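(* Let $f\in\mathbb{R}_{\ge0}[x_1^{\pm1},\dots,x_m^{\pm1}]$, $m\ge1$, be a convenient Laurent polynomial with nonnegative coefficients. Let $r=r(f)\ge1$ be the unique natural number such that $\mathrm{Cst}(f^n)=0$ if $r\nmid n$ and $\mathrm{Cst}(f^{rn})>0$ for all but finitely many $n\ge0$, and let $T_{\mathrm{con}}=\min_{\mathbf x\in(\mathbb{R}_{>0})^m}f(\mathbf x)$ be the conifold value. Then $$\lim_{n\to\infty}\big(\mathrm{Cst}(f^{rn})\big)^{1/(rn)}=T_{\mathrm{con}}.$$ In particular, the convergence radius of the constant term series $\widehat G(t):=\sum_{n=0}^\infty\mathrm{Cst}(f^n)t^n$ equals $T_{\mathrm{con}}^{-1}$. Furthermore, $\widehat G(t)$ can be extended to a multi-valued analytic function on a punctured neighbourhood of $t=T_{\mathrm{con}}^{-1}$ and has nontrivial monodromy at $T_{\mathrm{con}}^{-1}$.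
   Context: $\mathrm{Cst}(g)$ denotes the constant term of a Laurent polynomial $g$. A Laurent polynomial is convenient if its Newton polytope (the convex hull in $\mathbb{R}^m$ of the exponents with nonzero coefficient) contains the origin in its interior. For convenient $f$ with nonnegative coefficients the integer $r(f)$ exists and is unique, and $f|_{(\mathbb{R}_{>0})^m}$ attains a positive minimum, at its unique critical point. *)

theory Defs
  imports "HOL-Analysis.Analysis" "HOL-Library.Poly_Mapping"
begin

text \<open>
  A real Laurent polynomial in variables indexed by the finite type \<open>'m\<close> is an element of the
  group ring of the lattice \<open>int ^ 'm\<close>. The multiplication of \<open>poly_mapping\<close> is convolution of
  coefficients, so \<open>f ^ n\<close> is the power as a Laurent polynomial.
\<close>

type_synonym 'm laurent = "(int ^ 'm) \<Rightarrow>\<^sub>0 real"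

definition Cst :: "'m::finite laurent \<Rightarrow> real" where
  "Cst f = Poly_Mapping.lookup f 0"

definition newton_polytope :: "'m::finite laurent \<Rightarrow> (real ^ 'm) set" where
  "newton_polytope f = convex hull ((\<lambda>a. \<chi> i. real_of_int (a $ i)) ` Poly_Mapping.keys f)"

definition convenient :: "'m::finite laurent \<Rightarrow> bool" where
  "convenient f \<longleftrightarrow> 0 \<in> interior (newton_polytope f)"

definition laurent_eval :: "'m::finite laurent \<Rightarrow> real ^ 'm \<Rightarrow> real" where
  "laurent_eval f x = (\<Sum>a\<in>Poly_Mapping.keys f. Poly_Mapping.lookup f a * (\<Prod>i\<in>UNIV. (x $ i) powi (a $ i)))"

definition period :: "'m::finite laurent \<Rightarrow> nat" where
  "period f = (THE r. r \<ge> 1 \<and> (\<forall>n. \<not> r dvd n \<longrightarrow> Cst (f ^ n) = 0)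
                            \<and> (\<forall>\<^sub>\<infinity>n. Cst (f ^ (r * n)) > 0))"

text \<open>On a set of reals, \<open>LEAST\<close> is the minimum (an attained lower bound), not the infimum.\<close>

definition conifold_value :: "'m::finite laurent \<Rightarrow> real" where
  "conifold_value f = (LEAST T. T \<in> laurent_eval f ` {x. \<forall>i. x $ i > 0})"

definition constant_term_series :: "'m::finite laurent \<Rightarrow> complex fps" where
  "constant_term_series f = Abs_fps (\<lambda>n. complex_of_real (Cst (f ^ n)))"

text \<open>
  Analytic continuation along a path \<open>\<gamma>\<close> parametrised by \<open>{0..1}\<close>. Only the germ of \<open>F s\<close> at the
  point \<open>\<gamma> s\<close> matters; for nearby parameters \<open>s'\<close> the germ of \<open>F s'\<close> at \<open>\<gamma> s'\<close> must be the one
  induced by the function element \<open>F s\<close>.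
\<close>

definition same_germ :: "complex \<Rightarrow> (complex \<Rightarrow> complex) \<Rightarrow> (complex \<Rightarrow> complex) \<Rightarrow> bool" where
  "same_germ a g h \<longleftrightarrow> (\<forall>\<^sub>F z in nhds a. g z = h z)"

definition continuation_along :: "(real \<Rightarrow> complex) \<Rightarrow> (real \<Rightarrow> complex \<Rightarrow> complex) \<Rightarrow> bool" where
  "continuation_along \<gamma> F \<longleftrightarrow> path \<gamma> \<and>
     (\<forall>s\<in>{0..1}. F s analytic_on {\<gamma> s} \<and>
        (\<forall>\<^sub>F s' in at s within {0..1}. same_germ (\<gamma> s') (F s') (F s)))"

text \<open>
  The function \<open>g\<close> on \<open>D\<close> extends to a multi-valued analytic function on \<open>U\<close>: each germ of \<open>g\<close> at a
  point of \<open>D \<inter> U\<close> can be continued along every path in \<open>U\<close>. Intended for \<open>D \<inter> U\<close> nonempty and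
  connected and \<open>U\<close> open and connected, so that these germs lie on a single multi-valued function.
\<close>

definition extends_multivalued ::
    "(complex \<Rightarrow> complex) \<Rightarrow> complex set \<Rightarrow> complex set \<Rightarrow> bool" where
  "extends_multivalued g D U \<longleftrightarrow>
     (\<forall>\<gamma>. path \<gamma> \<and> path_image \<gamma> \<subseteq> U \<and> pathstart \<gamma> \<in> D \<longrightarrow>
        (\<exists>F. continuation_along \<gamma> F \<and> same_germ (pathstart \<gamma>) (F 0) g))"

text \<open>
  Nontrivial monodromy at \<open>p\<close> of the multi-valued extension of \<open>g\<close> (given on \<open>D\<close>) to the punctured
  disc \<open>ball p \<epsilon> - {p}\<close>: continuation once around \<open>p\<close>, along the circle centred at \<open>p\<close> (which
  generates the fundamental group of the punctured disc), changes some germ of \<open>g\<close>.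
\<close>

definition nontrivial_monodromy ::
    "(complex \<Rightarrow> complex) \<Rightarrow> complex set \<Rightarrow> complex \<Rightarrow> real \<Rightarrow> bool" where
  "nontrivial_monodromy g D p \<epsilon> \<longleftrightarrow>
     (\<exists>a F. a \<in> D \<inter> (ball p \<epsilon> - {p}) \<and>
        continuation_along (\<lambda>s. p + (a - p) * cis (2 * pi * s)) F \<and>
        same_germ a (F 0) g \<and> \<not> same_germ a (F 1) g)"

end

theory Submission
  imports Defs "HOL-Complex_Analysis.Complex_Analysis"
begin

text \<open>
  Let \<open>\<xi>0\<close> be the logarithm of the minimum point of \<open>f\<close> on the positive orthant and \<open>T\<close> the minimum. On
  the torus through that point \<open>f\<close> becomes \<open>g \<theta> = (\<Sum>a. c a * exp (\<i> * (\<theta> \<bullet> a)))\<close> with positive weights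
  \<open>c a\<close> of total mass \<open>T\<close>, and criticality says that \<open>(\<Sum>a. c a * a) = 0\<close>. By orthogonality of characters
  \<open>Cst (f ^ n)\<close> is the mean of \<open>g ^ n\<close>; hence \<open>Cst (f ^ n) \<le> T ^ n\<close>, and the constant term series
  \<open>G t\<close> is the mean of \<open>1 / (1 - t * g)\<close> for \<open>\<bar>t\<bar> < 1 / T\<close>.

  As \<open>t\<close> tends to \<open>1 / T\<close>, only the points with \<open>g \<theta> = T\<close> matter. They form a discrete group of periods
  of \<open>g\<close>, so each of them contributes the same local integral as \<open>\<theta> = 0\<close>, and the rest of the torus
  contributes a function that is holomorphic at \<open>1 / T\<close> (\<open>constant_term_decomposition\<close>).

  The local integral is reduced to one variable by polar coordinates (\<open>integral_polar_ball\<close>). On the ray in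
  direction \<open>u\<close> write \<open>T - g (\<rho> u) = y\<^sup>2\<close> with \<open>y = \<rho> * s u \<rho>\<close>; since \<open>\<theta> = 0\<close> is a nondegenerate maximum
  of \<open>Re g\<close>, \<open>y\<close> is a holomorphic coordinate in the place of \<open>\<rho>\<close>, on a disc that does not depend on \<open>u\<close>. With
  \<open>w = 1 / t - T\<close> one has \<open>1 - t * g = t * (w + y\<^sup>2)\<close>, so the integral over the ray is that of
  \<open>\<kappa> y / (w + y\<^sup>2)\<close> for a holomorphic density \<open>\<kappa>\<close>, up to the factor \<open>1 / t\<close>. Partial fractions
  with the poles \<open>\<plusminus>\<i> * sqrt w\<close> and a primitive involving logarithms evaluate it as a function of
  \<open>l = ln w / 2\<close> that is holomorphic on a whole left half-plane (\<open>local_part_expansion\<close>). Altogether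
  \<open>G t = A t + \<Lambda> (ln (1 / t - T) / 2)\<close>, where \<open>A\<close> is holomorphic at \<open>1 / T\<close>.

  Turning once around \<open>1 / T\<close> adds \<open>\<pi> * \<i>\<close> to \<open>l\<close>, which exchanges the two poles. The resulting change of \<open>\<Lambda>\<close>
  is, up to a nonvanishing factor, the residue \<open>\<kappa> (\<i> * exp l)\<close>; averaged over all directions it is still not zero,
  because its leading coefficient is an average of positive numbers. From this representation
  everything about \<open>G\<close> is formal (locale \<open>log_singularity\<close>): a continuous choice of \<open>ln (1 / t - T)\<close> along a path
  continues \<open>G\<close>, the monodromy is nontrivial, and the radius of convergence cannot exceed \<open>1 / T\<close>, as
  otherwise \<open>\<Lambda>\<close> would have the period \<open>\<pi> * \<i>\<close>.

  The limit of the roots follows from the radius, which provides arbitrarily good lower bounds for single constant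
  terms, and from \<open>Cst (f ^ m) * Cst (f ^ n) \<le> Cst (f ^ (m + n))\<close>, which spreads these bounds
  to all large multiples of the period (\<open>root_tendsto\<close>).
\<close>

section \<open>Holomorphic dependence of integrals on a parameter\<close>

text \<open>
  A Cauchy estimate and the mean value inequality bound the difference quotients of \<open>\<Phi> u\<close> at a point uniformly
  in \<open>u\<close>. By dominated convergence the integral is complex differentiable.
\<close>
lemma holomorphic_on_set_integral:
  fixes \<Phi> :: "'a::topological_space \<Rightarrow> complex \<Rightarrow> complex"
  assumes sets: "sets M = sets borel" and X: "X \<in> sets borel" and fin: "emeasure M X < \<infinity>"
    and U: "open U"
    and cont: "\<And>z. z \<in> U \<Longrightarrow> continuous_on X (\<lambda>u. \<Phi> u z)"
    and hol: "\<And>u. u \<in> X \<Longrightarrow> \<Phi> u holomorphic_on U"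
    and bd: "\<And>u z. u \<in> X \<Longrightarrow> z \<in> U \<Longrightarrow> norm (\<Phi> u z) \<le> C"
  shows "(\<lambda>z. LINT u:X|M. \<Phi> u z) holomorphic_on U"
proof -
  have meas: "(\<lambda>u. indicator X u *\<^sub>R \<Phi> u z) \<in> borel_measurable M" if "z \<in> U" for z
    using borel_measurable_continuous_on_indicator[OF X cont[OF that]]
    by (simp add: measurable_cong_sets[OF sets refl])
  have int: "integrable M (\<lambda>u. indicator X u *\<^sub>R (\<Phi> u z))" if "z \<in> U" for z
  proof (rule Bochner_Integration.integrable_bound)
    show "integrable M (\<lambda>u. indicator X u *\<^sub>R C)"
      using fin X sets by (intro integrable_scaleR_left) auto
    show "AE x in M. norm (indicat_real X x *\<^sub>R \<Phi> x z) \<le> norm (indicat_real X x *\<^sub>R C)"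
      using bd[OF _ that] by (force simp: indicator_def intro!: AE_I2)
  qed (rule meas[OF that])
  have "\<exists>D. ((\<lambda>z. LINT u:X|M. \<Phi> u z) has_field_derivative D) (at z0)" if z0: "z0 \<in> U" for z0
  proof -
    obtain r where r: "r > 0" "cball z0 (2*r) \<subseteq> U"
      using U z0 unfolding open_contains_cball
      by (metis field_sum_of_halves mult_2 half_gt_zero)
    have cb: "cball z r \<subseteq> U" if "z \<in> cball z0 r" for z
    proof
      fix y assume "y \<in> cball z r"
      then have "dist z0 y \<le> 2*r" using that dist_triangle[of z0 y z] by auto
      then show "y \<in> U" using r by auto
    qed
    have Db: "norm (deriv (\<Phi> u) z) \<le> C / r" if u: "u \<in> X" and z: "z \<in> cball z0 r" for u z
    proof -
      have "norm ((deriv ^^ 1) (\<Phi> u) z) \<le> fact 1 * C / r ^ 1"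
      proof (rule Cauchy_inequality)
        show "\<Phi> u holomorphic_on ball z r"
          using hol[OF u] cb[OF z] by (meson ball_subset_cball holomorphic_on_subset)
        show "continuous_on (cball z r) (\<Phi> u)"
          using hol[OF u] cb[OF z] by (meson holomorphic_on_imp_continuous_on continuous_on_subset)
        show "norm (\<Phi> u x) \<le> C" if "norm (z - x) = r" for x
          using bd[OF u] cb[OF z] that by (auto simp: dist_norm)
      qed (use r in auto)
      then show ?thesis by simp
    qed
    have qb: "norm ((\<Phi> u z - \<Phi> u z0) / (z - z0)) \<le> C / r"
      if u: "u \<in> X" and z: "z \<in> cball z0 r" "z \<noteq> z0" for u z
    proof -
      have "norm (\<Phi> u z - \<Phi> u z0) \<le> C / r * norm (z - z0)"
      proof (rule field_differentiable_bound[where S = "cball z0 r" and f' = "deriv (\<Phi> u)"])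
        show "(\<Phi> u has_field_derivative deriv (\<Phi> u) y) (at y within cball z0 r)"
          if "y \<in> cball z0 r" for y
          using hol[OF u] U cb[OF that] r
          by (meson centre_in_cball holomorphic_derivI less_imp_le subsetD)
      qed (use Db u z r in auto)
      then show ?thesis using z by (simp add: norm_divide pos_divide_le_eq)
    qed
    have lim: "((\<lambda>z. (\<Phi> u z - \<Phi> u z0) / (z - z0)) \<longlongrightarrow> deriv (\<Phi> u) z0) (at z0)" if "u \<in> X" for u
      using hol[OF that] U z0 holomorphic_derivI[of "\<Phi> u" U z0] by (simp add: has_field_derivative_iff)
    define D where "D = (LINT u:X|M. deriv (\<Phi> u) z0)"
    have "((\<lambda>y. ((LINT u:X|M. \<Phi> u y) - (LINT u:X|M. \<Phi> u z0)) / (y - z0)) \<longlongrightarrow> D) (at z0)"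
    proof (subst tendsto_at_iff_sequentially, intro allI impI)
      fix s assume s: "\<forall>i. s i \<in> UNIV - {z0}" "s \<longlonglongrightarrow> z0"
      have ev: "eventually (\<lambda>i. s i \<in> cball z0 r) sequentially"
        using topological_tendstoD[OF s(2), of "ball z0 r"] r(1) by (auto elim!: eventually_mono)
      then obtain n0 where n0: "\<And>i. i \<ge> n0 \<Longrightarrow> s i \<in> cball z0 r" by (auto simp: eventually_sequentially)
      \<comment> \<open>the first \<open>n0\<close> terms are skipped because domination is required for every index\<close>
      define q where "q i u = indicator X u *\<^sub>R ((\<Phi> u (s (i+n0)) - \<Phi> u z0) / (s (i+n0) - z0))" for i u
      have sU: "s (i+n0) \<in> U" for i using cb[OF n0[of "i+n0"]] r by auto
      have qm: "q i \<in> borel_measurable M" for i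
      proof -
        have "q i = (\<lambda>u. (indicator X u *\<^sub>R \<Phi> u (s (i+n0)) - indicator X u *\<^sub>R \<Phi> u z0) / (s (i+n0) - z0))"
          by (auto simp: q_def fun_eq_iff indicator_def)
        then show ?thesis using meas[OF sU[of i]] meas[OF z0] by simp
      qed
      have ql: "(\<lambda>i. q i u) \<longlonglongrightarrow> indicator X u *\<^sub>R deriv (\<Phi> u) z0" for u
      proof (cases "u \<in> X")
        case True
        have "((\<lambda>z. (\<Phi> u z - \<Phi> u z0) / (z - z0)) \<circ> s) \<longlonglongrightarrow> deriv (\<Phi> u) z0"
          using lim[OF True] s by (subst (asm) tendsto_at_iff_sequentially) blast
        from LIMSEQ_ignore_initial_segment[OF this, of n0] show ?thesis using True by (simp add: q_def o_def)
      qed (simp add: q_def)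
      have dm: "(\<lambda>u. indicator X u *\<^sub>R deriv (\<Phi> u) z0) \<in> borel_measurable M"
        by (rule borel_measurable_LIMSEQ_metric[OF qm ql])
      have "(\<lambda>i. LINT u|M. q i u) \<longlonglongrightarrow> (LINT u|M. indicator X u *\<^sub>R deriv (\<Phi> u) z0)"
      proof (rule integral_dominated_convergence[where w = "\<lambda>u. indicator X u *\<^sub>R (C / r)"])
        show "integrable M (\<lambda>u. indicat_real X u *\<^sub>R (C / r))"
          using fin X sets by (intro integrable_scaleR_left) auto
        show "AE u in M. norm (q i u) \<le> indicat_real X u *\<^sub>R (C / r)" for i
          using qb n0[of "i+n0"] s(1) by (auto simp: q_def indicator_def intro!: AE_I2)
      qed (use qm dm ql in auto)
      moreover have "(LINT u|M. q i u) =
          ((LINT u:X|M. \<Phi> u (s (i+n0))) - (LINT u:X|M. \<Phi> u z0)) / (s (i+n0) - z0)" for i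
      proof -
        have "q i = (\<lambda>u. (indicator X u *\<^sub>R \<Phi> u (s (i+n0)) - indicator X u *\<^sub>R \<Phi> u z0) / (s (i+n0) - z0))"
          by (auto simp: q_def fun_eq_iff indicator_def)
        then show ?thesis using int[OF sU[of i]] int[OF z0] by (simp add: set_lebesgue_integral_def)
      qed
      ultimately have "(\<lambda>i. ((LINT u:X|M. \<Phi> u (s (i+n0))) - (LINT u:X|M. \<Phi> u z0)) / (s (i+n0) - z0)) \<longlonglongrightarrow> D"
        by (simp add: D_def set_lebesgue_integral_def)
      then show "((\<lambda>y. ((LINT u:X|M. \<Phi> u y) - (LINT u:X|M. \<Phi> u z0)) / (y - z0)) \<circ> s) \<longlonglongrightarrow> D"
        by - (rule LIMSEQ_offset[where k=n0], simp add: o_def)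
    qed
    then show ?thesis by (auto simp: has_field_derivative_iff)
  qed
  then show ?thesis
    by (intro holomorphic_onI) (meson field_differentiable_at_within field_differentiable_def)
qed

section \<open>Polar coordinates\<close>

text \<open>
  The cone measure: a set of unit vectors is measured by the volume of the cone over it, times the
  dimension. This is the surface measure of the sphere.
\<close>
definition sphere_measure :: "'a::euclidean_space measure" where
  "sphere_measure = distr (density lborel (\<lambda>\<omega>. ennreal (real DIM('a) * indicator (cball 0 1) \<omega>))) borel sgn"

lemma sets_sphere_measure [simp, measurable_cong]: "sets (sphere_measure :: 'a::euclidean_space measure) = sets borel"
  by (simp add: sphere_measure_def)

lemma space_sphere_measure [simp]: "space (sphere_measure :: 'a::euclidean_space measure) = UNIV"
  by (simp add: sphere_measure_def)

lemma nn_integral_sphere_measure: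
  fixes g :: "'a::euclidean_space \<Rightarrow> ennreal"
  assumes [measurable]: "g \<in> borel_measurable borel"
  shows "(\<integral>\<^sup>+u. g u \<partial>sphere_measure) =
    (\<integral>\<^sup>+\<omega>. ennreal (real DIM('a) * indicator (cball 0 1) \<omega>) * g (sgn \<omega>) \<partial>lborel)"
proof -
  have "(\<integral>\<^sup>+u. g u \<partial>sphere_measure) =
    (\<integral>\<^sup>+\<omega>. g (sgn \<omega>) \<partial>density lborel (\<lambda>\<omega>::'a. ennreal (real DIM('a) * indicator (cball 0 1) \<omega>)))"
    unfolding sphere_measure_def by (rule nn_integral_distr) auto
  also have "\<dots> = (\<integral>\<^sup>+\<omega>. ennreal (real DIM('a) * indicator (cball 0 1) \<omega>) * g (sgn \<omega>) \<partial>lborel)"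
    by (rule nn_integral_density)
       (auto intro!: measurable_compose[OF _ measurable_ennreal] borel_measurable_times borel_measurable_indicator borel_measurable_const)
  finally show ?thesis .
qed

lemma finite_measure_sphere_measure: "finite_measure (sphere_measure :: 'a::euclidean_space measure)"
proof
  have "(\<integral>\<^sup>+u. 1 \<partial>(sphere_measure :: 'a measure)) = ennreal (real DIM('a)) * emeasure lborel (cball (0::'a) 1)"
    by (subst nn_integral_sphere_measure) (simp_all add: ennreal_mult' nn_integral_cmult_indicator ennreal_indicator)
  moreover have "emeasure lborel (cball (0::'a) 1) < \<infinity>"
    by (rule emeasure_lborel_cball_finite)
  ultimately show "emeasure sphere_measure (space (sphere_measure :: 'a measure)) \<noteq> \<infinity>"
    by (simp add: ennreal_mult_eq_top_iff)
qed

definition radial_weight :: "nat \<Rightarrow> real \<Rightarrow> real" where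
  "radial_weight d \<rho> = indicator {0<..} \<rho> * \<rho> ^ (d - 1)"

lemma borel_measurable_radial_weight [measurable]: "radial_weight d \<in> borel_measurable borel"
  unfolding radial_weight_def by measurable

lemma radial_weight_nonneg [simp]: "radial_weight d \<rho> \<ge> 0"
  by (auto simp: radial_weight_def indicator_def)

text \<open>
  The mass that exchanging the integrals in the next lemma leaves on a point at distance \<open>c\<close> from the
  origin. Its value 1 is what the factor \<open>DIM('a)\<close> in the cone measure achieves.
\<close>
lemma nn_integral_inverse_power_tail:
  fixes c :: real
  assumes "c > 0" "d > 0"
  shows "(\<integral>\<^sup>+s. ennreal (real d * c ^ d / s ^ Suc d * indicator {c..} s) \<partial>lborel) = 1"
proof -
  have "(\<integral>\<^sup>+s. ennreal (real d * c ^ d / s ^ Suc d) * indicator {c..} s \<partial>lborel) = ennreal (0 - (- (c ^ d / c ^ d)))"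
  proof (rule nn_integral_FTC_atLeast[where F = "\<lambda>s. - (c ^ d / s ^ d)"])
    show "((\<lambda>s. - (c ^ d / s ^ d)) has_real_derivative real d * c ^ d / s ^ Suc d) (at s)"
      if "c \<le> s" for s
      using that assms
      by (auto intro!: derivative_eq_intros simp: field_simps power_diff)
    show "((\<lambda>s. - (c ^ d / s ^ d)) \<longlongrightarrow> 0) at_top"
    proof -
      have "((\<lambda>s. - (c ^ d * inverse s ^ d)) \<longlongrightarrow> - (c ^ d * 0 ^ d)) at_top"
        by (intro tendsto_intros tendsto_inverse_0_at_top filterlim_ident)
      then show ?thesis using assms by (simp add: zero_power field_simps)
    qed
  qed (use assms in auto)
  moreover have "(\<lambda>s. ennreal (real d * c ^ d / s ^ Suc d) * indicator {c..} s) =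
      (\<lambda>s. ennreal (real d * c ^ d / s ^ Suc d * indicator {c..} s))"
    by (auto simp: fun_eq_iff indicator_def)
  ultimately show ?thesis using assms by simp
qed

text \<open>
  The cone measure averages over the points \<open>\<omega>\<close> of the unit ball, with direction \<open>sgn \<omega>\<close>. Rescaling \<open>\<rho>\<close> by \<open>norm \<omega>\<close>
  turns \<open>\<rho> *\<^sub>R sgn \<omega>\<close> into \<open>s *\<^sub>R \<omega>\<close>; for fixed \<open>s\<close> one substitutes \<open>\<theta> = s *\<^sub>R \<omega>\<close>, and integrating over \<open>s\<close>
  first leaves the weight 1 on every \<open>\<theta>\<close> other than 0.
\<close>
lemma nn_integral_polar:
  fixes f :: "'a::euclidean_space \<Rightarrow> ennreal"
  assumes [measurable]: "f \<in> borel_measurable borel"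
  shows "(\<integral>\<^sup>+u. (\<integral>\<^sup>+\<rho>. ennreal (radial_weight DIM('a) \<rho>) * f (\<rho> *\<^sub>R u) \<partial>lborel) \<partial>sphere_measure)
     = (\<integral>\<^sup>+\<theta>. f \<theta> \<partial>lborel)"
proof -
  let ?d = "DIM('a)" and ?W = "radial_weight DIM('a)"
  let ?k = "\<lambda>\<theta>::'a. \<lambda>s. ennreal (real ?d * norm \<theta> ^ ?d / s ^ Suc ?d * indicator {max 0 (norm \<theta>)..} s * indicator {0<..} s)"
  have dp: "?d > 0" by simp
  define B where "B \<omega> = real ?d * indicator (cball 0 1) \<omega> * norm \<omega> ^ ?d" for \<omega> :: 'a
  have [measurable]: "B \<in> borel_measurable borel" unfolding B_def
    by (intro borel_measurable_times borel_measurable_power borel_measurable_norm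
        borel_measurable_indicator borel_measurable_const) auto
  have B0: "B \<omega> \<ge> 0" for \<omega> by (auto simp: B_def indicator_def)
  have scal: "(\<integral>\<^sup>+\<rho>. ennreal (?W \<rho>) * f (\<rho> *\<^sub>R sgn \<omega>) \<partial>lborel) =
      ennreal (norm \<omega> ^ ?d) * (\<integral>\<^sup>+s. ennreal (?W s) * f (s *\<^sub>R \<omega>) \<partial>lborel)" if "\<omega> \<noteq> 0" for \<omega> :: 'a
  proof -
    have "(\<integral>\<^sup>+\<rho>. ennreal (?W \<rho>) * f (\<rho> *\<^sub>R sgn \<omega>) \<partial>lborel) =
       ennreal \<bar>norm \<omega>\<bar> * (\<integral>\<^sup>+s. ennreal (?W (0 + norm \<omega> * s)) * f ((0 + norm \<omega> * s) *\<^sub>R sgn \<omega>) \<partial>lborel)"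
      using that by (intro nn_integral_real_affine) auto
    also have "(\<lambda>s. ennreal (?W (0 + norm \<omega> * s)) * f ((0 + norm \<omega> * s) *\<^sub>R sgn \<omega>)) =
        (\<lambda>s. ennreal (norm \<omega> ^ (?d - 1)) * (ennreal (?W s) * f (s *\<^sub>R \<omega>)))"
    proof
      fix s
      have "?W (0 + norm \<omega> * s) = norm \<omega> ^ (?d - 1) * ?W s"
        using that by (auto simp: radial_weight_def indicator_def power_mult_distrib zero_less_mult_iff)
      moreover have "(0 + norm \<omega> * s) *\<^sub>R sgn \<omega> = s *\<^sub>R \<omega>"
        using that by (simp add: sgn_div_norm)
      ultimately show "ennreal (?W (0 + norm \<omega> * s)) * f ((0 + norm \<omega> * s) *\<^sub>R sgn \<omega>) =
         ennreal (norm \<omega> ^ (?d - 1)) * (ennreal (?W s) * f (s *\<^sub>R \<omega>))"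
        by (simp add: ennreal_mult mult.assoc)
    qed
    also have "ennreal \<bar>norm \<omega>\<bar> * (\<integral>\<^sup>+s. ennreal (norm \<omega> ^ (?d - 1)) * (ennreal (?W s) * f (s *\<^sub>R \<omega>)) \<partial>lborel) =
       ennreal (norm \<omega> ^ ?d) * (\<integral>\<^sup>+s. ennreal (?W s) * f (s *\<^sub>R \<omega>) \<partial>lborel)"
      using dp by (subst nn_integral_cmult) (auto simp: ennreal_mult[symmetric] mult.assoc[symmetric] simp flip: power_Suc)
    finally show ?thesis .
  qed
  have "(\<integral>\<^sup>+u. (\<integral>\<^sup>+\<rho>. ennreal (?W \<rho>) * f (\<rho> *\<^sub>R u) \<partial>lborel) \<partial>sphere_measure) =
     (\<integral>\<^sup>+\<omega>. ennreal (real ?d * indicator (cball 0 1) \<omega>) *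
         (\<integral>\<^sup>+\<rho>. ennreal (?W \<rho>) * f (\<rho> *\<^sub>R sgn \<omega>) \<partial>lborel) \<partial>lborel)"
    by (rule nn_integral_sphere_measure) measurable
  also have "\<dots> = (\<integral>\<^sup>+\<omega>. (\<integral>\<^sup>+s. ennreal (B \<omega>) * (ennreal (?W s) * f (s *\<^sub>R \<omega>)) \<partial>lborel) \<partial>lborel)"
  proof (rule nn_integral_cong_AE)
    show "AE \<omega> in lborel. ennreal (real ?d * indicator (cball 0 1) \<omega>) *
         (\<integral>\<^sup>+\<rho>. ennreal (?W \<rho>) * f (\<rho> *\<^sub>R sgn \<omega>) \<partial>lborel) =
         (\<integral>\<^sup>+s. ennreal (B \<omega>) * (ennreal (?W s) * f (s *\<^sub>R \<omega>)) \<partial>lborel)"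
      using AE_lborel_singleton[of "0::'a"]
    proof eventually_elim
      case (elim \<omega>)
      then show ?case
        by (subst nn_integral_cmult) (auto simp: scal B_def ennreal_mult mult.assoc)
    qed
  qed
  also have "\<dots> = (\<integral>\<^sup>+s. (\<integral>\<^sup>+\<omega>. ennreal (B \<omega>) * (ennreal (?W s) * f (s *\<^sub>R \<omega>)) \<partial>lborel) \<partial>lborel)"
    by (rule lborel_pair.Fubini') measurable
  also have "\<dots> = (\<integral>\<^sup>+s. (\<integral>\<^sup>+\<theta>. f \<theta> * ?k \<theta> s \<partial>lborel) \<partial>lborel)"
  proof (rule nn_integral_cong)
    fix s :: real
    show "(\<integral>\<^sup>+\<omega>. ennreal (B \<omega>) * (ennreal (?W s) * f (s *\<^sub>R \<omega>)) \<partial>lborel) =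
      (\<integral>\<^sup>+\<theta>. f \<theta> * ?k \<theta> s \<partial>lborel)"
    proof (cases "s > 0")
      case True
      define h where "h \<theta> = f \<theta> * ?k \<theta> s" for \<theta>
      have [measurable]: "h \<in> borel_measurable borel"
      proof -
        have "h = (\<lambda>\<theta>. f \<theta> * ennreal (real ?d * norm \<theta> ^ ?d / s ^ Suc ?d * indicator (cball 0 s) \<theta> * indicator {0<..} s))"
          using True by (auto simp: h_def fun_eq_iff indicator_def)
        then show ?thesis
          by (simp only:)
             (intro borel_measurable_times borel_measurable_times_ennreal assms
               measurable_compose[OF _ measurable_ennreal] borel_measurable_divide
               borel_measurable_power borel_measurable_norm
               borel_measurable_indicator borel_measurable_const; simp)
      qed
      have "(\<integral>\<^sup>+\<theta>. h \<theta> \<partial>lborel) = (\<integral>\<^sup>+\<theta>. h \<theta> \<partial>(density (distr lborel borel (\<lambda>x::'a. 0 + s *\<^sub>R x)) (\<lambda>_. \<bar>s\<bar> ^ ?d)))"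
        using True lborel_affine[of s "0::'a"] by simp
      also have "\<dots> = (\<integral>\<^sup>+\<omega>. ennreal (s ^ ?d) * h (s *\<^sub>R \<omega>) \<partial>lborel)"
        using True by (subst nn_integral_density) (auto simp: nn_integral_distr)
      also have "\<dots> = (\<integral>\<^sup>+\<omega>. ennreal (B \<omega>) * (ennreal (?W s) * f (s *\<^sub>R \<omega>)) \<partial>lborel)"
      proof (rule nn_integral_cong)
        fix \<omega> :: 'a
        obtain e where e: "?d = Suc e" using dp gr0_implies_Suc by blast
        have "s ^ ?d * (real ?d * norm (s *\<^sub>R \<omega>) ^ ?d / s ^ Suc ?d * indicator {max 0 (norm (s *\<^sub>R \<omega>))..} s * indicator {0<..} s) = B \<omega> * ?W s"
          using True by (auto simp: B_def radial_weight_def indicator_def power_mult_distrib field_simps e)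
        then show "ennreal (s ^ ?d) * h (s *\<^sub>R \<omega>) = ennreal (B \<omega>) * (ennreal (?W s) * f (s *\<^sub>R \<omega>))"
          using True B0[of \<omega>] unfolding h_def
          by (simp add: ennreal_mult[symmetric] mult.assoc[symmetric]) (simp add: ennreal_mult[symmetric] mult_ac)
      qed
      finally show ?thesis by (simp add: h_def)
    qed (auto simp: radial_weight_def)
  qed
  also have "\<dots> = (\<integral>\<^sup>+\<theta>. (\<integral>\<^sup>+s. f \<theta> * ?k \<theta> s \<partial>lborel) \<partial>lborel)"
  proof (rule lborel_pair.Fubini')
    have "(\<lambda>(\<theta>, s). f \<theta> * ?k \<theta> s) =
      (\<lambda>x. f (fst x) * ennreal (real ?d * norm (fst x) ^ ?d / snd x ^ Suc ?d * (if norm (fst x) \<le> snd x \<and> 0 < snd x then 1 else 0)))"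
      by (auto simp: fun_eq_iff indicator_def)
    also have "\<dots> \<in> borel_measurable (lborel \<Otimes>\<^sub>M lborel)" by measurable
    finally show "(\<lambda>(\<theta>, s). f \<theta> * ?k \<theta> s)
       \<in> borel_measurable (lborel \<Otimes>\<^sub>M lborel)" .
  qed
  also have "\<dots> = (\<integral>\<^sup>+\<theta>. f \<theta> \<partial>lborel)"
  proof (rule nn_integral_cong_AE)
    show "AE \<theta> in lborel. (\<integral>\<^sup>+s. f \<theta> * ?k \<theta> s \<partial>lborel) = f \<theta>"
      using AE_lborel_singleton[of "0::'a"]
    proof eventually_elim
      case (elim \<theta>)
      have E: "(\<lambda>s. f \<theta> * ?k \<theta> s) =
         (\<lambda>s. f \<theta> * ennreal (real ?d * norm \<theta> ^ ?d / s ^ Suc ?d * indicator {norm \<theta>..} s))"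
        using elim order_less_le_trans[of 0 "norm \<theta>"] by (auto simp: fun_eq_iff indicator_def)
      have "(\<integral>\<^sup>+s. f \<theta> * ennreal (real ?d * norm \<theta> ^ ?d / s ^ Suc ?d * indicator {norm \<theta>..} s) \<partial>lborel) =
        f \<theta> * (\<integral>\<^sup>+s. ennreal (real ?d * norm \<theta> ^ ?d / s ^ Suc ?d * indicator {norm \<theta>..} s) \<partial>lborel)"
        by (rule nn_integral_cmult) measurable
      moreover have "(\<integral>\<^sup>+s. ennreal (real ?d * norm \<theta> ^ ?d / s ^ Suc ?d * indicator {norm \<theta>..} s) \<partial>lborel) = 1"
        by (rule nn_integral_inverse_power_tail) (use elim in auto)
      ultimately show ?case unfolding E by (simp only: mult_1_right)
    qed
  qed
  finally show ?thesis .
qed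

lemma AE_sphere_measure_sphere: "AE u in (sphere_measure :: 'a::euclidean_space measure). u \<in> sphere 0 1"
proof (rule AE_I)
  have cl: "closed (sphere (0::'a) 1)" by simp
  then have [measurable]: "- sphere (0::'a) 1 \<in> sets borel" by (simp add: borel_comp)
  have "emeasure sphere_measure (- sphere (0::'a) 1) = (\<integral>\<^sup>+u. indicator (- sphere (0::'a) 1) u \<partial>sphere_measure)"
    by simp
  also have "\<dots> = (\<integral>\<^sup>+\<omega>. ennreal (real DIM('a) * indicator (cball 0 1) \<omega>) * indicator (- sphere (0::'a) 1) (sgn \<omega>) \<partial>lborel)"
    by (rule nn_integral_sphere_measure) simp
  also have "\<dots> = (\<integral>\<^sup>+\<omega>. 0 \<partial>(lborel :: 'a measure))"
  proof (rule nn_integral_cong_AE)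
    show "AE \<omega> in lborel. ennreal (real DIM('a) * indicator (cball 0 1) \<omega>) * indicator (- sphere (0::'a) 1) (sgn \<omega>) = 0"
      using AE_lborel_singleton[of "0::'a"] by eventually_elim (simp add: norm_sgn)
  qed
  finally show "emeasure sphere_measure (- sphere (0::'a) 1) = 0" by simp
qed (auto simp: borel_comp)

text \<open>
  As an equation between measures, polar coordinates transfer to complex-valued integrals.
\<close>
lemma lborel_eq_polar:
  "(lborel :: 'a::euclidean_space measure) =
     distr (density (sphere_measure \<Otimes>\<^sub>M lborel) (\<lambda>x. ennreal (radial_weight DIM('a) (snd x)))) borel
       (\<lambda>x. snd x *\<^sub>R fst x)"
proof (rule measure_eqI)
  interpret S: finite_measure "sphere_measure :: 'a measure" by (rule finite_measure_sphere_measure)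
  let ?M = "(sphere_measure :: 'a measure) \<Otimes>\<^sub>M lborel"
  let ?D = "\<lambda>x. ennreal (radial_weight DIM('a) (snd x))" and ?h = "\<lambda>x::'a\<times>real. snd x *\<^sub>R fst x"
  fix A :: "'a set" assume "A \<in> sets lborel"
  then have [measurable]: "A \<in> sets borel" by simp
  have h: "?h \<in> borel_measurable ?M" by measurable
  have "emeasure (distr (density ?M ?D) borel ?h) A = (\<integral>\<^sup>+x. indicator A x \<partial>distr (density ?M ?D) borel ?h)"
    by simp
  also have "\<dots> = (\<integral>\<^sup>+x. indicator A (?h x) \<partial>density ?M ?D)"
    by (rule nn_integral_distr) (use h in auto)
  also have "\<dots> = (\<integral>\<^sup>+x. ?D x * indicator A (?h x) \<partial>?M)"
    by (rule nn_integral_density) measurable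
  also have "\<dots> = (\<integral>\<^sup>+u. (\<integral>\<^sup>+\<rho>. ?D (u,\<rho>) * indicator A (?h (u,\<rho>)) \<partial>lborel) \<partial>sphere_measure)"
    by (rule lborel.nn_integral_fst[symmetric]) measurable
  also have "\<dots> = (\<integral>\<^sup>+u. (\<integral>\<^sup>+\<rho>. ennreal (radial_weight DIM('a) \<rho>) * indicator A (\<rho> *\<^sub>R u) \<partial>lborel) \<partial>sphere_measure)"
    by simp
  also have "\<dots> = (\<integral>\<^sup>+\<theta>. indicator A \<theta> \<partial>lborel)"
    by (rule nn_integral_polar) simp
  finally show "emeasure lborel A = emeasure (distr (density ?M ?D) borel ?h) A" by simp
qed simp

lemma integral_polar_ball:
  fixes F :: "'a::euclidean_space \<Rightarrow> complex"
  assumes \<delta>: "\<delta> > 0" and F: "continuous_on (cball 0 \<delta>) F"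
  shows "(LINT \<theta>:ball 0 \<delta>|lborel. F \<theta>) =
    (LINT u:sphere 0 1|sphere_measure. integral {0..\<delta>} (\<lambda>\<rho>. of_real (\<rho> ^ (DIM('a) - 1)) * F (\<rho> *\<^sub>R u)))"
proof -
  interpret S: finite_measure "sphere_measure :: 'a measure" by (rule finite_measure_sphere_measure)
  let ?d = "DIM('a)"
  let ?M = "(sphere_measure :: 'a measure) \<Otimes>\<^sub>M lborel"
  let ?D = "\<lambda>x. radial_weight ?d (snd x)" and ?h = "\<lambda>x::'a\<times>real. snd x *\<^sub>R fst x"
  interpret P: pair_sigma_finite "sphere_measure :: 'a measure" "lborel :: real measure" ..
  define Fi where "Fi \<theta> = indicator (ball 0 \<delta>) \<theta> *\<^sub>R F \<theta>" for \<theta>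
  have "continuous_on (ball 0 \<delta>) F" using F by (rule continuous_on_subset) auto
  then have [measurable]: "Fi \<in> borel_measurable borel"
    unfolding Fi_def by (intro borel_measurable_continuous_on_indicator) auto
  have "set_integrable lborel (cball 0 \<delta>) F"
    unfolding set_integrable_def by (rule borel_integrable_compact) (use F in auto)
  then have "set_integrable lborel (ball 0 \<delta>) F" by (rule set_integrable_subset) auto
  then have FiI: "integrable lborel Fi" unfolding set_integrable_def Fi_def[abs_def] .
  have hM: "?h \<in> borel_measurable ?M" by measurable
  have hD: "?h \<in> borel_measurable (density ?M (\<lambda>x. ennreal (?D x)))" by measurable
  have "integrable (density ?M (\<lambda>x. ennreal (?D x))) (\<lambda>x. Fi (?h x))"
    using FiI by (subst (asm) lborel_eq_polar) (simp add: integrable_distr_eq[OF hD])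
  then have I: "integrable ?M (\<lambda>x. ?D x *\<^sub>R Fi (?h x))"
    by (subst (asm) integrable_density) auto
  define g where "g u = (LINT \<rho>|lborel. radial_weight ?d \<rho> *\<^sub>R Fi (\<rho> *\<^sub>R u))" for u
  have gm: "g \<in> borel_measurable sphere_measure" unfolding g_def by measurable
  have gval: "g u = integral {0..\<delta>} (\<lambda>\<rho>. of_real (\<rho> ^ (?d - 1)) * F (\<rho> *\<^sub>R u))" if u: "u \<in> sphere 0 1" for u
  proof -
    have c: "continuous_on {0..\<delta>} (\<lambda>\<rho>. of_real (\<rho> ^ (?d - 1)) * F (\<rho> *\<^sub>R u))"
      using u by (intro continuous_intros continuous_on_compose2[OF F]) auto
    have "set_integrable lborel {0..\<delta>} (\<lambda>\<rho>. of_real (\<rho> ^ (?d - 1)) * F (\<rho> *\<^sub>R u))"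
      unfolding set_integrable_def by (rule borel_integrable_compact) (use c in auto)
    then have si: "set_integrable lborel {0<..<\<delta>} (\<lambda>\<rho>. of_real (\<rho> ^ (?d - 1)) * F (\<rho> *\<^sub>R u))"
      by (rule set_integrable_subset) auto
    have "g u = (LINT \<rho>:{0<..<\<delta>}|lborel. of_real (\<rho> ^ (?d - 1)) * F (\<rho> *\<^sub>R u))"
      unfolding g_def set_lebesgue_integral_def
      using u by (intro Bochner_Integration.integral_cong)
        (auto simp: radial_weight_def Fi_def indicator_def scaleR_conv_of_real)
    also have "\<dots> = integral {0<..<\<delta>} (\<lambda>\<rho>. of_real (\<rho> ^ (?d - 1)) * F (\<rho> *\<^sub>R u))"
      by (rule set_borel_integral_eq_integral(2)[OF si])
    finally show ?thesis by (simp add: integral_open_interval_real)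
  qed
  have "(LINT \<theta>:ball 0 \<delta>|lborel. F \<theta>) = integral\<^sup>L lborel Fi"
    by (simp add: set_lebesgue_integral_def Fi_def[abs_def])
  also have "\<dots> = integral\<^sup>L (distr (density ?M (\<lambda>x. ennreal (?D x))) borel ?h) Fi"
    by (subst lborel_eq_polar) simp
  also have "\<dots> = (LINT x|density ?M (\<lambda>x. ennreal (?D x)). Fi (?h x))"
    by (rule integral_distr[OF hD]) simp
  also have "\<dots> = (LINT x|?M. ?D x *\<^sub>R Fi (?h x))"
    by (rule integral_density) auto
  also have "\<dots> = (LINT u|sphere_measure. g u)"
    using P.integral_fst'[OF I] by (simp add: g_def)
  also have "\<dots> = (LINT u:sphere 0 1|sphere_measure. g u)"
    unfolding set_lebesgue_integral_def
  proof (rule integral_cong_AE)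
    show "(\<lambda>u. indicat_real (sphere 0 1) u *\<^sub>R g u) \<in> borel_measurable sphere_measure"
      by (intro borel_measurable_scaleR borel_measurable_indicator gm) (auto simp: borel_closed)
    show "AE u in sphere_measure. g u = indicat_real (sphere 0 1) u *\<^sub>R g u"
      using AE_sphere_measure_sphere by eventually_elim simp
  qed (rule gm)
  also have "\<dots> = (LINT u:sphere 0 1|sphere_measure. integral {0..\<delta>} (\<lambda>\<rho>. of_real (\<rho> ^ (?d - 1)) * F (\<rho> *\<^sub>R u)))"
    unfolding set_lebesgue_integral_def
    using gval by (intro Bochner_Integration.integral_cong) (auto simp: indicator_def)
  finally show ?thesis .
qed

text \<open>
  Otherwise polar coordinates would give the unit ball measure zero.
\<close>
lemma measure_sphere_measure_pos: "measure (sphere_measure :: 'a::euclidean_space measure) (sphere 0 1) > 0"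
proof -
  interpret S: finite_measure "sphere_measure :: 'a measure" by (rule finite_measure_sphere_measure)
  have "(LINT \<theta>:ball (0::'a) 1|lborel. (1::complex)) =
    (LINT u:(sphere (0::'a) 1)|sphere_measure. integral {0..1} (\<lambda>\<rho>. of_real (\<rho> ^ (DIM('a) - 1)) * (1::complex)))"
    by (rule integral_polar_ball) auto
  moreover have "(LINT \<theta>:ball (0::'a) 1|lborel. (1::complex)) = measure lborel (ball (0::'a) 1) *\<^sub>R 1"
    using emeasure_lborel_ball_finite[of "0::'a" 1] by (intro set_integral_const) auto
  then have "(LINT \<theta>:ball (0::'a) 1|lborel. (1::complex)) \<noteq> 0"
    using content_ball_pos[of 1 "0::'a"] by simp
  ultimately have "(LINT u:(sphere (0::'a) 1)|sphere_measure. integral {0..1} (\<lambda>\<rho>. of_real (\<rho> ^ (DIM('a) - 1)) * (1::complex))) \<noteq> 0"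
    by simp
  moreover have "(LINT u:(sphere (0::'a) 1)|sphere_measure. c) = measure sphere_measure (sphere (0::'a) 1) *\<^sub>R c" for c :: complex
    by (rule set_integral_const) (auto simp: borel_closed)
  ultimately have "measure (sphere_measure :: 'a measure) (sphere 0 1) \<noteq> 0" by auto
  then show ?thesis by (simp add: zero_less_measure_iff)
qed

section \<open>Radial integrals in an adapted coordinate\<close>

text \<open>
  On a circle about 0 the form \<open>dz / (2 * \<pi> * \<i> * z)\<close> is \<open>dx\<close>. As integrals over \<open>{0..1}\<close>, circle integrals
  are within reach of the continuity and differentiation theorems for parameter integrals.
\<close>
lemma has_contour_integral_circlepath0D:
  assumes "(f has_contour_integral I) (circlepath 0 R)"
  shows "((\<lambda>x. f (circlepath 0 R x) * circlepath 0 R x) has_integral I / (2 * pi * \<i>)) {0..1}"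
proof -
  have "((\<lambda>x. f (circlepath 0 R x) * vector_derivative (circlepath 0 R) (at x within {0..1})) has_integral I) {0..1}"
    using assms by (simp add: has_contour_integral_def)
  then have "((\<lambda>x. f (circlepath 0 R x) * (2 * pi * \<i> * circlepath 0 R x)) has_integral I) {0..1}"
    proof (rule has_integral_eq[rotated])
    fix x :: real assume "x \<in> {0..1}"
    then show "f (circlepath 0 R x) * vector_derivative (circlepath 0 R) (at x within {0..1}) =
        f (circlepath 0 R x) * (2 * pi * \<i> * circlepath 0 R x)"
      using vector_derivative_circlepath01[of x 0 R] by (simp add: circlepath)
  qed
  from has_integral_divide[OF this, of "2 * pi * \<i>"] show ?thesis
    by (rule has_integral_eq[rotated]) (simp add: field_simps)
qed

lemma partial_fractions_two_poles:
  fixes Y v a :: complex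
  assumes "Y \<noteq> v" "Y \<noteq> a" "v \<noteq> a"
  shows "1 / ((Y - a) * (Y - v)) = (1 / (Y - v) - 1 / (Y - a)) / (v - a)"
  using assms by (simp add: divide_simps)

text \<open>
  The coordinate change \<open>y z = z * s z\<close> on a disc of radius \<open>R\<close>, where \<open>s\<close> is close to a positive constant \<open>b\<close>. The
  larger disc of radius \<open>3 * R\<close> leaves room for Cauchy estimates. The powers \<open>z ^ e\<close> come from polar
  coordinates in dimension \<open>e + 1\<close>.
\<close>
locale radial_chart =
  fixes s :: "complex \<Rightarrow> complex" and b R :: real and e :: nat
  assumes R: "R > 0" and b: "b > 0"
    and s_hol: "s holomorphic_on ball 0 (3 * R)"
    and s_near: "\<And>z. norm z < 3 * R \<Longrightarrow> norm (s z - b) \<le> b / 8"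
    and s0: "s 0 = b"
begin

definition y :: "complex \<Rightarrow> complex" where "y z = z * s z"

abbreviation \<delta> :: real where "\<delta> \<equiv> R / 4"
abbreviation circ :: "real \<Rightarrow> complex" where "circ \<equiv> circlepath 0 R"

text \<open>
  The density of \<open>z ^ e * dz\<close> in the coordinate \<open>y\<close>. Cauchy's formula for the inverse function of \<open>y\<close> gives it
  without mentioning that inverse, and shows how it depends on \<open>a\<close> and on \<open>s\<close>.
\<close>
definition \<kappa> :: "complex \<Rightarrow> complex" where
  "\<kappa> a = integral {0..1} (\<lambda>x. circ x ^ Suc e / (y (circ x) - a))"

text \<open>
  The quotient \<open>\<kappa> a / a ^ e\<close>, with the singularity at 0 removed.
\<close>
definition k :: "complex \<Rightarrow> complex" where
  "k a = integral {0..1} (\<lambda>x. circ x / s (circ x) ^ e / (y (circ x) - a))"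

text \<open>
  The part of the integral of \<open>\<rho> ^ e / (y \<rho> - a)\<close> over \<open>{0..\<delta>}\<close> that remains holomorphic at \<open>a = 0\<close>. The two
  terms come from the upper limit of the primitive found below; its lower limit contributes the
  singular term \<open>\<kappa> a * Ln (- a)\<close>.
\<close>
definition N :: "complex \<Rightarrow> complex" where
  "N a = integral {0..1} (\<lambda>x. circ x ^ Suc e * (- Ln (1 - y \<delta> / y (circ x))) / (y (circ x) - a))
         + \<kappa> a * Ln (y \<delta> - a)"

lemma y_hol: "y holomorphic_on ball 0 (3 * R)"
  unfolding y_def[abs_def] by (intro holomorphic_intros s_hol)

lemma s_nz: "norm z < 3 * R \<Longrightarrow> s z \<noteq> 0"
  using s_near[of z] b by auto

lemma norm_circ [simp]: "norm (circ x) = R"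
  using R by (simp add: circlepath norm_mult)

lemma circ_in: "circ x \<in> ball 0 (3 * R)" "circ x \<in> cball 0 R" "norm (circ x) < 3 * R"
  using R by auto

lemma cont_circ: "continuous_on A circ"
  by (simp add: circlepath) (intro continuous_intros)

lemma deriv_s_bound: assumes "norm z \<le> R" shows "norm (deriv s z) \<le> b / (8 * R)"
proof -
  have sub: "cball z R \<subseteq> ball 0 (3 * R)"
  proof
    fix x assume "x \<in> cball z R"
    then have "norm x \<le> norm z + R"
      using norm_triangle_ineq2[of x z] by (auto simp: dist_norm norm_minus_commute)
    then show "x \<in> ball 0 (3 * R)" using assms R by auto
  qed
  have "norm ((deriv ^^ 1) (\<lambda>w. s w - b) z) \<le> fact 1 * (b / 8) / R ^ 1"
  proof (rule Cauchy_inequality)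
    show "(\<lambda>w. s w - complex_of_real b) holomorphic_on ball z R"
      using sub by (intro holomorphic_intros holomorphic_on_subset[OF s_hol]) auto
    show "continuous_on (cball z R) (\<lambda>w. s w - complex_of_real b)"
      using sub by (intro holomorphic_on_imp_continuous_on holomorphic_intros holomorphic_on_subset[OF s_hol]) auto
    show "norm (s x - b) \<le> b / 8" if "norm (z - x) = R" for x
      using sub that by (intro s_near) (auto simp: subset_iff dist_norm)
  qed (use R in auto)
  moreover have "deriv (\<lambda>w. s w - b) z = deriv s z"
    using assms R holomorphic_on_imp_differentiable_at[OF s_hol, of z] by (simp add: deriv_diff)
  ultimately show ?thesis by simp
qed

lemma deriv_y: assumes "norm z < 3 * R" shows "deriv y z = s z + z * deriv s z" "(y has_field_derivative deriv y z) (at z)"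
proof -
  have "(s has_field_derivative deriv s z) (at z)"
    using s_hol assms by (intro holomorphic_derivI[of _ "ball 0 (3*R)"]) auto
  then have *: "(y has_field_derivative s z + z * deriv s z) (at z)"
    unfolding y_def[abs_def] by (auto intro!: derivative_eq_intros)
  show "deriv y z = s z + z * deriv s z" using * by (rule DERIV_imp_deriv)
  then show "(y has_field_derivative deriv y z) (at z)" using * by simp
qed

lemma deriv_y_near: assumes "norm z \<le> R" shows "norm (deriv y z - b) \<le> b / 4"
proof -
  have "norm (z * deriv s z) \<le> R * (b / (8 * R))"
    unfolding norm_mult using assms deriv_s_bound[OF assms] R b by (intro mult_mono) auto
  then have "norm (z * deriv s z) \<le> b / 8" using R by simp
  moreover have "norm (s z - b) \<le> b / 8" using assms R by (intro s_near) auto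
  moreover have "norm (deriv y z - b) \<le> norm (s z - b) + norm (z * deriv s z)"
    using deriv_y(1)[of z] assms R norm_triangle_ineq[of "s z - b" "z * deriv s z"]
    by (simp add: algebra_simps)
  ultimately show ?thesis by linarith
qed

text \<open>
  The derivative of \<open>y\<close> stays within \<open>b / 4\<close> of \<open>b\<close>. This makes \<open>y\<close> injective, with the bounds that the
  following lemmas extract.
\<close>
lemma y_lipschitz:
  fixes z w :: complex
  assumes "norm z \<le> R" "norm w \<le> R"
  shows "norm (y z - y w - b * (z - w)) \<le> b / 4 * norm (z - w)"
proof -
  have "norm ((\<lambda>z. y z - b * z) z - (\<lambda>z. y z - b * z) w) \<le> b / 4 * norm (z - w)"
  proof (rule field_differentiable_bound[where S = "cball 0 R" and f' = "\<lambda>z. deriv y z - b"])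
    show "((\<lambda>z. y z - b * z) has_field_derivative deriv y x - b) (at x within cball 0 R)"
      if "x \<in> cball 0 R" for x
      using that R deriv_y(2)[of x]
      by (auto intro!: derivative_eq_intros DERIV_subset[OF deriv_y(2)])
  qed (use assms deriv_y_near in auto)
  then show ?thesis by (simp add: algebra_simps)
qed

lemma y_lower:
  fixes z w :: complex
  assumes "norm z \<le> R" "norm w \<le> R"
  shows "norm (y z - y w) \<ge> 3 / 4 * b * norm (z - w)"
proof -
  have "norm (b * (z - w)) \<le> norm (y z - y w) + norm (y z - y w - b * (z - w))"
    using norm_triangle_ineq4[of "y z - y w" "y z - y w - b * (z - w)"] by simp
  moreover have "norm (b * (z - w)) = b * norm (z - w)" using b by (simp add: norm_mult)
  ultimately show ?thesis using y_lipschitz[OF assms] by simp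
qed

lemma y_0 [simp]: "y 0 = 0" by (simp add: y_def)

lemma y_circ_lower: "norm (y (circ x)) \<ge> 3 / 4 * b * R"
  using y_lower[of "circ x" 0] R by simp

lemma y_near: fixes z :: complex assumes "norm z \<le> R" shows "norm (y z - b * z) \<le> b / 4 * norm z"
  using y_lipschitz[OF assms, of 0] R by simp

lemma y_upper: fixes z :: complex assumes "norm z \<le> R" shows "norm (y z) \<le> 5 / 4 * b * norm z"
proof -
  have "norm (y z) \<le> norm (y z - b * z) + norm (b * z)"
    using norm_triangle_ineq[of "y z - b * z" "b * z"] by simp
  moreover have "norm (b * z) = b * norm z" using b by (simp add: norm_mult)
  ultimately show ?thesis using y_near[OF assms] by simp
qed

lemma Re_y: assumes "0 \<le> \<rho>" "\<rho> \<le> R" shows "Re (y (of_real \<rho>)) \<ge> 3 / 4 * b * \<rho>"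
proof -
  have "norm (y \<rho> - b * of_real \<rho>) \<le> b / 4 * \<rho>" using y_near[of \<rho>] assms by simp
  then have "\<bar>Re (y \<rho> - b * of_real \<rho>)\<bar> \<le> b / 4 * \<rho>" using abs_Re_le_cmod order_trans by blast
  from abs_le_D2[OF this] show ?thesis by (simp add: algebra_simps)
qed

lemma cont_y_circ: "continuous_on A (\<lambda>x. y (circ x))" "continuous_on A (\<lambda>x. s (circ x))"
  by (rule continuous_on_compose2[OF holomorphic_on_imp_continuous_on[OF y_hol] cont_circ], use circ_in in auto,
      rule continuous_on_compose2[OF holomorphic_on_imp_continuous_on[OF s_hol] cont_circ], use circ_in in auto)

text \<open>
  The difference quotient of \<open>y\<close> at \<open>w\<close> has no zero in the disc, so Cauchy's formula applies to \<open>\<phi>\<close> divided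
  by it.
\<close>
lemma inverse_chart_integral:
  assumes \<phi>: "\<phi> holomorphic_on ball 0 (3 * R)" and w: "norm w < R"
  shows "integral {0..1} (\<lambda>x. \<phi> (circ x) * circ x / (y (circ x) - y w)) = \<phi> w / deriv y w"
proof -
  define q where "q z = (if z = w then deriv y w else (y z - y w) / (z - w))" for z
  have q_hol: "q holomorphic_on ball 0 (3 * R)"
    unfolding q_def[abs_def] by (rule pole_lemma_open[OF y_hol]) simp
  have q_nz: "q z \<noteq> 0" if "norm z \<le> R" for z
  proof (cases "z = w")
    case True
    then show ?thesis using deriv_y_near[of w] w b by (auto simp: q_def)
  next
    case False
    then have "3 / 4 * b * norm (z - w) > 0" using b by simp
    then have "y z \<noteq> y w" using y_lower[OF that, of w] w by auto
    then show ?thesis using False by (simp add: q_def)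
  qed
  have sub: "cball 0 R \<subseteq> ball (0::complex) (3 * R)" using R by auto
  have "((\<lambda>u. (\<phi> u / q u) / (u - w)) has_contour_integral (2 * of_real pi * \<i> * (\<phi> w / q w))) (circlepath 0 R)"
  proof (rule Cauchy_integral_circlepath)
    have *: "(\<lambda>u. \<phi> u / q u) holomorphic_on cball 0 R"
      using q_nz by (intro holomorphic_intros holomorphic_on_subset[OF \<phi>] holomorphic_on_subset[OF q_hol]) (use sub in auto)
    show "continuous_on (cball 0 R) (\<lambda>u. \<phi> u / q u)" using * by (rule holomorphic_on_imp_continuous_on)
    show "(\<lambda>u. \<phi> u / q u) holomorphic_on ball 0 R" using * by (rule holomorphic_on_subset) auto
  qed (use w in auto)
  from has_contour_integral_circlepath0D[OF this]
  have "((\<lambda>x. \<phi> (circ x) / q (circ x) / (circ x - w) * circ x) has_integral \<phi> w / q w) {0..1}"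
    by simp
  moreover have eq: "\<phi> (circ x) / q (circ x) / (circ x - w) * circ x = \<phi> (circ x) * circ x / (y (circ x) - y w)" for x
  proof -
    have "circ x \<noteq> w" using w norm_circ[of x] by auto
    then show ?thesis by (simp add: q_def)
  qed
  ultimately have "((\<lambda>x. \<phi> (circ x) * circ x / (y (circ x) - y w)) has_integral \<phi> w / q w) {0..1}"
    by (simp only: eq)
  then show ?thesis by (simp add: integral_unique q_def)
qed

lemma \<kappa>_y: assumes "norm w < R" shows "\<kappa> (y w) = w ^ e / deriv y w"
  using inverse_chart_integral[of "\<lambda>z. z ^ e", OF _ assms]
  by (simp add: \<kappa>_def mult.commute holomorphic_on_power)

lemma k_0: "k 0 = 1 / of_real b ^ Suc e"
proof -
  have "(\<lambda>z. 1 / s z ^ e) holomorphic_on ball 0 (3 * R)"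
    by (intro holomorphic_intros s_hol) (use s_nz in auto)
  from inverse_chart_integral[OF this, of 0] show ?thesis
    using R deriv_y(1)[of 0] s0 by (simp add: k_def mult.commute)
qed

lemma circ_denominator: assumes "norm a < 3 / 4 * b * R" shows "y (circ x) - a \<noteq> 0"
  using y_circ_lower[of x] assms by auto

text \<open>
  Since \<open>z ^ e = y z ^ e / s z ^ e\<close> and \<open>y z ^ e - a ^ e\<close> is divisible by \<open>y z - a\<close>, the difference of the two sides
  is the integral of a holomorphic function over a closed curve.
\<close>
lemma \<kappa>_eq_k: assumes a: "norm a < 3 / 4 * b * R" shows "\<kappa> a = a ^ e * k a"
proof -
  define h where "h z = 1 / s z ^ e * (\<Sum>j<e. a ^ (e - Suc j) * y z ^ j)" for z
  have h: "h holomorphic_on ball 0 (3 * R)"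
    unfolding h_def by (intro holomorphic_intros s_hol y_hol) (use s_nz in auto)
  have "(h has_contour_integral 0) (circlepath 0 R)"
    by (rule Cauchy_theorem_convex_simple[OF h]) (use R in auto)
  from has_contour_integral_circlepath0D[OF this]
  have "((\<lambda>x. h (circ x) * circ x) has_integral 0) {0..1}" by simp
  moreover have "h (circ x) * circ x = circ x ^ Suc e / (y (circ x) - a) - a ^ e * (circ x / s (circ x) ^ e / (y (circ x) - a))" for x
  proof -
    have nz: "y (circ x) - a \<noteq> 0" by (rule circ_denominator[OF a])
    have "y (circ x) ^ e - a ^ e = (y (circ x) - a) * (\<Sum>j<e. a ^ (e - Suc j) * y (circ x) ^ j)"
      by (rule power_diff_sumr2)
    then have "(\<Sum>j<e. a ^ (e - Suc j) * y (circ x) ^ j) = (y (circ x) ^ e - a ^ e) / (y (circ x) - a)"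
      using nz by (simp add: field_simps)
    then have "h (circ x) * circ x = circ x / s (circ x) ^ e * ((y (circ x) ^ e - a ^ e) / (y (circ x) - a))"
      by (simp add: h_def)
    also have "y (circ x) ^ e = circ x ^ e * s (circ x) ^ e" by (simp add: y_def power_mult_distrib)
    finally show ?thesis
      using s_nz[OF circ_in(3), of x] nz by (simp add: diff_divide_distrib right_diff_distrib)
  qed
  ultimately have "((\<lambda>x. circ x ^ Suc e / (y (circ x) - a) - a ^ e * (circ x / s (circ x) ^ e / (y (circ x) - a))) has_integral 0) {0..1}"
    by simp
  moreover have "(\<lambda>x. circ x ^ Suc e / (y (circ x) - a)) integrable_on {0..1}"
    by (intro integrable_continuous_interval continuous_intros cont_circ cont_y_circ) (use circ_denominator[OF a] in auto)
  moreover have "(\<lambda>x. circ x / s (circ x) ^ e / (y (circ x) - a)) integrable_on {0..1}"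
    by (intro integrable_continuous_interval continuous_intros cont_circ cont_y_circ)
       (use circ_denominator[OF a] s_nz[OF circ_in(3)] in auto)
  ultimately have "\<kappa> a - a ^ e * k a = 0"
    unfolding \<kappa>_def k_def
    by (intro has_integral_unique[OF has_integral_diff[OF integrable_integral has_integral_mult_right[OF integrable_integral]]])
  then show ?thesis by simp
qed

text \<open>
  Substituting \<open>\<rho> ^ e = \<kappa> (y \<rho>) * y' \<rho>\<close> leaves the kernel \<open>1 / ((Y - y \<rho>) * (y \<rho> - a))\<close> with \<open>Y\<close> on the image of the
  circle; partial fractions give the two logarithms. As \<open>a\<close> is imaginary and \<open>Re (y \<rho>) > 0\<close> for
  positive \<open>\<rho>\<close>, the argument of \<open>Ln (y \<rho> - a)\<close> does not meet the cut.
\<close>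
lemma chart_antiderivative:
  assumes \<rho>: "0 \<le> \<rho>" "\<rho> \<le> \<delta>" and a: "norm a < b * R / 16" and Re: "Re a = 0" "a \<noteq> 0"
  defines "H \<equiv> \<lambda>\<rho>::real. integral {0..1} (\<lambda>x. circ x ^ Suc e * (- Ln (1 - y \<rho> / y (circ x))) / (y (circ x) - a))
         + \<kappa> a * Ln (y \<rho> - a)"
  shows "(H has_vector_derivative of_real \<rho> ^ e / (y \<rho> - a)) (at \<rho> within {0..\<delta>})"
proof -
  define G where "G v = integral {0..1} (\<lambda>x. circ x ^ Suc e * (- Ln (1 - v / y (circ x))) / (y (circ x) - a))" for v
  let ?U = "ball (0::complex) (b * R / 2)"
  have a': "norm a < 3 / 4 * b * R" using a mult_pos_pos[OF b R] by simp
  note nz = circ_denominator[OF a']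
  have vU: "y \<rho> \<in> ?U"
  proof -
    have "norm (y \<rho>) \<le> 5 / 4 * b * \<rho>" using y_upper[of \<rho>] \<rho> R by simp
    also have "\<dots> \<le> 5 / 4 * b * (R / 4)" using \<rho> b by (intro mult_left_mono) auto
    also have "\<dots> < b * R / 2" using b R by simp
    finally show ?thesis by simp
  qed
  have quot: "norm (v / y (circ x)) < 1" "y (circ x) \<noteq> 0" "y (circ x) - v \<noteq> 0" if "v \<in> ?U" for v x
  proof -
    have p: "b * R > 0" using b R by simp
    have 1: "norm (y (circ x)) > norm v" using that y_circ_lower[of x] p by auto
    then show "norm (v / y (circ x)) < 1" "y (circ x) - v \<noteq> 0" "y (circ x) \<noteq> 0"
      by (auto simp: norm_divide divide_simps)
  qed
  have slit: "1 - v / y (circ x) \<notin> \<real>\<^sub>\<le>\<^sub>0" if "v \<in> ?U" for v x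
  proof
    assume "1 - v / y (circ x) \<in> \<real>\<^sub>\<le>\<^sub>0"
    then have "Re (1 - v / y (circ x)) \<le> 0" by (auto simp: complex_nonpos_Reals_iff)
    then show False using quot(1)[OF that, of x] abs_Re_le_cmod[of "v / y (circ x)"] by simp
  qed
  have G': "(G has_field_derivative integral (cbox 0 1) (\<lambda>x. circ x ^ Suc e / ((y (circ x) - a) * (y (circ x) - v)))) (at v within ?U)"
    if v: "v \<in> ?U" for v
    unfolding G_def cbox_interval[symmetric]
  proof (rule leibniz_rule_field_derivative)
    show "((\<lambda>v. circ t ^ Suc e * - Ln (1 - v / y (circ t)) / (y (circ t) - a)) has_field_derivative
           circ t ^ Suc e / ((y (circ t) - a) * (y (circ t) - v))) (at v within ?U)"
      if "v \<in> ?U" "t \<in> cbox 0 1" for v t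
    proof -
      have "((\<lambda>v. circ t ^ Suc e * - Ln (1 - v / y (circ t)) / (y (circ t) - a)) has_field_derivative
            circ t ^ Suc e * - (inverse (1 - v / y (circ t)) * (- (1 / y (circ t)))) / (y (circ t) - a)) (at v within ?U)"
        using slit[OF that(1), of t] nz[of t] quot(2)[OF that(1), of t] by (auto intro!: derivative_eq_intros)
      moreover have "circ t ^ Suc e * - (inverse (1 - v / y (circ t)) * (- (1 / y (circ t)))) / (y (circ t) - a) =
         circ t ^ Suc e / ((y (circ t) - a) * (y (circ t) - v))"
        using quot(2,3)[OF that(1), of t] nz[of t] by (simp add: divide_simps)
      ultimately show ?thesis by simp
    qed
    show "(\<lambda>t. circ t ^ Suc e * - Ln (1 - v / y (circ t)) / (y (circ t) - a)) integrable_on cbox 0 1"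
      if "v \<in> ?U" for v
      by (intro integrable_continuous continuous_intros cont_circ cont_y_circ) (use nz slit[OF that] quot[OF that] in auto)
    show "continuous_on (?U \<times> cbox 0 1) (\<lambda>(v, t). circ t ^ Suc e / ((y (circ t) - a) * (y (circ t) - v)))"
      unfolding case_prod_unfold
      by (intro continuous_intros continuous_on_compose2[OF cont_circ[of UNIV]] continuous_on_compose2[OF cont_y_circ(1)[of UNIV]])
         (use nz quot(3) in auto)
  qed (use v in auto)
  have Gv: "(G has_field_derivative integral {0..1} (\<lambda>x. circ x ^ Suc e / ((y (circ x) - a) * (y (circ x) - y \<rho>)))) (at (y \<rho>))"
    using G'[OF vU] at_within_open[OF vU] by simp
  have va: "y \<rho> \<noteq> a" "y \<rho> - a \<notin> \<real>\<^sub>\<le>\<^sub>0"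
  proof -
    have r: "Re (y \<rho>) \<ge> 3 / 4 * b * \<rho>" using Re_y[of \<rho>] \<rho> R by simp
    have "y \<rho> - a \<notin> \<real>\<^sub>\<le>\<^sub>0"
    proof
      assume "y \<rho> - a \<in> \<real>\<^sub>\<le>\<^sub>0"
      then have *: "Re (y \<rho>) \<le> 0" "Im (y \<rho>) = Im a" using Re by (auto simp: complex_nonpos_Reals_iff)
      then have "\<not> b * \<rho> > 0" using r by auto
      then have "\<rho> = 0" using \<rho> b by (auto simp: zero_less_mult_iff)
      then have "Im a = 0" using * by simp
      then show False using Re complex_eqI[of a 0] by simp
    qed
    then show "y \<rho> - a \<notin> \<real>\<^sub>\<le>\<^sub>0" "y \<rho> \<noteq> a" by auto
  qed
  have \<rho>R: "norm (complex_of_real \<rho>) < R" using \<rho> R by simp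
  have yv: "((\<lambda>\<rho>::real. y \<rho>) has_vector_derivative deriv y \<rho>) (at \<rho> within {0..\<delta>})"
    using deriv_y(2)[of \<rho>] \<rho>R by (intro has_vector_derivative_real_field) auto
  have Q: "((\<lambda>v. G v + \<kappa> a * Ln (v - a)) has_field_derivative
     integral {0..1} (\<lambda>x. circ x ^ Suc e / ((y (circ x) - a) * (y (circ x) - y \<rho>))) + \<kappa> a / (y \<rho> - a)) (at (y \<rho>))"
    using va by (auto intro!: derivative_eq_intros Gv simp: divide_inverse)
  have int: "integral {0..1} (\<lambda>x. circ x ^ Suc e / ((y (circ x) - a) * (y (circ x) - y \<rho>))) = (\<kappa> (y \<rho>) - \<kappa> a) / (y \<rho> - a)"
  proof -
    have "(\<lambda>x. circ x ^ Suc e / ((y (circ x) - a) * (y (circ x) - y \<rho>))) =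
      (\<lambda>x. (circ x ^ Suc e / (y (circ x) - y \<rho>) - circ x ^ Suc e / (y (circ x) - a)) / (y \<rho> - a))"
    proof
      fix x
      have "1 / ((y (circ x) - a) * (y (circ x) - y \<rho>)) = (1 / (y (circ x) - y \<rho>) - 1 / (y (circ x) - a)) / (y \<rho> - a)"
        using quot(3)[OF vU, of x] nz[of x] va by (intro partial_fractions_two_poles) auto
      then have "circ x ^ Suc e * (1 / ((y (circ x) - a) * (y (circ x) - y \<rho>))) =
         circ x ^ Suc e * ((1 / (y (circ x) - y \<rho>) - 1 / (y (circ x) - a)) / (y \<rho> - a))" by simp
      then show "circ x ^ Suc e / ((y (circ x) - a) * (y (circ x) - y \<rho>)) =
         (circ x ^ Suc e / (y (circ x) - y \<rho>) - circ x ^ Suc e / (y (circ x) - a)) / (y \<rho> - a)"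
        by (simp add: algebra_simps)
    qed
    moreover have "(\<lambda>x. circ x ^ Suc e / (y (circ x) - y \<rho>)) integrable_on {0..1}"
      by (intro integrable_continuous_interval continuous_intros cont_circ cont_y_circ) (use quot(3)[OF vU] in auto)
    moreover have "(\<lambda>x. circ x ^ Suc e / (y (circ x) - a)) integrable_on {0..1}"
      by (intro integrable_continuous_interval continuous_intros cont_circ cont_y_circ) (use nz in auto)
    ultimately show ?thesis by (simp add: \<kappa>_def integral_diff)
  qed
  have dnz: "deriv y \<rho> \<noteq> 0" using deriv_y_near[of \<rho>] \<rho>R b by auto
  have "(H has_vector_derivative deriv y \<rho> * ((\<kappa> (y \<rho>) - \<kappa> a) / (y \<rho> - a) + \<kappa> a / (y \<rho> - a))) (at \<rho> within {0..\<delta>})"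
    using field_vector_diff_chain_within[OF yv has_field_derivative_at_within[OF Q]] int
    by (simp add: o_def H_def G_def)
  also have "deriv y \<rho> * ((\<kappa> (y \<rho>) - \<kappa> a) / (y \<rho> - a) + \<kappa> a / (y \<rho> - a)) = of_real \<rho> ^ e / (y \<rho> - a)"
    using \<kappa>_y[OF \<rho>R] dnz by (simp add: diff_divide_distrib)
  finally show ?thesis .
qed

lemma chart_integral:
  assumes a: "norm a < b * R / 16" and Re: "Re a = 0" "a \<noteq> 0"
  shows "((\<lambda>\<rho>. of_real \<rho> ^ e / (y \<rho> - a)) has_integral (N a - \<kappa> a * Ln (- a))) {0..\<delta>}"
proof -
  have "((\<lambda>\<rho>. of_real \<rho> ^ e / (y \<rho> - a)) has_integral (N a - (integral {0..1} (\<lambda>x. circ x ^ Suc e * (- Ln (1 - y (of_real 0) / y (circ x))) / (y (circ x) - a))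
         + \<kappa> a * Ln (y (of_real 0) - a)))) {0..\<delta>}"
    unfolding N_def by (rule fundamental_theorem_of_calculus) (use R chart_antiderivative[OF _ _ assms] in auto)
  then show ?thesis by simp
qed

end

section \<open>Radial integrals averaged over directions\<close>

lemma holomorphic_on_cauchy_kernel_integral:
  fixes G Y :: "real \<Rightarrow> complex"
  assumes G: "continuous_on {0..1} G" and Y: "continuous_on {0..1} Y"
    and nz: "\<And>x. x \<in> {0..1} \<Longrightarrow> \<eta> \<le> norm (Y x)"
  shows "(\<lambda>a. integral {0..1} (\<lambda>x. G x / (Y x - a))) holomorphic_on ball 0 \<eta>"
  unfolding cbox_interval[symmetric]
proof (rule leibniz_rule_holomorphic)
  have nz': "Y t \<noteq> a" if "a \<in> ball 0 \<eta>" "t \<in> {0..1}" for a t using nz[OF that(2)] that(1) by auto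
  show "((\<lambda>a. G t / (Y t - a)) has_field_derivative G t / (Y t - a)\<^sup>2) (at a within ball 0 \<eta>)"
    if "a \<in> ball 0 \<eta>" "t \<in> cbox 0 1" for a t
    using nz'[of a t] that by (auto intro!: derivative_eq_intros simp: power2_eq_square divide_simps)
  show "(\<lambda>x. G x / (Y x - a)) integrable_on cbox 0 1" if "a \<in> ball 0 \<eta>" for a
    using nz'[OF that] by (intro integrable_continuous continuous_intros) (use G Y in auto)
  show "continuous_on (ball 0 \<eta> \<times> cbox 0 1) (\<lambda>(a, t). G t / (Y t - a)\<^sup>2)"
    unfolding case_prod_unfold
    by (intro continuous_intros continuous_on_compose2[OF G] continuous_on_compose2[OF Y]) (use nz' in auto)
qed auto

lemma continuous_on_cauchy_kernel_integral:
  fixes G Y :: "'a::metric_space \<Rightarrow> real \<Rightarrow> complex"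
  assumes G: "continuous_on (X \<times> {0..1}) (\<lambda>(u, x). G u x)" and Y: "continuous_on (X \<times> {0..1}) (\<lambda>(u, x). Y u x)"
    and nz: "\<And>u x a. u \<in> X \<Longrightarrow> x \<in> {0..1} \<Longrightarrow> a \<in> A \<Longrightarrow> Y u x \<noteq> a"
  shows "continuous_on (X \<times> A) (\<lambda>p. integral {0..1} (\<lambda>x. G (fst p) x / (Y (fst p) x - snd p)))"
  unfolding cbox_interval[symmetric]
proof (rule integral_continuous_on_param)
  have 1: "continuous_on ((X \<times> A) \<times> cbox 0 1) (\<lambda>p. (fst (fst p), snd p))"
    by (intro continuous_intros)
  have "continuous_on ((X \<times> A) \<times> cbox 0 1) (\<lambda>p. (\<lambda>(u, x). G u x) (fst (fst p), snd p))"
    by (rule continuous_on_compose2[OF G 1]) auto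
  moreover have "continuous_on ((X \<times> A) \<times> cbox 0 1) (\<lambda>p. (\<lambda>(u, x). Y u x) (fst (fst p), snd p))"
    by (rule continuous_on_compose2[OF Y 1]) auto
  ultimately show "continuous_on ((X \<times> A) \<times> cbox 0 1) (\<lambda>(p, x). G (fst p) x / (Y (fst p) x - snd p))"
    unfolding case_prod_unfold fst_conv snd_conv
    using nz by (intro continuous_intros) auto
qed

context radial_chart
begin

lemma bR_pos: "b * R > 0" using b R by simp

lemma norm_quot: "norm (y \<delta> / y (circ x)) < 1"
proof -
  have "norm (y \<delta>) \<le> 5 / 4 * b * (R / 4)" using y_upper[of \<delta>] R by simp
  then show ?thesis using y_circ_lower[of x] bR_pos by (auto simp: norm_divide divide_simps)
qed

lemma quot_slit: "1 - y \<delta> / y (circ x) \<notin> \<real>\<^sub>\<le>\<^sub>0"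
proof
  assume "1 - y \<delta> / y (circ x) \<in> \<real>\<^sub>\<le>\<^sub>0"
  then have "Re (1 - y \<delta> / y (circ x)) \<le> 0" by (auto simp: complex_nonpos_Reals_iff)
  then show False using norm_quot[of x] abs_Re_le_cmod[of "y \<delta> / y (circ x)"] by simp
qed

lemma end_slit: assumes "norm a < b * R / 8" shows "y \<delta> - a \<notin> \<real>\<^sub>\<le>\<^sub>0"
proof
  assume "y \<delta> - a \<in> \<real>\<^sub>\<le>\<^sub>0"
  then have "Re (y \<delta>) \<le> Re a" by (auto simp: complex_nonpos_Reals_iff)
  moreover have "Re (y \<delta>) \<ge> 3 / 4 * b * (R / 4)" using Re_y[of \<delta>] R by simp
  ultimately show False using assms bR_pos complex_Re_le_cmod[of a] by simp
qed

lemma \<kappa>_hol: "\<kappa> holomorphic_on ball 0 (b * R / 8)" and k_hol: "k holomorphic_on ball 0 (b * R / 8)"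
proof -
  have *: "b * R / 8 \<le> norm (y (circ x))" for x using y_circ_lower[of x] bR_pos by simp
  show "\<kappa> holomorphic_on ball 0 (b * R / 8)" unfolding \<kappa>_def[abs_def]
    by (intro holomorphic_on_cauchy_kernel_integral continuous_intros cont_circ cont_y_circ *)
  show "k holomorphic_on ball 0 (b * R / 8)" unfolding k_def[abs_def]
    by (intro holomorphic_on_cauchy_kernel_integral continuous_intros cont_circ cont_y_circ *)
       (use s_nz[OF circ_in(3)] in auto)
qed

lemma y_circ_nz: "y (circ x) \<noteq> 0"
  using y_circ_lower[of x] bR_pos by (auto simp: mult.commute)

lemma N_hol: "N holomorphic_on ball 0 (b * R / 8)"
proof -
  have *: "b * R / 8 \<le> norm (y (circ x))" for x using y_circ_lower[of x] bR_pos by simp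
  have "(\<lambda>a. integral {0..1} (\<lambda>x. circ x ^ Suc e * (- Ln (1 - y \<delta> / y (circ x))) / (y (circ x) - a))) holomorphic_on ball 0 (b * R / 8)"
    by (intro holomorphic_on_cauchy_kernel_integral continuous_intros cont_circ cont_y_circ *)
       (use quot_slit y_circ_nz in auto)
  then show ?thesis unfolding N_def[abs_def]
    by (intro holomorphic_intros \<kappa>_hol) (use end_slit in auto)
qed

text \<open>
  Partial fractions: \<open>\<zeta>\<^sup>2 + y\<^sup>2 = (y - \<i> * \<zeta>) * (y + \<i> * \<zeta>)\<close>.
\<close>
lemma chart_integral_resolvent:
  fixes \<zeta> :: real
  assumes z: "0 < \<zeta>" "\<zeta> < b * R / 16"
  shows "integral {0..\<delta>} (\<lambda>\<rho>. of_real \<rho> ^ e / (of_real (\<zeta>\<^sup>2) + (y \<rho>)\<^sup>2)) =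
    ((N (\<i> * \<zeta>) - \<kappa> (\<i> * \<zeta>) * Ln (- (\<i> * \<zeta>))) - (N (- (\<i> * \<zeta>)) - \<kappa> (- (\<i> * \<zeta>)) * Ln (\<i> * \<zeta>))) / (2 * \<i> * \<zeta>)"
proof -
  let ?a = "\<i> * complex_of_real \<zeta>"
  have 1: "((\<lambda>\<rho>. of_real \<rho> ^ e / (y \<rho> - ?a)) has_integral (N ?a - \<kappa> ?a * Ln (- ?a))) {0..\<delta>}"
    by (rule chart_integral) (use z in \<open>auto simp: norm_mult\<close>)
  have 2: "((\<lambda>\<rho>. of_real \<rho> ^ e / (y \<rho> - (- ?a))) has_integral (N (- ?a) - \<kappa> (- ?a) * Ln (- (- ?a)))) {0..\<delta>}"
    by (rule chart_integral) (use z in \<open>auto simp: norm_mult\<close>)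
  have "((\<lambda>\<rho>. (of_real \<rho> ^ e / (y \<rho> - ?a) - of_real \<rho> ^ e / (y \<rho> - (- ?a))) / (2 * ?a)) has_integral
     ((N ?a - \<kappa> ?a * Ln (- ?a)) - (N (- ?a) - \<kappa> (- ?a) * Ln (- (- ?a)))) / (2 * ?a)) {0..\<delta>}"
    by (intro has_integral_divide has_integral_diff 1 2)
  then have "((\<lambda>\<rho>. of_real \<rho> ^ e / (of_real (\<zeta>\<^sup>2) + (y \<rho>)\<^sup>2)) has_integral
     ((N ?a - \<kappa> ?a * Ln (- ?a)) - (N (- ?a) - \<kappa> (- ?a) * Ln (- (- ?a)))) / (2 * ?a)) {0..\<delta>}"
  proof (rule has_integral_eq[rotated])
    fix \<rho> assume \<rho>: "\<rho> \<in> {0..\<delta>}"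
    have "Re (y \<rho>) \<ge> 3 / 4 * b * \<rho>" using Re_y[of \<rho>] \<rho> R by simp
    then have "y \<rho> \<noteq> ?a \<and> y \<rho> \<noteq> - ?a"
    proof (cases "\<rho> = 0")
      case False
      then have "3 / 4 * b * \<rho> > 0" using \<rho> b by simp
      then have "Re (y \<rho>) > 0" using \<open>Re (y \<rho>) \<ge> 3 / 4 * b * \<rho>\<close> by linarith
      then show ?thesis by auto
    qed (use z in auto)
    then have nz: "y \<rho> - ?a \<noteq> 0" "y \<rho> + ?a \<noteq> 0" by (auto simp: add_eq_0_iff)
    have "of_real (\<zeta>\<^sup>2) + (y \<rho>)\<^sup>2 = (y \<rho> - ?a) * (y \<rho> + ?a)"
      by (simp add: algebra_simps power2_eq_square)
    then show "(of_real \<rho> ^ e / (y \<rho> - ?a) - of_real \<rho> ^ e / (y \<rho> - (- ?a))) / (2 * ?a) =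
        of_real \<rho> ^ e / (of_real (\<zeta>\<^sup>2) + (y \<rho>)\<^sup>2)"
      using nz z by (simp add: divide_simps) (simp add: algebra_simps)
  qed
  then show ?thesis by (simp add: integral_unique mult.assoc)
qed

end

text \<open>
  Charts indexed by a compact space of directions. The lower bound \<open>b0\<close> makes their domains uniform.
\<close>
locale radial_family =
  fixes s :: "'a::metric_space \<Rightarrow> complex \<Rightarrow> complex" and b :: "'a \<Rightarrow> real" and R b0 :: real and e :: nat
    and X :: "'a set" and M :: "'a measure"
  assumes chart: "\<And>u. u \<in> X \<Longrightarrow> radial_chart (s u) (b u) R"
    and cont: "continuous_on (X \<times> ball 0 (3 * R)) (\<lambda>(u, z). s u z)"
    and b0: "b0 > 0" "\<And>u. u \<in> X \<Longrightarrow> b0 \<le> b u" and X: "compact X"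
    and M: "sets M = sets borel" "emeasure M X < \<infinity>" "measure M X > 0" and R: "R > 0"
begin

abbreviation "r \<equiv> b0 * R / 16"
abbreviation "yy u \<equiv> radial_chart.y (s u)"
abbreviation "kap u \<equiv> radial_chart.\<kappa> (s u) R e"
abbreviation "kk u \<equiv> radial_chart.k (s u) R e"
abbreviation "NN u \<equiv> radial_chart.N (s u) R e"

lemma r_le: "u \<in> X \<Longrightarrow> r \<le> b u * R / 16"
  using b0(2)[of u] R by simp

lemma b_pos: "u \<in> X \<Longrightarrow> b u > 0" using b0(2)[of u] b0(1) by simp

lemma cont_s: "continuous_on A f \<Longrightarrow> continuous_on A g \<Longrightarrow> (\<And>p. p \<in> A \<Longrightarrow> f p \<in> X) \<Longrightarrow>
   (\<And>p. p \<in> A \<Longrightarrow> norm (g p) < 3 * R) \<Longrightarrow> continuous_on A (\<lambda>p. s (f p) (g p))"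
  using continuous_on_compose2[OF cont, of A "\<lambda>p. (f p, g p)"] by (force intro: continuous_intros)

lemma cont_yy: "continuous_on A f \<Longrightarrow> continuous_on A g \<Longrightarrow> (\<And>p. p \<in> A \<Longrightarrow> f p \<in> X) \<Longrightarrow>
   (\<And>p. p \<in> A \<Longrightarrow> norm (g p) < 3 * R) \<Longrightarrow> continuous_on A (\<lambda>p. yy (f p) (g p))"
proof -
  assume *: "continuous_on A f" "continuous_on A g" "\<And>p. p \<in> A \<Longrightarrow> f p \<in> X"
   "\<And>p. p \<in> A \<Longrightarrow> norm (g p) < 3 * R"
  have "continuous_on A (\<lambda>p. g p * s (f p) (g p))"
    by (intro continuous_intros cont_s *)
  then show ?thesis
    using * by (subst continuous_on_cong[OF refl]) (auto simp: radial_chart.y_def[OF chart])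
qed

lemma y_circ_ne: "u \<in> X \<Longrightarrow> a \<in> cball 0 r \<Longrightarrow> yy u (circlepath 0 R x) \<noteq> a"
  using radial_chart.y_circ_lower[OF chart, of u x] r_le[of u] radial_chart.bR_pos[OF chart, of u] by auto

lemma norm_circlepath: "norm (circlepath 0 R x) = R"
  using R by (simp add: circlepath norm_mult)

lemma cont_circ_snd: "continuous_on A (\<lambda>p. circlepath 0 R (snd p))"
  by (simp add: circlepath) (intro continuous_intros)

lemma cont_Y: "continuous_on (X \<times> {0..1}) (\<lambda>(u, x). yy u (circlepath 0 R x))"
  unfolding case_prod_unfold
  by (intro cont_yy continuous_intros cont_circ_snd) (use norm_circlepath R in auto)

lemma cont_kap: "continuous_on (X \<times> cball 0 r) (\<lambda>p. kap (fst p) (snd p))"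
proof -
  have "continuous_on (X \<times> cball 0 r) (\<lambda>p. integral {0..1} (\<lambda>x. circlepath 0 R x ^ Suc e / (yy (fst p) (circlepath 0 R x) - snd p)))"
    by (rule continuous_on_cauchy_kernel_integral[OF _ cont_Y y_circ_ne])
       (auto simp: case_prod_unfold intro!: continuous_intros cont_circ_snd)
  then show ?thesis
    by (subst continuous_on_cong[OF refl]) (auto simp: radial_chart.\<kappa>_def[OF chart])
qed

lemma cont_kk: "continuous_on (X \<times> cball 0 r) (\<lambda>p. kk (fst p) (snd p))"
proof -
  have "continuous_on (X \<times> cball 0 r) (\<lambda>p. integral {0..1} (\<lambda>x. circlepath 0 R x / s (fst p) (circlepath 0 R x) ^ e / (yy (fst p) (circlepath 0 R x) - snd p)))"
    by (rule continuous_on_cauchy_kernel_integral[OF _ cont_Y y_circ_ne, where G = "\<lambda>u x. circlepath 0 R x / s u (circlepath 0 R x) ^ e"])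
       (use R norm_circlepath radial_chart.s_nz[OF chart] in
        \<open>auto simp: case_prod_unfold intro!: continuous_intros cont_circ_snd cont_s\<close>)
  then show ?thesis
    by (subst continuous_on_cong[OF refl]) (auto simp: radial_chart.k_def[OF chart])
qed

lemma cont_NN: "continuous_on (X \<times> cball 0 r) (\<lambda>p. NN (fst p) (snd p))"
proof -
  have R4: "norm (complex_of_real (R / 4)) < 3 * R" using R by simp
  have "continuous_on (X \<times> cball 0 r) (\<lambda>p. integral {0..1} (\<lambda>x. circlepath 0 R x ^ Suc e *
       (- Ln (1 - yy (fst p) (of_real (R/4)) / yy (fst p) (circlepath 0 R x))) / (yy (fst p) (circlepath 0 R x) - snd p)))"
  proof (rule continuous_on_cauchy_kernel_integral[OF _ cont_Y y_circ_ne, where G = "\<lambda>u x. circlepath 0 R x ^ Suc e *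
       (- Ln (1 - yy u (of_real (R/4)) / yy u (circlepath 0 R x)))"])
    show "continuous_on (X \<times> {0..1}) (\<lambda>(u, x). circlepath 0 R x ^ Suc e * (- Ln (1 - yy u (of_real (R/4)) / yy u (circlepath 0 R x))))"
      unfolding case_prod_unfold
      using R4 R norm_circlepath radial_chart.quot_slit[OF chart]
      by (intro continuous_intros cont_circ_snd cont_yy) (auto simp: radial_chart.y_circ_nz[OF chart])
  qed auto
  moreover have "continuous_on (X \<times> cball 0 r) (\<lambda>p. kap (fst p) (snd p) * Ln (yy (fst p) (of_real (R/4)) - snd p))"
  proof (intro continuous_intros cont_yy cont_kap)
    show "yy (fst p) (of_real (R/4)) - snd p \<notin> \<real>\<^sub>\<le>\<^sub>0" if "p \<in> X \<times> cball 0 r" for p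
    proof (rule radial_chart.end_slit[OF chart])
      show "norm (snd p) < b (fst p) * R / 8"
        using that r_le[of "fst p"] radial_chart.bR_pos[OF chart, of "fst p"] by auto
    qed (use that in auto)
  qed (use R4 in auto)
  ultimately have "continuous_on (X \<times> cball 0 r) (\<lambda>p. integral {0..1} (\<lambda>x. circlepath 0 R x ^ Suc e *
       (- Ln (1 - yy (fst p) (of_real (R/4)) / yy (fst p) (circlepath 0 R x))) / (yy (fst p) (circlepath 0 R x) - snd p))
       + kap (fst p) (snd p) * Ln (yy (fst p) (of_real (R/4)) - snd p))"
    by (rule continuous_on_add)
  then show ?thesis
    by (subst continuous_on_cong[OF refl]) (auto simp: radial_chart.N_def[OF chart])
qed

lemma averaged_holomorphic:
  assumes c: "continuous_on (X \<times> cball 0 r) (\<lambda>p. F (fst p) (snd p))"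
    and h: "\<And>u. u \<in> X \<Longrightarrow> F u holomorphic_on ball 0 (b u * R / 8)"
  shows "(\<lambda>a. LINT u:X|M. F u a) holomorphic_on ball 0 r"
proof -
  have "compact ((\<lambda>p. F (fst p) (snd p)) ` (X \<times> cball 0 r))"
    by (intro compact_continuous_image[OF c] compact_Times X compact_cball)
  then obtain C where C: "\<And>p. p \<in> X \<times> cball 0 r \<Longrightarrow> norm (F (fst p) (snd p)) \<le> C"
    unfolding compact_eq_bounded_closed bounded_iff by blast
  show ?thesis
  proof (rule holomorphic_on_set_integral[OF M(1) _ M(2)])
    show "X \<in> sets borel" using X by (simp add: borel_compact)
    show "continuous_on X (\<lambda>u. F u z)" if "z \<in> ball 0 r" for z
      using that by (intro continuous_on_compose2[OF c, of X "\<lambda>u. (u, z)", simplified] continuous_intros) auto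
    show "F u holomorphic_on ball 0 r" if "u \<in> X" for u
      using r_le[OF that] radial_chart.bR_pos[OF chart[OF that]] by (intro holomorphic_on_subset[OF h[OF that]]) auto
    show "norm (F u z) \<le> C" if "u \<in> X" "z \<in> ball 0 r" for u z using C[of "(u, z)"] that by auto
  qed auto
qed

lemma averaged_integrable:
  assumes c: "continuous_on (X \<times> cball 0 r) (\<lambda>p. F (fst p) (snd p) :: complex)" and a: "a \<in> cball 0 r"
  shows "set_integrable M X (\<lambda>u. F u a)"
proof -
  have c': "continuous_on X (\<lambda>u. F u a)"
    using a by (intro continuous_on_compose2[OF c, of X "\<lambda>u. (u, a)", simplified] continuous_intros) auto
  obtain C where C: "\<And>u. u \<in> X \<Longrightarrow> norm (F u a) \<le> C"
    using compact_continuous_image[OF c' X] unfolding compact_eq_bounded_closed bounded_iff by blast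
  have Xb: "X \<in> sets borel" using X by (simp add: borel_compact)
  show ?thesis unfolding set_integrable_def
  proof (rule Bochner_Integration.integrable_bound)
    show "integrable M (\<lambda>u. indicator X u *\<^sub>R C)"
      using M Xb by (intro integrable_scaleR_left) auto
    show "(\<lambda>u. indicat_real X u *\<^sub>R F u a) \<in> borel_measurable M"
      using borel_measurable_continuous_on_indicator[OF Xb c'] by (simp add: measurable_cong_sets[OF M(1) refl])
    show "AE u in M. norm (indicat_real X u *\<^sub>R F u a) \<le> norm (indicat_real X u *\<^sub>R C)"
      using C by (force simp: indicator_def intro!: AE_I2)
  qed
qed

text \<open>
  Averaging over the directions cannot destroy the leading coefficient: at 0 each direction contributes
  \<open>1 / b u ^ Suc e\<close>, which is positive.
\<close>
lemma averaged_integral: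
  obtains N K where "N holomorphic_on ball 0 r" "K holomorphic_on ball 0 r" "K 0 \<noteq> 0"
    "\<And>\<zeta>::real. 0 < \<zeta> \<Longrightarrow> \<zeta> < r \<Longrightarrow>
       (LINT u:X|M. integral {0..R/4} (\<lambda>\<rho>. of_real \<rho> ^ e / (of_real (\<zeta>\<^sup>2) + (of_real \<rho> * s u \<rho>)\<^sup>2))) =
       ((N (\<i> * \<zeta>) - (\<i> * \<zeta>) ^ e * K (\<i> * \<zeta>) * Ln (- (\<i> * \<zeta>))) -
        (N (- (\<i> * \<zeta>)) - (- (\<i> * \<zeta>)) ^ e * K (- (\<i> * \<zeta>)) * Ln (\<i> * \<zeta>))) / (2 * \<i> * \<zeta>)"
proof -
  define N where "N a = (LINT u:X|M. NN u a)" for a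
  define K where "K a = (LINT u:X|M. kk u a)" for a
  have rp: "r > 0" using b0(1) R by simp
  have Xb: "X \<in> sets borel" using X by (simp add: borel_compact)
  have kap_K: "(LINT u:X|M. kap u a) = a ^ e * K a" if "a \<in> cball 0 r" for a
  proof -
    have "(LINT u:X|M. kap u a) = (LINT u:X|M. a ^ e * kk u a)"
    proof (rule set_lebesgue_integral_cong)
      show "\<forall>u. u \<in> X \<longrightarrow> kap u a = a ^ e * kk u a"
      proof (intro allI impI radial_chart.\<kappa>_eq_k[OF chart])
        fix u assume u: "u \<in> X"
        show "norm a < 3 / 4 * b u * R"
          using that r_le[OF u] radial_chart.bR_pos[OF chart[OF u]] by auto
      qed
    qed (use Xb M in auto)
    then show ?thesis by (simp add: K_def)
  qed
  have "K 0 \<noteq> 0"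
  proof -
    have cb: "continuous_on X b"
    proof -
      have "continuous_on X (\<lambda>u. Re (s u 0))" using R by (intro continuous_intros cont_s) auto
      then show ?thesis by (subst continuous_on_cong[OF refl]) (auto simp: radial_chart.s0[OF chart])
    qed
    have Xne: "X \<noteq> {}" using M(3) by auto
    obtain um where um: "um \<in> X" "\<And>u. u \<in> X \<Longrightarrow> b u \<le> b um"
      using continuous_attains_sup[OF X Xne cb] by blast
    define B where "B = b um"
    have cg: "continuous_on X (\<lambda>u. 1 / b u ^ Suc e)"
      using b_pos by (intro continuous_intros cb) force
    have K0: "K 0 = (LINT u:X|M. of_real (1 / b u ^ Suc e))"
      unfolding K_def using Xb M
      by (intro set_lebesgue_integral_cong) (auto simp: radial_chart.k_0[OF chart])
    have i1: "set_integrable M X (\<lambda>u. 1 / b u ^ Suc e)"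
    proof -
      have "set_integrable M X (\<lambda>u. kk u 0)" by (rule averaged_integrable[OF cont_kk]) (use rp in auto)
      then have "set_integrable M X (\<lambda>u. Re (kk u 0))" unfolding set_integrable_def
        using integrable_Re by fastforce
      then show ?thesis
        by (subst (asm) set_integrable_cong[OF refl refl, of X _ "\<lambda>u. 1 / b u ^ Suc e"])
           (auto simp: radial_chart.k_0[OF chart] simp flip: of_real_mult of_real_power)
    qed
    have "1 / B ^ Suc e * measure M X = (LINT u:X|M. 1 / B ^ Suc e)"
      by (subst set_integral_const) (use Xb M in auto)
    also have "\<dots> \<le> (LINT u:X|M. 1 / b u ^ Suc e)"
    proof (rule set_integral_mono[OF _ i1])
      show "set_integrable M X (\<lambda>u. 1 / B ^ Suc e)"
        unfolding set_integrable_def using M Xb by (intro integrable_scaleR_left) auto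
      show "1 / B ^ Suc e \<le> 1 / b u ^ Suc e" if "u \<in> X" for u
        using um(2)[OF that] b_pos[OF that] unfolding B_def
        by (intro divide_left_mono power_mono mult_pos_pos zero_less_power) (auto intro: b_pos um)
    qed
    finally have "1 / B ^ Suc e * measure M X \<le> (LINT u:X|M. 1 / b u ^ Suc e)" .
    moreover have "0 < 1 / B ^ Suc e * measure M X"
      using M(3) b_pos[OF um(1)] by (auto simp: B_def)
    ultimately have "0 < (LINT u:X|M. 1 / b u ^ Suc e)" by (rule less_le_trans[rotated])
    moreover have "K 0 = of_real (LINT u:X|M. 1 / b u ^ Suc e)"
      unfolding K0 by (rule set_integral_complex_of_real)
    ultimately show ?thesis by simp
  qed
  moreover have "(LINT u:X|M. integral {0..R/4} (\<lambda>\<rho>. of_real \<rho> ^ e / (of_real (\<zeta>\<^sup>2) + (of_real \<rho> * s u \<rho>)\<^sup>2))) =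
       ((N (\<i> * \<zeta>) - (\<i> * \<zeta>) ^ e * K (\<i> * \<zeta>) * Ln (- (\<i> * \<zeta>))) -
        (N (- (\<i> * \<zeta>)) - (- (\<i> * \<zeta>)) ^ e * K (- (\<i> * \<zeta>)) * Ln (\<i> * \<zeta>))) / (2 * \<i> * \<zeta>)"
    if z: "0 < \<zeta>" "\<zeta> < r" for \<zeta> :: real
  proof -
    let ?a = "\<i> * complex_of_real \<zeta>"
    have ac: "?a \<in> cball 0 r" "- ?a \<in> cball 0 r" using z by (auto simp: norm_mult)
    have "(LINT u:X|M. integral {0..R/4} (\<lambda>\<rho>. of_real \<rho> ^ e / (of_real (\<zeta>\<^sup>2) + (of_real \<rho> * s u \<rho>)\<^sup>2))) =
      (LINT u:X|M. ((NN u ?a - kap u ?a * Ln (- ?a)) - (NN u (- ?a) - kap u (- ?a) * Ln ?a)) / (2 * ?a))"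
    proof (rule set_lebesgue_integral_cong)
      show "\<forall>u. u \<in> X \<longrightarrow> integral {0..R/4} (\<lambda>\<rho>. of_real \<rho> ^ e / (of_real (\<zeta>\<^sup>2) + (of_real \<rho> * s u \<rho>)\<^sup>2)) =
         ((NN u ?a - kap u ?a * Ln (- ?a)) - (NN u (- ?a) - kap u (- ?a) * Ln ?a)) / (2 * ?a)"
      proof (intro allI impI)
        fix u assume u: "u \<in> X"
        have "\<zeta> < b u * R / 16" using z r_le[OF u] by simp
        from radial_chart.chart_integral_resolvent[OF chart[OF u] z(1) this, of e]
        show "integral {0..R/4} (\<lambda>\<rho>. of_real \<rho> ^ e / (of_real (\<zeta>\<^sup>2) + (of_real \<rho> * s u \<rho>)\<^sup>2)) =
         ((NN u ?a - kap u ?a * Ln (- ?a)) - (NN u (- ?a) - kap u (- ?a) * Ln ?a)) / (2 * ?a)"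
          by (simp add: radial_chart.y_def[OF chart[OF u]] mult.assoc)
      qed
    qed (use Xb M in auto)
    also have "\<dots> = ((N ?a - (LINT u:X|M. kap u ?a) * Ln (- ?a)) - (N (- ?a) - (LINT u:X|M. kap u (- ?a)) * Ln ?a)) / (2 * ?a)"
    proof -
      have I: "set_integrable M X (\<lambda>u. NN u a)" "set_integrable M X (\<lambda>u. kap u a)" if "a \<in> cball 0 r" for a
        using averaged_integrable[OF cont_NN that] averaged_integrable[OF cont_kap that] .
      have J: "set_integrable M X (\<lambda>u. kap u a * c)" if "a \<in> cball 0 r" for a c
        using I(2)[OF that] by (intro set_integrable_mult_left) auto
      show ?thesis
        unfolding N_def
        using I[OF ac(1)] I[OF ac(2)] J[OF ac(1)] J[OF ac(2)]
        by (simp add: set_integral_diff)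
    qed
    finally show ?thesis by (simp add: kap_K[OF ac(1)] kap_K[OF ac(2)] mult.assoc)
  qed
  moreover have "N holomorphic_on ball 0 r" unfolding N_def
    by (rule averaged_holomorphic[OF cont_NN]) (rule radial_chart.N_hol[OF chart])
  moreover have "K holomorphic_on ball 0 r" unfolding K_def
    by (rule averaged_holomorphic[OF cont_kk]) (rule radial_chart.k_hol[OF chart])
  ultimately show ?thesis using that by blast
qed

end

section \<open>Functions with a logarithmic singularity\<close>

text \<open>
  The branch of the logarithm around \<open>exp c\<close> that has the value \<open>c\<close> there.
\<close>
definition Ln_branch :: "complex \<Rightarrow> complex \<Rightarrow> complex" where
  "Ln_branch c w = Ln (w * exp (- c)) + c"

lemma Ln_branch_0: "Ln_branch 0 w = Ln w"
  by (simp add: Ln_branch_def)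

lemma Ln_branch_exp: "Ln_branch c (exp c) = c"
  by (simp add: Ln_branch_def flip: exp_add)

lemma Ln_branch_eventually_eq:
  assumes "\<bar>Im (c' - c)\<bar> < pi"
  shows "\<forall>\<^sub>F w in nhds (exp c'). Ln_branch c' w = Ln_branch c w"
proof -
  have "((\<lambda>w. Im (Ln (w * exp (- c')))) \<longlongrightarrow> Im (Ln (exp c' * exp (- c')))) (nhds (exp c'))"
    by (intro tendsto_intros filterlim_ident) (auto simp flip: exp_add)
  then have "((\<lambda>w. Im (Ln (w * exp (- c')))) \<longlongrightarrow> 0) (nhds (exp c'))"
    by (simp flip: exp_add)
  then have "\<forall>\<^sub>F w in nhds (exp c'). dist (Im (Ln (w * exp (- c')))) 0 < pi - \<bar>Im (c' - c)\<bar>"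
    by (rule tendstoD) (use assms in auto)
  moreover have "\<forall>\<^sub>F w in nhds (exp c'). w \<noteq> 0"
    by (rule t1_space_nhds) simp
  ultimately show ?thesis
  proof eventually_elim
    case (elim w)
    have "Ln (w * exp (- c)) = Ln (w * exp (- c')) + (c' - c)"
    proof (rule Ln_unique)
      have "exp (Ln (w * exp (- c')) + (c' - c)) = w * exp (- c') * exp (c' - c)"
        using elim by (simp add: exp_add)
      also have "\<dots> = w * exp (- c)" by (simp add: mult.assoc flip: exp_add)
      finally show "exp (Ln (w * exp (- c')) + (c' - c)) = w * exp (- c)" .
    qed (use elim in \<open>auto simp: abs_if split: if_splits\<close>)
    then show ?case by (simp add: Ln_branch_def)
  qed
qed

text \<open>
  The representation of a power series near \<open>1 / T\<close> as a holomorphic function plus a function \<open>\<Lambda>\<close> of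
  \<open>ln (1 / t - T) / 2\<close>, known on a real interval. A turn around \<open>1 / T\<close> shifts the argument of \<open>\<Lambda>\<close>
  by \<open>\<pi> * \<i>\<close>, so \<open>jump\<close> is the assumption that makes the singularity a branch point.
\<close>
locale log_singularity =
  fixes F :: "complex fps" and T \<eta> \<sigma> :: real and A \<Lambda> :: "complex \<Rightarrow> complex"
  assumes T: "T > 0" and \<eta>: "\<eta> > 0"
    and A_hol: "A holomorphic_on ball (of_real (inverse T)) \<eta>"
    and \<Lambda>_hol: "\<Lambda> holomorphic_on {l. Re l < \<sigma>}"
    and radius_ge: "fps_conv_radius F \<ge> ereal (inverse T)"
    and decomp: "\<And>t. inverse T - \<eta> < t \<Longrightarrow> t < inverse T \<Longrightarrow> 0 < t \<Longrightarrow>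
        eval_fps F (of_real t) = A (of_real t) + \<Lambda> (of_real (ln (1 / t - T) / 2))"
    and jump: "\<And>l. Re l < \<sigma> \<Longrightarrow> \<Lambda> (l + pi * \<i>) \<noteq> \<Lambda> l"
begin

definition p :: complex where "p = of_real (inverse T)"

lemma p: "Re p = inverse T" "norm p = inverse T" "p \<noteq> 0" "1 / p = of_real T" "of_real T * p = 1"
proof -
  show "norm p = inverse T" using T by (simp add: p_def norm_inverse)
qed (use T in \<open>simp_all add: p_def field_simps\<close>)

lemma A_hol': "A holomorphic_on ball p \<eta>"
  using A_hol by (simp add: p_def)

definition w :: "complex \<Rightarrow> complex" where "w z = 1 / z - T"

text \<open>
  Radii of discs on which \<open>ln (1 / t - T) / 2\<close> stays in the domain of \<open>\<Lambda>\<close>, for every choice of the logarithm: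
  the condition \<open>Re l < \<sigma>\<close> depends only on \<open>norm (w z)\<close>.
\<close>
definition good :: "real \<Rightarrow> bool" where
  "good \<epsilon> \<longleftrightarrow> 0 < \<epsilon> \<and> \<epsilon> \<le> \<eta> \<and> \<epsilon> < inverse T \<and> (\<forall>z\<in>ball p \<epsilon>. norm (w z) < exp (2 * \<sigma>))"

lemma ex_good: "\<exists>\<epsilon>. good \<epsilon>"
proof -
  have "isCont w p" unfolding w_def[abs_def] using p by (intro continuous_intros) auto
  moreover have "w p = 0" using p by (simp add: w_def)
  ultimately have "(w \<longlongrightarrow> 0) (nhds p)" unfolding isCont_def tendsto_nhds_iff by simp
  then have "\<forall>\<^sub>F z in nhds p. dist (w z) 0 < exp (2 * \<sigma>)" by (rule tendstoD) simp
  then obtain d where d: "d > 0" "\<And>z. dist z p < d \<Longrightarrow> norm (w z) < exp (2 * \<sigma>)"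
    unfolding eventually_nhds_metric by auto
  have "good (min d (min \<eta> (inverse T / 2)))"
    using d \<eta> T by (auto simp: good_def dist_commute min_less_iff_disj)
  then show ?thesis ..
qed

context
  fixes \<epsilon> assumes good: "good \<epsilon>"
begin

lemma \<epsilon>: "0 < \<epsilon>" "\<epsilon> \<le> \<eta>" "\<epsilon> < inverse T" using good by (auto simp: good_def)

lemma Re_pos: assumes "z \<in> ball p \<epsilon>" shows "Re z > 0" "z \<noteq> 0"
proof -
  have "\<bar>Re (p - z)\<bar> < \<epsilon>"
    using assms abs_Re_le_cmod[of "p - z"] by (simp add: dist_norm)
  then show "Re z > 0" using \<epsilon> p by simp
  then show "z \<noteq> 0" by auto
qed

lemma w_nz: assumes "z \<in> ball p \<epsilon>" "z \<noteq> p" shows "w z \<noteq> 0"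
proof
  assume "w z = 0"
  then have "of_real T * z = of_real T * p"
    using Re_pos[OF assms(1)] p(5) by (simp add: w_def field_simps)
  then show False using T assms by simp
qed

lemma half_log_lt: assumes "z \<in> ball p \<epsilon>" "exp c = w z" shows "Re (c / 2) < \<sigma>"
proof -
  have "exp (Re c) < exp (2 * \<sigma>)" using good assms unfolding good_def by (metis norm_exp_eq_Re)
  then show ?thesis by simp
qed

text \<open>
  If \<open>w z\<close> were a real number that is not positive, then \<open>1 / z = T + w z\<close> would be at most \<open>T\<close>.
\<close>
lemma w_slit:
  assumes "norm z < inverse T" "z \<in> ball p \<epsilon>" shows "w z \<notin> \<real>\<^sub>\<le>\<^sub>0"
proof
  assume "w z \<in> \<real>\<^sub>\<le>\<^sub>0"
  then obtain x where x: "w z = of_real x" "x \<le> 0" by (auto elim!: nonpos_Reals_cases)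
  then have z: "1 / z = of_real (T + x)" by (simp add: w_def algebra_simps)
  then have zz: "z = of_real (1 / (T + x))"
    by (simp only: of_real_divide of_real_1 flip: z) simp
  then have "T + x > 0" using Re_pos[OF assms(2)] by (simp del: of_real_add of_real_divide)
  moreover have "1 / (T + x) < 1 / T"
    using assms(1) zz \<open>T + x > 0\<close> by (simp add: inverse_eq_divide norm_divide del: of_real_add)
  ultimately show False using x T by (simp add: divide_simps split: if_splits)
qed

text \<open>
  By the identity theorem the representation extends from the real interval to the convex intersection
  of the two discs, where the principal logarithm is holomorphic.
\<close>
lemma eval_eq:
  assumes z: "norm z < inverse T" "z \<in> ball p \<epsilon>"
  shows "eval_fps F z = A z + \<Lambda> (Ln (w z) / 2)"
proof -
  define S where "S = ball 0 (inverse T) \<inter> ball p \<epsilon>"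
  define g where "g z = eval_fps F z - (A z + \<Lambda> (Ln (w z) / 2))" for z
  have sl: "w z \<notin> \<real>\<^sub>\<le>\<^sub>0" if "z \<in> S" for z using w_slit[of z] that by (auto simp: S_def)
  have nz: "w z \<noteq> 0" if "z \<in> S" for z using sl[OF that] by auto
  have SF: "S \<subseteq> eball 0 (fps_conv_radius F)"
  proof
    fix x assume "x \<in> S"
    then have "ereal (norm x) < ereal (inverse T)" by (auto simp: S_def)
    from less_le_trans[OF this radius_ge] show "x \<in> eball 0 (fps_conv_radius F)"
      by (simp add: in_eball_iff)
  qed
  have wh: "w holomorphic_on S" unfolding w_def[abs_def]
    by (intro holomorphic_intros) (use Re_pos in \<open>auto simp: S_def\<close>)
  have "((\<lambda>z. \<Lambda> z) \<circ> (\<lambda>z. Ln (w z) / 2)) holomorphic_on S"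
  proof (rule holomorphic_on_compose_gen[OF _ \<Lambda>_hol])
    show "(\<lambda>z. Ln (w z) / 2) holomorphic_on S" using sl by (intro holomorphic_intros wh) auto
    show "(\<lambda>z. Ln (w z) / 2) ` S \<subseteq> {l. Re l < \<sigma>}"
    proof safe
      fix z assume z: "z \<in> S"
      show "Re (Ln (w z) / 2) < \<sigma>"
        by (rule half_log_lt[of z]) (use z sl[OF z] nz in \<open>auto simp: S_def\<close>)
    qed
  qed
  then have gh: "g holomorphic_on S" unfolding g_def
    using \<epsilon> by (intro holomorphic_intros SF holomorphic_on_subset[OF A_hol']) (auto simp: S_def o_def)
  define U where "U = complex_of_real ` {inverse T - \<epsilon> <..< inverse T}"
  have US: "U \<subseteq> S"
  proof
    fix x assume "x \<in> U"
    then obtain t where t: "x = of_real t" "inverse T - \<epsilon> < t" "t < inverse T" by (auto simp: U_def)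
    have "norm (p - x) = \<bar>inverse T - t\<bar>" unfolding t p_def by (metis norm_of_real of_real_diff)
    then show "x \<in> S" using t \<epsilon> by (auto simp: S_def dist_norm)
  qed
  define \<xi> where "\<xi> = complex_of_real (inverse T - \<epsilon> / 2)"
  have lim: "\<xi> islimpt U"
  proof -
    have "(inverse T - \<epsilon> / 2) islimpt {inverse T - \<epsilon> <..< inverse T}"
      using \<epsilon> by (intro interior_limit_point) auto
    moreover have "inj complex_of_real" by (simp add: inj_on_def)
    ultimately show ?thesis unfolding U_def \<xi>_def
      by (intro islimpt_isCont_image) (simp_all add: eventually_at_filter del: of_real_diff)
  qed
  have "\<xi> \<in> U" using \<epsilon> unfolding U_def \<xi>_def by (intro imageI) auto
  then have \<xi>S: "\<xi> \<in> S" using US by blast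
  have "g z = 0"
  proof (rule analytic_continuation[OF gh _ _ US \<xi>S lim])
    show "g x = 0" if xU: "x \<in> U" for x
    proof -
      obtain t where t: "x = of_real t" "inverse T - \<epsilon> < t" "t < inverse T" using xU by (auto simp: U_def)
      have t0: "t > 0" using t \<epsilon> by simp
      have "T < 1 / t" using t(3) t0 T by (simp add: field_simps)
      then have "Ln (of_real (1 / t - T)) = complex_of_real (ln (1 / t - T))" by (intro Ln_of_real) simp
      moreover have "w x = of_real (1 / t - T)" by (simp add: w_def t)
      ultimately have "Ln (w x) = of_real (ln (1 / t - T))" by simp
      then show ?thesis using decomp[of t] t t0 \<epsilon> by (simp add: g_def)
    qed
  qed (use z US in \<open>auto simp: S_def intro!: convex_connected convex_Int\<close>)
  then show ?thesis by (simp add: g_def)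
qed

text \<open>
  Two branches of the logarithm agree near a point as soon as their values there differ by less than \<open>\<pi>\<close>, so
  a continuous logarithm of \<open>w\<close> along the path is all that a continuation needs.
\<close>
lemma continuation_along_log_lift:
  assumes \<gamma>: "path \<gamma>" "path_image \<gamma> \<subseteq> ball p \<epsilon> - {p}"
    and c: "continuous_on {0..1} c" "\<And>s. s \<in> {0..1} \<Longrightarrow> exp (c s) = w (\<gamma> s)"
  shows "continuation_along \<gamma> (\<lambda>s z. A z + \<Lambda> (Ln_branch (c s) (w z) / 2))"
  unfolding continuation_along_def
proof (intro conjI ballI \<gamma>(1))
  fix s :: real assume s: "s \<in> {0..1}"
  have in': "\<gamma> s \<in> ball p \<epsilon>" if "s \<in> {0..1}" for s using \<gamma>(2) that unfolding path_image_def by blast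
  have wa: "w analytic_on {\<gamma> s}" unfolding w_def[abs_def]
    by (intro analytic_intros) (use Re_pos[OF in'[OF s]] in auto)
  have ba: "(\<lambda>z. Ln_branch (c s) (w z) / 2) analytic_on {\<gamma> s}"
    unfolding Ln_branch_def by (intro analytic_intros wa) (auto simp flip: c(2)[OF s] exp_add)
  have "(\<Lambda> \<circ> (\<lambda>z. Ln_branch (c s) (w z) / 2)) analytic_on {\<gamma> s}"
  proof (rule analytic_on_compose[OF ba])
    have "open {l. Re l < \<sigma>}" by (rule open_halfspace_Re_lt)
    then have "\<Lambda> analytic_on {l. Re l < \<sigma>}" using \<Lambda>_hol by (simp add: analytic_on_open)
    then show "\<Lambda> analytic_on (\<lambda>z. Ln_branch (c s) (w z) / 2) ` {\<gamma> s}"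
      by (rule analytic_on_subset)
         (use half_log_lt[OF in'[OF s] c(2)[OF s]] in \<open>auto simp: Ln_branch_exp simp flip: c(2)[OF s]\<close>)
  qed
  moreover have "A analytic_on {\<gamma> s}"
    using A_hol' in'[OF s] \<epsilon> by (intro analytic_on_subset[of A "ball p \<eta>" "{\<gamma> s}"]) (auto simp: analytic_on_open)
  ultimately show "(\<lambda>z. A z + \<Lambda> (Ln_branch (c s) (w z) / 2)) analytic_on {\<gamma> s}"
    by (intro analytic_on_add) (auto simp: o_def)
  have "((\<lambda>s'. \<bar>Im (c s' - c s)\<bar>) \<longlongrightarrow> \<bar>Im (c s - c s)\<bar>) (at s within {0..1})"
    using c(1) s by (intro tendsto_intros) (auto simp: continuous_on_def)
  then have "\<forall>\<^sub>F s' in at s within {0..1}. \<bar>Im (c s' - c s)\<bar> < pi"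
    by (rule order_tendstoD) simp
  moreover have "\<forall>\<^sub>F s' in at s within {0..1}. s' \<in> {0..1}"
    by (simp add: eventually_at_filter)
  ultimately show "\<forall>\<^sub>F s' in at s within {0..1}. same_germ (\<gamma> s') (\<lambda>z. A z + \<Lambda> (Ln_branch (c s') (w z) / 2))
       (\<lambda>z. A z + \<Lambda> (Ln_branch (c s) (w z) / 2))"
  proof eventually_elim
    case (elim s')
    have "isCont w (\<gamma> s')" unfolding w_def[abs_def]
      using Re_pos[OF in'[OF elim(2)]] by (intro continuous_intros) auto
    then have "filterlim w (nhds (exp (c s'))) (nhds (\<gamma> s'))"
      using c(2)[OF elim(2)] by (simp add: isCont_def tendsto_nhds_iff)
    from eventually_compose_filterlim[OF Ln_branch_eventually_eq[OF elim(1)] this]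
    show ?case unfolding same_germ_def by eventually_elim simp
  qed
qed

lemma same_germ_start:
  assumes z: "norm z < inverse T" "z \<in> ball p \<epsilon>"
  shows "same_germ z (\<lambda>x. A x + \<Lambda> (Ln_branch (Ln (w z)) (w x) / 2)) (eval_fps F)"
proof -
  have sl: "w z \<notin> \<real>\<^sub>\<le>\<^sub>0" by (rule w_slit[OF z])
  then have e: "exp (Ln (w z)) = w z" by (cases "w z = 0") auto
  have "isCont w z" unfolding w_def[abs_def]
    using Re_pos[OF z(2)] by (intro continuous_intros) auto
  then have wl: "filterlim w (nhds (exp (Ln (w z)))) (nhds z)"
    by (simp add: isCont_def tendsto_nhds_iff e)
  have "\<bar>Im (Ln (w z) - 0)\<bar> < pi"
    using mpi_less_Im_Ln[of "w z"] Im_Ln_less_pi[OF sl] sl by (cases "w z = 0") auto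
  from eventually_compose_filterlim[OF Ln_branch_eventually_eq[OF this] wl]
  have "\<forall>\<^sub>F x in nhds z. Ln_branch (Ln (w z)) (w x) = Ln (w x)" by (simp add: Ln_branch_0)
  moreover have "\<forall>\<^sub>F x in nhds z. x \<in> ball 0 (inverse T) \<inter> ball p \<epsilon>"
    by (rule eventually_nhds_in_open) (use z in auto)
  ultimately show ?thesis unfolding same_germ_def
    by eventually_elim (auto simp: eval_eq)
qed

lemma log_lift:
  assumes \<gamma>: "path \<gamma>" "path_image \<gamma> \<subseteq> ball p \<epsilon> - {p}"
  obtains c where "continuous_on {0..1} c" "\<And>s. s \<in> {0..1} \<Longrightarrow> exp (c s) = w (\<gamma> s)" "c 0 = Ln (w (\<gamma> 0))"
proof -
  have in': "\<gamma> s \<in> ball p \<epsilon> - {p}" if "s \<in> {0..1}" for s using \<gamma>(2) that unfolding path_image_def by blast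
  have cont: "continuous_on {0..1} (\<lambda>s. w (\<gamma> s))" unfolding w_def
    using \<gamma>(1) Re_pos in' by (intro continuous_intros) (auto simp: path_def)
  have nz: "w (\<gamma> s) \<noteq> 0" if "s \<in> {0..1}" for s using w_nz in'[OF that] by auto
  obtain g where g: "continuous_on {0..1} g" "\<And>s. s \<in> {0..1} \<Longrightarrow> w (\<gamma> s) = exp (g s)"
    by (rule continuous_logarithm_on_contractible[OF cont _ nz]) (auto intro: convex_imp_contractible)
  show ?thesis
  proof (rule that[of "\<lambda>s. g s + (Ln (w (\<gamma> 0)) - g 0)"])
    have "exp (Ln (w (\<gamma> 0)) - g 0) = 1" using g(2)[of 0] nz[of 0] by (simp add: exp_diff)
    then show "exp (g s + (Ln (w (\<gamma> 0)) - g 0)) = w (\<gamma> s)" if "s \<in> {0..1}" for s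
      using g(2)[OF that] by (simp add: exp_add)
  qed (auto intro!: continuous_intros g)
qed

end

text \<open>
  In the coordinate \<open>l\<close> with \<open>t = 1 / (T + exp (2 * l))\<close>, a larger radius would make \<open>\<Lambda> l\<close> equal to
  \<open>G t - A t\<close> on a left half-plane, and this is periodic with period \<open>\<pi> * \<i>\<close>.
\<close>
lemma radius_eq: "fps_conv_radius F = ereal (inverse T)"
proof (rule antisym[OF _ radius_ge], rule ccontr)
  assume "\<not> fps_conv_radius F \<le> ereal (inverse T)"
  then have "p \<in> eball 0 (fps_conv_radius F)" using p by (simp add: in_eball_iff)
  then obtain d where d: "d > 0" "ball p d \<subseteq> eball 0 (fps_conv_radius F)"
    using open_eball open_contains_ball by blast
  define e where "e = min d (min \<eta> (inverse T / 2))"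
  have e: "e > 0" "e \<le> d" "e \<le> \<eta>" "e < inverse T" using d \<eta> T by (auto simp: e_def min_less_iff_disj)
  have "isCont (\<lambda>x::complex. 1 / (of_real T + x)) 0" using T by (intro continuous_intros) auto
  then have "((\<lambda>x. 1 / (of_real T + x)) \<longlongrightarrow> p) (nhds 0)"
    unfolding isCont_def tendsto_nhds_iff by (simp add: p_def inverse_eq_divide)
  then have "\<forall>\<^sub>F x in nhds 0. dist (1 / (of_real T + x)) p < e" by (rule tendstoD) (use e in auto)
  then obtain \<mu> where \<mu>: "\<mu> > 0" "\<And>x. norm x < \<mu> \<Longrightarrow> dist (1 / (of_real T + x)) p < e"
    unfolding eventually_nhds_metric by auto
  define \<tau> where "\<tau> l = 1 / (of_real T + exp (2 * l))" for l :: complex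
  define \<sigma>' where "\<sigma>' = min \<sigma> (min (ln \<mu> / 2) (ln T / 2))"
  define H where "H = {l :: complex. Re l < \<sigma>'}"
  have Hop: "open H" "convex H" unfolding H_def by (auto simp: open_halfspace_Re_lt convex_halfspace_Re_lt)
  have x: "norm (exp (2 * l)) < \<mu>" "norm (exp (2 * l)) < T" if "l \<in> H" for l
  proof -
    have "2 * Re l < ln \<mu>" "2 * Re l < ln T" using that by (auto simp: H_def \<sigma>'_def)
    then have "exp (2 * Re l) < exp (ln \<mu>)" "exp (2 * Re l) < exp (ln T)" by simp_all
    then show "norm (exp (2 * l)) < \<mu>" "norm (exp (2 * l)) < T" using \<mu>(1) T by simp_all
  qed
  have nz: "of_real T + exp (2 * l) \<noteq> 0" if "l \<in> H" for l
    using x(2)[OF that] T by (metis add_eq_0_iff abs_of_pos norm_minus_cancel norm_of_real order_less_irrefl)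
  have \<tau>b: "\<tau> l \<in> ball p e" if "l \<in> H" for l
    using \<mu>(2)[OF x(1)[OF that]] by (simp add: \<tau>_def dist_commute)
  have \<tau>h: "\<tau> holomorphic_on H" unfolding \<tau>_def[abs_def] by (intro holomorphic_intros) (use nz in auto)
  define g where "g l = eval_fps F (\<tau> l) - (A (\<tau> l) + \<Lambda> l)" for l
  have "(eval_fps F \<circ> \<tau>) holomorphic_on H" "(A \<circ> \<tau>) holomorphic_on H"
    using \<tau>b e d
    by (auto intro!: holomorphic_on_compose_gen[OF \<tau>h, of _ "ball p e"] holomorphic_on_eval_fps holomorphic_on_subset[OF A_hol'])
  then have gh: "g holomorphic_on H" unfolding g_def
    by (intro holomorphic_intros holomorphic_on_subset[OF \<Lambda>_hol]) (auto simp: H_def \<sigma>'_def o_def)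
  define U where "U = complex_of_real ` {..<\<sigma>'}"
  have US: "U \<subseteq> H" by (auto simp: U_def H_def)
  have lim: "of_real (\<sigma>' - 1) islimpt U"
  proof -
    have "(\<sigma>' - 1) islimpt {..<\<sigma>'}" by (intro interior_limit_point) (simp add: interior_open)
    then show ?thesis unfolding U_def
      by (intro islimpt_isCont_image) (simp_all add: eventually_at_filter del: of_real_diff)
  qed
  have g0: "g l = 0" if "l \<in> H" for l
  proof (rule analytic_continuation[OF gh Hop(1) _ US _ lim _ that])
    show "g x = 0" if xU: "x \<in> U" for x
    proof -
      obtain u where u: "x = of_real u" "u < \<sigma>'" using xU by (auto simp: U_def)
      define t where "t = 1 / (T + exp (2 * u))"
      have "T + exp (2 * u) > 0" using T by (simp add: add_pos_pos)
      then have t: "t > 0" "t < inverse T" "1 / t - T = exp (2 * u)" using T by (auto simp: t_def field_simps)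
      have \<tau>t: "\<tau> x = of_real t" by (simp add: \<tau>_def t_def u flip: exp_of_real)
      have "norm (p - of_real t) < e" using \<tau>b[of x] xU US \<tau>t by (auto simp: dist_norm)
      then have "\<bar>inverse T - t\<bar> < e" unfolding p_def by (metis norm_of_real of_real_diff)
      then have "inverse T - \<eta> < t" using e by linarith
      from decomp[OF this t(2,1)] show ?thesis
        by (simp add: g_def \<tau>t t(3)) (simp add: u)
    qed
  qed (use Hop in \<open>auto simp: H_def convex_connected\<close>)
  define l where "l = complex_of_real (\<sigma>' - 1)"
  have lH: "l \<in> H" "l + pi * \<i> \<in> H" by (auto simp: l_def H_def)
  have e2: "2 * (l + pi * \<i>) = 2 * l + 2 * of_real pi * \<i>" by (simp add: algebra_simps)
  have "exp (2 * (l + pi * \<i>)) = exp (2 * l)" unfolding e2 exp_add exp_two_pi_i by simp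
  then have "\<tau> (l + pi * \<i>) = \<tau> l" by (simp add: \<tau>_def)
  then have "\<Lambda> (l + pi * \<i>) = \<Lambda> l" using g0[OF lH(1)] g0[OF lH(2)] by (simp add: g_def)
  moreover have "Re l < \<sigma>" by (simp add: l_def \<sigma>'_def)
  ultimately show False using jump by blast
qed

lemma monodromy:
  "\<exists>\<epsilon>>0. extends_multivalued (eval_fps F) (eball 0 (fps_conv_radius F)) (ball p \<epsilon> - {p}) \<and>
     nontrivial_monodromy (eval_fps F) (eball 0 (fps_conv_radius F)) p \<epsilon>"
proof -
  obtain \<epsilon> where good: "good \<epsilon>" using ex_good by blast
  note \<epsilon> = \<epsilon>[OF good]
  have D: "z \<in> eball 0 (fps_conv_radius F) \<longleftrightarrow> norm z < inverse T" for z
    by (simp add: radius_eq in_eball_iff)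
  have "extends_multivalued (eval_fps F) (eball 0 (fps_conv_radius F)) (ball p \<epsilon> - {p})"
    unfolding extends_multivalued_def
  proof (intro allI impI, elim conjE)
    fix \<gamma> assume \<gamma>: "path \<gamma>" "path_image \<gamma> \<subseteq> ball p \<epsilon> - {p}" "pathstart \<gamma> \<in> eball 0 (fps_conv_radius F)"
    obtain c where c: "continuous_on {0..1} c" "\<And>s. s \<in> {0..1} \<Longrightarrow> exp (c s) = w (\<gamma> s)" "c 0 = Ln (w (\<gamma> 0))"
      using log_lift[OF good \<gamma>(1,2)] by blast
    have "\<gamma> 0 \<in> ball p \<epsilon>" "norm (\<gamma> 0) < inverse T"
      using \<gamma>(2) D[THEN iffD1, OF \<gamma>(3)] by (auto simp: pathstart_def image_subset_iff path_image_def)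
    then have "same_germ (pathstart \<gamma>) (\<lambda>z. A z + \<Lambda> (Ln_branch (c 0) (w z) / 2)) (eval_fps F)"
      using same_germ_start[OF good] by (simp add: pathstart_def c(3))
    then show "\<exists>F'. continuation_along \<gamma> F' \<and> same_germ (pathstart \<gamma>) (F' 0) (eval_fps F)"
      using continuation_along_log_lift[OF good \<gamma>(1,2) c(1,2)] by blast
  qed
  moreover have "nontrivial_monodromy (eval_fps F) (eball 0 (fps_conv_radius F)) p \<epsilon>"
  proof -
    \<comment> \<open>around a circle through a real point the logarithm is explicit: \<open>w = T / t * (p - t)\<close>, and \<open>Re t > 0\<close>\<close>
    define a where "a = complex_of_real (inverse T - \<epsilon> / 2)"
    define \<gamma> where "\<gamma> s = p + (a - p) * cis (2 * pi * s)" for s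
    have ap: "a - p = - of_real (\<epsilon> / 2)" by (simp add: a_def p_def)
    have \<gamma>in: "\<gamma> s \<in> ball p \<epsilon> - {p}" for s
      using \<epsilon> by (auto simp: \<gamma>_def ap dist_norm norm_mult)
    have \<gamma>p: "path \<gamma>" unfolding path_def \<gamma>_def by (intro continuous_intros)
    have \<gamma>i: "path_image \<gamma> \<subseteq> ball p \<epsilon> - {p}" using \<gamma>in by (auto simp: path_image_def)
    have \<gamma>0: "\<gamma> 0 = a" "\<gamma> 1 = a" by (simp_all add: \<gamma>_def)
    have ain: "a \<in> ball p \<epsilon> - {p}" using \<gamma>in[of 0] \<gamma>0 by simp
    have an: "norm a < inverse T" using \<epsilon> by (simp add: a_def del: of_real_diff)
    have Rep: "Re (\<gamma> s) > 0" for s using Re_pos[OF good, of "\<gamma> s"] \<gamma>in[of s] by auto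
    have sl: "of_real T / \<gamma> s \<notin> \<real>\<^sub>\<le>\<^sub>0" for s
    proof -
      have "Re (of_real T / \<gamma> s) > 0" using Rep[of s] T by (simp add: Re_divide_of_real complex_div_gt_0 Re_divide sum_power2_gt_zero_iff)
      then show ?thesis by (auto simp: complex_nonpos_Reals_iff)
    qed
    have gz: "\<gamma> s \<noteq> 0" for s using Rep[of s] by auto
    define c where "c s = of_real (ln (\<epsilon> / 2)) + 2 * pi * \<i> * of_real s + Ln (of_real T / \<gamma> s)" for s
    have cc: "continuous_on {0..1} c" unfolding c_def
      by (intro continuous_intros) (use sl gz \<gamma>p in \<open>auto simp: path_def\<close>)
    have ce: "exp (c s) = w (\<gamma> s)" for s
    proof -
      have nz: "\<gamma> s \<noteq> 0" using Rep[of s] by auto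
      have "exp (c s) = of_real (\<epsilon> / 2) * cis (2 * pi * s) * (of_real T / \<gamma> s)"
        using nz T \<epsilon> by (simp add: c_def exp_add cis_conv_exp mult_ac exp_of_real)
      also have "of_real (\<epsilon> / 2) * cis (2 * pi * s) = p - \<gamma> s" by (simp add: \<gamma>_def ap)
      finally show ?thesis using nz p(5) by (simp add: w_def field_simps)
    qed
    have c0: "c 0 = Ln (w a)"
    proof -
      have "Im (c 0) = 0"
      proof -
        have "of_real T / \<gamma> 0 = of_real (T / (inverse T - \<epsilon> / 2))" by (simp add: \<gamma>0 a_def)
        moreover have "T / (inverse T - \<epsilon> / 2) > 0" using T \<epsilon> by simp
        ultimately show ?thesis by (simp add: c_def Ln_of_real del: of_real_divide of_real_diff)
      qed
      then show ?thesis using ce[of 0] \<gamma>0 by (intro Ln_unique[symmetric]) auto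
    qed
    have c1: "c 1 = c 0 + 2 * pi * \<i>" by (simp add: c_def \<gamma>0)
    define F' where "F' s z = A z + \<Lambda> (Ln_branch (c s) (w z) / 2)" for s z
    have 1: "continuation_along \<gamma> F'"
      unfolding F'_def by (rule continuation_along_log_lift[OF good \<gamma>p \<gamma>i cc ce])
    have 2: "same_germ a (F' 0) (eval_fps F)"
      unfolding F'_def c0 by (rule same_germ_start[OF good an]) (use ain in auto)
    have 3: "\<not> same_germ a (F' 1) (eval_fps F)"
    proof
      assume "same_germ a (F' 1) (eval_fps F)"
      then have "F' 1 a = eval_fps F a" unfolding same_germ_def by (rule eventually_nhds_x_imp_x)
      moreover have "F' 0 a = eval_fps F a" using 2 unfolding same_germ_def by (rule eventually_nhds_x_imp_x)
      ultimately have "\<Lambda> (c 1 / 2) = \<Lambda> (c 0 / 2)"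
        using Ln_branch_exp[of "c 0"] Ln_branch_exp[of "c 1"] ce[of 0] ce[of 1] unfolding F'_def \<gamma>0 by (metis add_left_cancel)
      moreover have "c 1 / 2 = c 0 / 2 + pi * \<i>" by (simp add: c1 add_divide_distrib)
      moreover have "Re (c 0 / 2) < \<sigma>"
        by (rule half_log_lt[OF good, of a]) (use ain ce[of 0] \<gamma>0 in auto)
      ultimately show False using jump by metis
    qed
    show ?thesis unfolding nontrivial_monodromy_def
      using 1 2 3 ain D[THEN iffD2, OF an] by (intro exI[of _ a] exI[of _ F']) (auto simp: \<gamma>_def[abs_def])
  qed
  ultimately show ?thesis using \<epsilon>(1) by blast
qed

end

section \<open>Constant terms as integrals over the torus\<close>

lemma poly_mapping_eq_sum_single:
  fixes f :: "'a \<Rightarrow>\<^sub>0 'b::comm_monoid_add"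
  shows "f = (\<Sum>a\<in>Poly_Mapping.keys f. Poly_Mapping.single a (Poly_Mapping.lookup f a))"
  by (rule poly_mapping_eqI) (auto simp: lookup_sum lookup_single when_def in_keys_iff)

definition char_eval :: "('k \<Rightarrow> complex) \<Rightarrow> ('k \<Rightarrow>\<^sub>0 real) \<Rightarrow> complex" where
  "char_eval \<psi> f = (\<Sum>a\<in>Poly_Mapping.keys f. of_real (Poly_Mapping.lookup f a) * \<psi> a)"

lemma char_eval_superset:
  assumes "finite S" "Poly_Mapping.keys f \<subseteq> S"
  shows "char_eval \<psi> f = (\<Sum>a\<in>S. of_real (Poly_Mapping.lookup f a) * \<psi> a)"
  unfolding char_eval_def by (rule sum.mono_neutral_left) (use assms in \<open>auto simp: in_keys_iff\<close>)

lemma char_eval_add: "char_eval \<psi> (f + g) = char_eval \<psi> f + char_eval \<psi> g"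
proof -
  let ?S = "Poly_Mapping.keys f \<union> Poly_Mapping.keys g"
  have "Poly_Mapping.keys (f + g) \<subseteq> ?S" by (rule keys_add)
  then show ?thesis
    by (simp add: char_eval_superset[of ?S] lookup_add distrib_right sum.distrib)
qed

lemma char_eval_0 [simp]: "char_eval \<psi> 0 = 0"
  by (simp add: char_eval_def)

lemma char_eval_sum: "char_eval \<psi> (\<Sum>i\<in>I. F i) = (\<Sum>i\<in>I. char_eval \<psi> (F i))"
  by (induction I rule: infinite_finite_induct) (simp_all add: char_eval_add)

lemma char_eval_single: "char_eval \<psi> (Poly_Mapping.single a c) = of_real c * \<psi> a"
  by (cases "c = 0") (simp_all add: char_eval_def)

lemma poly_mapping_mult_eq_sum:
  fixes f g :: "'k::comm_monoid_add \<Rightarrow>\<^sub>0 'b::comm_semiring_1"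
  shows "f * g = (\<Sum>a\<in>Poly_Mapping.keys f. \<Sum>b\<in>Poly_Mapping.keys g.
      Poly_Mapping.single (a + b) (Poly_Mapping.lookup f a * Poly_Mapping.lookup g b))"
  by (subst poly_mapping_eq_sum_single[of f], subst poly_mapping_eq_sum_single[of g])
     (simp add: sum_product mult_single)

lemma char_eval_mult:
  fixes f g :: "'k::comm_monoid_add \<Rightarrow>\<^sub>0 real"
  assumes "\<And>a b. \<psi> (a + b) = \<psi> a * \<psi> b"
  shows "char_eval \<psi> (f * g) = char_eval \<psi> f * char_eval \<psi> g"
proof -
  have "char_eval \<psi> (f * g) = (\<Sum>a\<in>Poly_Mapping.keys f. \<Sum>b\<in>Poly_Mapping.keys g.
      (of_real (Poly_Mapping.lookup f a) * \<psi> a) * (of_real (Poly_Mapping.lookup g b) * \<psi> b))"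
    by (subst poly_mapping_mult_eq_sum) (simp add: char_eval_sum char_eval_single assms mult_ac)
  then show ?thesis by (simp add: char_eval_def sum_product)
qed

lemma char_eval_power:
  fixes f :: "'k::comm_monoid_add \<Rightarrow>\<^sub>0 real"
  assumes "\<And>a b. \<psi> (a + b) = \<psi> a * \<psi> b" "\<psi> 0 = 1"
  shows "char_eval \<psi> (f ^ n) = char_eval \<psi> f ^ n"
proof (induction n)
  case 0
  show ?case using assms(2) by (simp add: char_eval_def)
next
  case (Suc n)
  then show ?case using char_eval_mult[OF assms(1)] by simp
qed

definition rvec :: "int ^ 'm \<Rightarrow> real ^ 'm" where "rvec a = (\<chi> i. real_of_int (a $ i))"

lemma rvec_add: "rvec (a + b) = rvec a + rvec b"
  by (simp add: rvec_def vec_eq_iff)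

lemma rvec_0 [simp]: "rvec 0 = 0"
  by (simp add: rvec_def vec_eq_iff)

lemma integral_exp_int_period:
  fixes k :: int and \<beta> :: real
  shows "(LINT x:{\<beta>..\<beta> + 2 * pi}|lborel. exp (\<i> * of_real (of_int k * x))) = (if k = 0 then 2 * pi else 0)"
proof (cases "k = 0")
  case True
  then show ?thesis by (simp add: set_lebesgue_integral_def scaleR_conv_of_real)
next
  case False
  have c: "continuous_on A (\<lambda>x. exp (\<i> * of_real (of_int k * x)))" for A
    by (intro continuous_intros)
  have "(LINT x:{\<beta>..\<beta> + 2 * pi}|lborel. exp (\<i> * of_real (of_int k * x))) =
    integral {\<beta>..\<beta> + 2 * pi} (\<lambda>x. exp (\<i> * of_real (of_int k * x)))"
    by (rule set_borel_integral_eq_integral(2), unfold set_integrable_def, rule borel_integrable_compact, simp, rule c)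
  also have "\<dots> = exp (\<i> * of_real (of_int k * (\<beta> + 2 * pi))) / (\<i> * of_int k) - exp (\<i> * of_real (of_int k * \<beta>)) / (\<i> * of_int k)"
  proof (rule integral_unique, rule fundamental_theorem_of_calculus)
    fix x assume "x \<in> {\<beta>..\<beta> + 2 * pi}"
    define c where "c = \<i> * complex_of_int k"
    have "((\<lambda>z. exp (c * z) / c) has_field_derivative exp (c * of_real x)) (at (of_real x))"
      using False by (auto intro!: derivative_eq_intros simp: c_def)
    from has_vector_derivative_real_field[OF this]
    show "((\<lambda>x. exp (\<i> * of_real (of_int k * x)) / (\<i> * of_int k)) has_vector_derivative exp (\<i> * of_real (of_int k * x))) (at x within {\<beta>..\<beta> + 2 * pi})"
      by (simp add: o_def c_def mult.assoc)
  qed simp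
  also have "exp (\<i> * of_real (of_int k * (\<beta> + 2 * pi))) = exp (\<i> * of_real (of_int k * \<beta>)) * exp (2 * of_int k * of_real pi * \<i>)"
    by (simp add: algebra_simps flip: exp_add)
  also have "exp (2 * of_int k * of_real pi * \<i>) = 1"
    using exp_integer_2pi[of "of_int k"] by (simp add: mult_ac)
  finally show ?thesis using False by simp
qed

text \<open>
  The corner is a parameter so that the boundary of the box can avoid a given countable set.
\<close>
definition period_box :: "real \<Rightarrow> (real ^ 'm) set" where
  "period_box \<beta> = cbox (\<chi> i. \<beta>) (\<chi> i. \<beta> + 2 * pi)"

lemma mem_period_box:
  "\<theta> \<in> (period_box \<beta> :: (real ^ 'm::finite) set) \<longleftrightarrow> (\<forall>b\<in>Basis. \<theta> \<bullet> b \<in> {\<beta>..\<beta> + 2 * pi})"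
proof -
  have "(\<chi> i. c) \<bullet> b = c" if "b \<in> Basis" for c :: real and b :: "real ^ 'm"
    using that by (auto simp: Basis_vec_def inner_axis)
  then show ?thesis by (simp add: period_box_def mem_box)
qed

text \<open>
  Lebesgue measure, the box and the character are all products over the coordinates.
\<close>
lemma integral_character_period_box:
  fixes a :: "int ^ 'm::finite"
  shows "(LINT \<theta>:period_box \<beta>|lborel. exp (\<i> * of_real (\<theta> \<bullet> rvec a))) = (if a = 0 then (2 * pi) ^ CARD('m) else 0)"
proof -
  interpret product_sigma_finite "\<lambda>_::real^'m. lborel :: real measure" ..
  define k where "k b = (\<Sum>i\<in>UNIV. if b = axis i 1 then a $ i else 0)" for b :: "real ^ 'm"
  have ka: "k (axis i 1) = a $ i" for i
    by (simp add: k_def axis_eq_axis)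
  have kb: "rvec a \<bullet> b = of_int (k b)" if "b \<in> Basis" for b
    using that by (auto simp: Basis_vec_def ka inner_axis rvec_def)
  define h where "h b x = indicator {\<beta>..\<beta> + 2 * pi} x *\<^sub>R exp (\<i> * of_real (of_int (k b) * x))" for b x
  have hm: "h b \<in> borel_measurable lborel" for b unfolding h_def by measurable
  have hI: "integrable lborel (h b)" for b
    unfolding h_def by (rule borel_integrable_compact) (auto intro!: continuous_intros)
  have factor: "indicator (period_box \<beta>) \<theta> *\<^sub>R exp (\<i> * of_real (\<theta> \<bullet> rvec a)) = (\<Prod>b\<in>Basis. h b (\<theta> \<bullet> b))" for \<theta> :: "real ^ 'm"
  proof -
    have "exp (\<i> * of_real (\<theta> \<bullet> rvec a)) = exp (\<Sum>b\<in>Basis. \<i> * of_real (of_int (k b) * (\<theta> \<bullet> b)))"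
      by (subst euclidean_inner) (simp add: kb sum_distrib_left mult_ac)
    also have "\<dots> = (\<Prod>b\<in>Basis. exp (\<i> * of_real (of_int (k b) * (\<theta> \<bullet> b))))"
      by (rule exp_sum) simp
    finally have e: "exp (\<i> * of_real (\<theta> \<bullet> rvec a)) = (\<Prod>b\<in>Basis. exp (\<i> * of_real (of_int (k b) * (\<theta> \<bullet> b))))" .
    show ?thesis
    proof (cases "\<theta> \<in> period_box \<beta>")
      case True
      then have "\<theta> \<bullet> b \<in> {\<beta>..\<beta> + 2 * pi}" if "b \<in> Basis" for b
        using that by (auto simp: mem_period_box)
      then show ?thesis using True by (simp add: e h_def)
    next
      case False
      then obtain b where b: "b \<in> Basis" "\<theta> \<bullet> b \<notin> {\<beta>..\<beta> + 2 * pi}"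
        by (auto simp: mem_period_box)
      then have "(\<Prod>b\<in>Basis. h b (\<theta> \<bullet> b)) = 0" by (intro prod_zero) (use b in \<open>auto simp: h_def intro!: bexI[of _ b]\<close>)
      then show ?thesis using False by simp
    qed
  qed
  have "(LINT \<theta>:period_box \<beta>|lborel. exp (\<i> * of_real (\<theta> \<bullet> rvec a))) = (LINT \<theta>|lborel. (\<Prod>b\<in>Basis. h b (\<theta> \<bullet> b)))"
    unfolding set_lebesgue_integral_def by (simp only: factor)
  also have "\<dots> = (LINT x|Pi\<^sub>M Basis (\<lambda>_. lborel). (\<Prod>b\<in>Basis. h b ((\<Sum>b\<in>Basis. x b *\<^sub>R b) \<bullet> b)))"
    by (subst lborel_eq, rule integral_distr) (use hm in \<open>auto intro!: borel_measurable_prod\<close>)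
  also have "\<dots> = (LINT x|Pi\<^sub>M Basis (\<lambda>_. lborel). (\<Prod>b\<in>Basis. h b (x b)))"
    by (simp add: inner_sum_left_Basis)
  also have "\<dots> = (\<Prod>b\<in>Basis. LINT x|lborel. h b x)"
    by (rule product_integral_prod) (use hI in auto)
  also have "\<dots> = (\<Prod>b\<in>Basis. if k b = 0 then 2 * pi else 0)"
    unfolding h_def using integral_exp_int_period unfolding set_lebesgue_integral_def by simp
  also have "\<dots> = (if a = 0 then (2 * pi) ^ CARD('m) else 0)"
  proof (cases "a = 0")
    case True
    then have "k b = 0" for b unfolding k_def by (intro sum.neutral) (simp add: True)
    then show ?thesis using True by simp
  next
    case False
    then obtain i where "a $ i \<noteq> 0" by (auto simp: vec_eq_iff)
    then have "k (axis i 1) \<noteq> 0" "axis i 1 \<in> (Basis :: (real ^ 'm) set)" by (auto simp: ka Basis_vec_def)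
    then have "(\<Prod>b\<in>Basis. if k b = 0 then 2 * pi else 0) = 0"
      by (intro prod_zero) auto
    then show ?thesis using False by (simp only: of_real_0 if_False)
  qed
  finally show ?thesis .
qed

text \<open>
  The value of \<open>f\<close> at the point with coordinates \<open>exp (\<xi> $ i + \<i> * \<theta> $ i)\<close>.
\<close>
definition torus_eval :: "'m::finite laurent \<Rightarrow> real ^ 'm \<Rightarrow> real ^ 'm \<Rightarrow> complex" where
  "torus_eval f \<xi> \<theta> = char_eval (\<lambda>a. exp (of_real (\<xi> \<bullet> rvec a) + \<i> * of_real (\<theta> \<bullet> rvec a))) f"

lemma torus_eval_power: "torus_eval (f ^ n) \<xi> \<theta> = torus_eval f \<xi> \<theta> ^ n"
  unfolding torus_eval_def
  by (rule char_eval_power) (simp_all add: rvec_add inner_add_right algebra_simps exp_add)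

lemma continuous_on_torus_eval: "continuous_on S (torus_eval f \<xi>)"
  unfolding torus_eval_def char_eval_def by (intro continuous_intros)

lemma set_integrable_period_box:
  fixes h :: "real ^ 'm::finite \<Rightarrow> complex"
  assumes "continuous_on (period_box \<beta>) h"
  shows "set_integrable lborel (period_box \<beta>) h"
  unfolding set_integrable_def
  by (rule borel_integrable_compact) (use assms in \<open>auto simp: period_box_def compact_cbox\<close>)

lemma Cst_eq_integral:
  fixes f :: "'m::finite laurent"
  shows "(LINT \<theta>:period_box \<beta>|lborel. torus_eval f \<xi> \<theta> ^ n) = of_real ((2 * pi) ^ CARD('m) * Cst (f ^ n))"
proof -
  let ?h = "f ^ n"
  let ?c = "\<lambda>a. complex_of_real (Poly_Mapping.lookup ?h a * exp (\<xi> \<bullet> rvec a))"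
  have "(LINT \<theta>:period_box \<beta>|lborel. torus_eval f \<xi> \<theta> ^ n) = (LINT \<theta>:period_box \<beta>|lborel. torus_eval ?h \<xi> \<theta>)"
    by (simp add: torus_eval_power)
  also have "\<dots> = (LINT \<theta>:period_box \<beta>|lborel. (\<Sum>a\<in>Poly_Mapping.keys ?h. ?c a * exp (\<i> * of_real (\<theta> \<bullet> rvec a))))"
    by (simp add: torus_eval_def char_eval_def exp_add mult.assoc exp_of_real)
  also have "\<dots> = (\<Sum>a\<in>Poly_Mapping.keys ?h. (LINT \<theta>:period_box \<beta>|lborel. ?c a * exp (\<i> * of_real (\<theta> \<bullet> rvec a))))"
    unfolding set_lebesgue_integral_def scaleR_sum_right
  proof (rule Bochner_Integration.integral_sum)
    fix a
    show "integrable lborel (\<lambda>\<theta>. indicat_real (period_box \<beta>) \<theta> *\<^sub>R (?c a * exp (\<i> * of_real (\<theta> \<bullet> rvec a))))"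
      by (rule set_integrable_period_box[unfolded set_integrable_def]) (intro continuous_intros)
  qed
  also have "\<dots> = (\<Sum>a\<in>Poly_Mapping.keys ?h. ?c a * (if a = 0 then (2 * pi) ^ CARD('m) else 0))"
    by (simp add: integral_character_period_box)
  also have "\<dots> = (\<Sum>a\<in>Poly_Mapping.keys ?h. if a = 0 then of_real ((2 * pi) ^ CARD('m) * Cst ?h) else 0)"
    by (intro sum.cong) (auto simp: Cst_def mult_ac)
  also have "\<dots> = of_real ((2 * pi) ^ CARD('m) * Cst ?h)"
    by (auto simp: Cst_def in_keys_iff)
  finally show ?thesis .
qed

lemma measure_period_box: "measure lborel (period_box \<beta> :: (real ^ 'm::finite) set) = (2 * pi) ^ CARD('m)"
proof -
  have "(LINT \<theta>:(period_box \<beta> :: (real ^ 'm) set)|lborel. (1::complex)) = (2 * pi) ^ CARD('m)"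
    using integral_character_period_box[of \<beta> "0 :: int ^ 'm"] by simp
  moreover have "(LINT \<theta>:(period_box \<beta> :: (real ^ 'm) set)|lborel. (1::complex)) = of_real (measure lborel (period_box \<beta> :: (real ^ 'm) set))"
    by (subst set_integral_const) (auto simp: period_box_def emeasure_lborel_cbox_eq scaleR_conv_of_real)
  ultimately have "complex_of_real (measure lborel (period_box \<beta> :: (real ^ 'm) set)) = of_real ((2 * pi) ^ CARD('m))" by simp
  then show ?thesis by (simp only: of_real_eq_iff)
qed

text \<open>
  Integrate the geometric series; its partial sums are dominated because \<open>norm t * T < 1\<close>.
\<close>
lemma sums_constant_terms:
  fixes f :: "'m::finite laurent"
  assumes bound: "\<And>\<theta>. norm (torus_eval f \<xi> \<theta>) \<le> T" and T: "T > 0" and t: "norm t < inverse T"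
  shows "(\<lambda>n. of_real (Cst (f ^ n)) * t ^ n) sums
    ((LINT \<theta>:period_box \<beta>|lborel. 1 / (1 - t * torus_eval f \<xi> \<theta>)) / (2 * pi) ^ CARD('m))"
proof -
  let ?g = "torus_eval f \<xi>" and ?B = "period_box \<beta> :: (real ^ 'm) set"
  define q where "q = norm t * T"
  have q: "0 \<le> q" "q < 1" using t T by (auto simp: q_def field_simps)
  have tg: "norm (t * ?g \<theta>) \<le> q" for \<theta>
    unfolding q_def norm_mult using bound by (intro mult_left_mono) auto
  have nz: "t * ?g \<theta> \<noteq> 1" for \<theta> using tg[of \<theta>] q by auto
  have Bs: "?B \<in> sets lborel" by (simp add: period_box_def)
  have SI: "set_integrable lborel ?B (\<lambda>\<theta>. (t * ?g \<theta>) ^ k)" for k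
    by (rule set_integrable_period_box) (intro continuous_intros continuous_on_torus_eval)
  have "(\<lambda>n. LINT \<theta>:?B|lborel. (\<Sum>k<n. (t * ?g \<theta>) ^ k)) \<longlonglongrightarrow> (LINT \<theta>:?B|lborel. 1 / (1 - t * ?g \<theta>))"
    unfolding set_lebesgue_integral_def
  proof (rule integral_dominated_convergence[where w = "\<lambda>\<theta>. indicator ?B \<theta> *\<^sub>R (1 / (1 - q))"])
    show "(\<lambda>\<theta>. indicat_real ?B \<theta> *\<^sub>R (1 / (1 - t * ?g \<theta>))) \<in> borel_measurable lborel"
    proof -
      have "set_integrable lborel ?B (\<lambda>\<theta>. 1 / (1 - t * ?g \<theta>))"
        using nz by (intro set_integrable_period_box continuous_intros continuous_on_torus_eval) auto
      from borel_measurable_integrable[OF this[unfolded set_integrable_def]] show ?thesis .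
    qed
    show "(\<lambda>\<theta>. indicat_real ?B \<theta> *\<^sub>R (\<Sum>k<i. (t * ?g \<theta>) ^ k)) \<in> borel_measurable lborel" for i
    proof -
      have "set_integrable lborel ?B (\<lambda>\<theta>. \<Sum>k<i. (t * ?g \<theta>) ^ k)"
        by (intro set_integrable_period_box continuous_intros continuous_on_torus_eval)
      from borel_measurable_integrable[OF this[unfolded set_integrable_def]] show ?thesis .
    qed
    show "integrable lborel (\<lambda>\<theta>. indicat_real ?B \<theta> *\<^sub>R (1 / (1 - q)))"
      by (intro integrable_scaleR_left integrable_real_indicator) (auto simp: period_box_def emeasure_lborel_cbox_eq)
    show "AE \<theta> in lborel. (\<lambda>i. indicat_real ?B \<theta> *\<^sub>R (\<Sum>k<i. (t * ?g \<theta>) ^ k)) \<longlonglongrightarrow> indicat_real ?B \<theta> *\<^sub>R (1 / (1 - t * ?g \<theta>))"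
    proof (intro AE_I2 tendsto_intros)
      fix \<theta>
      have "(\<lambda>k. (t * ?g \<theta>) ^ k) sums (1 / (1 - t * ?g \<theta>))"
        by (rule geometric_sums) (use tg[of \<theta>] q in linarith)
      then show "(\<lambda>i. \<Sum>k<i. (t * ?g \<theta>) ^ k) \<longlonglongrightarrow> 1 / (1 - t * ?g \<theta>)" by (simp add: sums_def)
    qed
    show "AE \<theta> in lborel. norm (indicat_real ?B \<theta> *\<^sub>R (\<Sum>k<i. (t * ?g \<theta>) ^ k)) \<le> indicat_real ?B \<theta> *\<^sub>R (1 / (1 - q))" for i
    proof (intro AE_I2)
      fix \<theta>
      have "norm (\<Sum>k<i. (t * ?g \<theta>) ^ k) \<le> (\<Sum>k<i. norm ((t * ?g \<theta>) ^ k))" by (rule norm_sum)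
      also have "\<dots> \<le> (\<Sum>k<i. q ^ k)" unfolding norm_power by (intro sum_mono power_mono tg) auto
      also have "\<dots> \<le> suminf (\<lambda>k. q ^ k)" using q by (intro sum_le_suminf summable_geometric) auto
      also have "\<dots> = 1 / (1 - q)" using q by (intro suminf_geometric) auto
      finally show "norm (indicat_real ?B \<theta> *\<^sub>R (\<Sum>k<i. (t * ?g \<theta>) ^ k)) \<le> indicat_real ?B \<theta> *\<^sub>R (1 / (1 - q))"
        by (simp add: indicator_def)
    qed
  qed
  moreover have "(LINT \<theta>:?B|lborel. (\<Sum>k<n. (t * ?g \<theta>) ^ k)) = (\<Sum>k<n. of_real (Cst (f ^ k)) * t ^ k) * (2 * pi) ^ CARD('m)" for n
  proof -
    have "(LINT \<theta>:?B|lborel. (\<Sum>k<n. (t * ?g \<theta>) ^ k)) = (\<Sum>k<n. LINT \<theta>:?B|lborel. (t * ?g \<theta>) ^ k)"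
      unfolding set_lebesgue_integral_def scaleR_sum_right
      by (rule Bochner_Integration.integral_sum) (use SI in \<open>auto simp: set_integrable_def\<close>)
    also have "\<dots> = (\<Sum>k<n. t ^ k * of_real ((2 * pi) ^ CARD('m) * Cst (f ^ k)))"
      by (simp add: power_mult_distrib Cst_eq_integral)
    finally show ?thesis by (simp add: sum_distrib_right sum_distrib_left mult_ac)
  qed
  ultimately have "(\<lambda>n. (\<Sum>k<n. of_real (Cst (f ^ k)) * t ^ k) * (2 * pi) ^ CARD('m)) \<longlonglongrightarrow> (LINT \<theta>:?B|lborel. 1 / (1 - t * ?g \<theta>))"
    by simp
  from tendsto_divide[OF this tendsto_const[of "complex_of_real ((2 * pi) ^ CARD('m))"]]
  show ?thesis by (simp add: sums_def)
qed

lemma eval_constant_term_series: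
  fixes f :: "'m::finite laurent"
  assumes "\<And>\<theta>. norm (torus_eval f \<xi> \<theta>) \<le> T" "T > 0" "norm t < inverse T"
  shows "eval_fps (constant_term_series f) t =
    (LINT \<theta>:period_box \<beta>|lborel. 1 / (1 - t * torus_eval f \<xi> \<theta>)) / (2 * pi) ^ CARD('m)"
  using sums_unique[OF sums_constant_terms[OF assms]] by (simp add: eval_fps_def constant_term_series_def)

lemma conv_radius_constant_term_series_ge:
  fixes f :: "'m::finite laurent"
  assumes "\<And>\<theta>. norm (torus_eval f \<xi> \<theta>) \<le> T" "T > 0"
  shows "fps_conv_radius (constant_term_series f) \<ge> ereal (inverse T)"
  unfolding fps_conv_radius_def
proof (rule conv_radius_geI_ex)
  fix r :: real assume r: "0 < r" "ereal r < ereal (inverse T)"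
  then have "norm (complex_of_real r) < inverse T" by simp
  from sums_constant_terms[OF assms this]
  have "summable (\<lambda>n. fps_nth (constant_term_series f) n * of_real r ^ n)"
    by (auto simp: constant_term_series_def sums_iff)
  then show "\<exists>z. norm z = r \<and> summable (\<lambda>n. fps_nth (constant_term_series f) n * z ^ n)"
    using r by (intro exI[of _ "of_real r"]) auto
qed

lemma Cst_power_le:
  fixes f :: "'m::finite laurent"
  assumes "\<And>\<theta>. norm (torus_eval f \<xi> \<theta>) \<le> T"
  shows "\<bar>Cst (f ^ n)\<bar> \<le> T ^ n"
proof -
  let ?B = "period_box 0 :: (real ^ 'm) set"
  have "norm (LINT \<theta>:?B|lborel. torus_eval f \<xi> \<theta> ^ n) \<le> (LINT \<theta>:?B|lborel. norm (torus_eval f \<xi> \<theta> ^ n))"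
    by (rule set_integral_norm_bound) (intro set_integrable_period_box continuous_intros continuous_on_torus_eval)
  also have "\<dots> \<le> (LINT \<theta>:?B|lborel. T ^ n)"
  proof (rule set_integral_mono)
    show "set_integrable lborel ?B (\<lambda>\<theta>. norm (torus_eval f \<xi> \<theta> ^ n))"
      unfolding set_integrable_def
      by (rule borel_integrable_compact) (auto simp: period_box_def compact_cbox intro!: continuous_intros continuous_on_torus_eval)
    show "set_integrable lborel ?B (\<lambda>\<theta>. T ^ n)"
      unfolding set_integrable_def
      by (rule borel_integrable_compact) (auto simp: period_box_def compact_cbox)
    show "norm (torus_eval f \<xi> \<theta> ^ n) \<le> T ^ n" for \<theta>
      unfolding norm_power by (intro power_mono assms) auto
  qed
  also have "\<dots> = (2 * pi) ^ CARD('m) * T ^ n"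
    by (subst set_integral_const) (auto simp: measure_period_box, auto simp: period_box_def emeasure_lborel_cbox_eq)
  finally have "(2 * pi) ^ CARD('m) * \<bar>Cst (f ^ n)\<bar> \<le> (2 * pi) ^ CARD('m) * T ^ n"
    by (simp add: Cst_eq_integral norm_mult norm_power)
  then show ?thesis by simp
qed

section \<open>The conifold point\<close>

locale convenient_laurent =
  fixes f :: "'m::finite laurent"
  assumes nonneg: "\<And>a. Poly_Mapping.lookup f a \<ge> 0" and conv: "convenient f"
begin

abbreviation "K \<equiv> Poly_Mapping.keys f"

lemma coeff_pos: "a \<in> K \<Longrightarrow> Poly_Mapping.lookup f a > 0"
  using nonneg[of a] by (simp add: in_keys_iff order_less_le)

text \<open>
  The Newton polytope contains a ball of radius \<open>c\<close> around 0, and a linear function on the polytope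
  is at most its largest value at an exponent.
\<close>
lemma support_function_lower:
  obtains c where "c > 0" "\<And>\<xi>. \<exists>a\<in>K. c * norm \<xi> \<le> \<xi> \<bullet> rvec a"
proof -
  let ?P = "convex hull (rvec ` K)"
  have "0 \<in> interior ?P"
    using conv unfolding convenient_def newton_polytope_def rvec_def .
  then obtain c where c: "c > 0" "cball 0 c \<subseteq> ?P"
    by (metis interior_subset mem_interior_cball)
  have "\<exists>a\<in>K. c * norm \<xi> \<le> \<xi> \<bullet> rvec a" for \<xi>
  proof (rule ccontr)
    assume "\<not> (\<exists>a\<in>K. c * norm \<xi> \<le> \<xi> \<bullet> rvec a)"
    then have "rvec ` K \<subseteq> {x. \<xi> \<bullet> x < c * norm \<xi>}" by (auto simp: not_le)
    then have "?P \<subseteq> {x. \<xi> \<bullet> x < c * norm \<xi>}" by (rule hull_minimal) (rule convex_halfspace_lt)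
    moreover have "c *\<^sub>R sgn \<xi> \<in> cball 0 c" using c(1) by (simp add: norm_sgn)
    ultimately have "\<xi> \<bullet> (c *\<^sub>R sgn \<xi>) < c * norm \<xi>" using c(2) by blast
    moreover have "\<xi> \<bullet> sgn \<xi> = norm \<xi>"
      by (cases "\<xi> = 0") (simp_all add: sgn_div_norm power2_norm_eq_inner[symmetric] power2_eq_square)
    ultimately show False by simp
  qed
  then show ?thesis using that c(1) by blast
qed

definition \<phi> :: "real ^ 'm \<Rightarrow> real" where
  "\<phi> \<xi> = (\<Sum>a\<in>K. Poly_Mapping.lookup f a * exp (\<xi> \<bullet> rvec a))"

text \<open>
  In logarithmic coordinates \<open>f\<close> grows exponentially in \<open>norm \<xi>\<close>, so the minimum over a large ball is global.
\<close>
lemma ex_minimum: "\<exists>\<xi>. \<forall>\<xi>'. \<phi> \<xi> \<le> \<phi> \<xi>'"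
proof -
  obtain c where c: "c > 0" "\<And>\<xi>. \<exists>a\<in>K. c * norm \<xi> \<le> \<xi> \<bullet> rvec a" using support_function_lower by blast
  have Kne: "K \<noteq> {}" using c(2)[of 0] by auto
  define m where "m = Min (Poly_Mapping.lookup f ` K)"
  have m: "m > 0" "\<And>a. a \<in> K \<Longrightarrow> m \<le> Poly_Mapping.lookup f a"
    using Kne coeff_pos by (auto simp: m_def)
  have low: "m * exp (c * norm \<xi>) \<le> \<phi> \<xi>" for \<xi>
  proof -
    obtain a where a: "a \<in> K" "c * norm \<xi> \<le> \<xi> \<bullet> rvec a" using c(2) by blast
    have "m * exp (c * norm \<xi>) \<le> Poly_Mapping.lookup f a * exp (\<xi> \<bullet> rvec a)"
      using m a nonneg[of a] by (intro mult_mono) auto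
    also have "\<dots> \<le> \<phi> \<xi>" unfolding \<phi>_def
      by (rule member_le_sum[OF a(1)]) (use nonneg in auto)
    finally show ?thesis .
  qed
  \<comment> \<open>outside this radius \<open>m * exp (c * norm \<xi>)\<close> exceeds \<open>\<phi> 0\<close>, by \<open>1 + x \<le> exp x\<close>\<close>
  define B where "B = \<phi> 0 / (m * c)"
  have \<phi>0: "\<phi> 0 > 0" using low[of 0] m by simp
  have B0: "B \<ge> 0" using \<phi>0 m c by (simp add: B_def)
  have "continuous_on (cball 0 B) \<phi>" unfolding \<phi>_def by (intro continuous_intros)
  then obtain \<xi> where \<xi>: "\<xi> \<in> cball 0 B" "\<And>\<xi>'. \<xi>' \<in> cball 0 B \<Longrightarrow> \<phi> \<xi> \<le> \<phi> \<xi>'"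
    using continuous_attains_inf[of "cball 0 B" \<phi>] B0 by auto
  have "\<phi> \<xi> \<le> \<phi> \<xi>'" for \<xi>'
  proof (cases "\<xi>' \<in> cball 0 B")
    case False
    then have "c * norm \<xi>' > c * B" using c by simp
    then have "c * norm \<xi>' > \<phi> 0 / m" using c by (simp add: B_def)
    then have "exp (c * norm \<xi>') \<ge> \<phi> 0 / m" using exp_ge_add_one_self[of "c * norm \<xi>'"] by linarith
    then have "m * exp (c * norm \<xi>') \<ge> \<phi> 0" using m by (simp add: field_simps)
    moreover have "\<phi> \<xi> \<le> \<phi> 0" using \<xi>(2)[of 0] B0 by simp
    ultimately show ?thesis using low[of \<xi>'] by simp
  qed (rule \<xi>(2))
  then show ?thesis by blast
qed

text \<open>
  The conifold point in logarithmic coordinates; \<open>c\<close> collects the coefficients of \<open>f\<close> rescaled to it.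
\<close>
definition \<xi>0 :: "real ^ 'm" where "\<xi>0 = (SOME \<xi>. \<forall>\<xi>'. \<phi> \<xi> \<le> \<phi> \<xi>')"
definition T :: real where "T = \<phi> \<xi>0"
definition c :: "int ^ 'm \<Rightarrow> real" where "c a = Poly_Mapping.lookup f a * exp (\<xi>0 \<bullet> rvec a)"

lemma \<xi>0_min: "\<phi> \<xi>0 \<le> \<phi> \<xi>"
  using someI_ex[OF ex_minimum] by (simp add: \<xi>0_def)

lemma c_pos: "a \<in> K \<Longrightarrow> c a > 0"
  using coeff_pos by (simp add: c_def)

lemma sum_c: "(\<Sum>a\<in>K. c a) = T"
  by (simp add: T_def \<phi>_def c_def)

lemma T_pos: "T > 0"
proof -
  obtain C where C: "C > 0" "\<And>\<xi>. \<exists>a\<in>K. C * norm \<xi> \<le> \<xi> \<bullet> rvec a" using support_function_lower by blast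
  have "K \<noteq> {}" using C(2)[of 0] by auto
  then show ?thesis unfolding sum_c[symmetric] by (intro sum_pos c_pos) auto
qed

lemma gradient_zero: "(\<Sum>a\<in>K. c a * (v \<bullet> rvec a)) = 0"
proof -
  define h where "h s = \<phi> (\<xi>0 + s *\<^sub>R v)" for s
  have "(h has_real_derivative (\<Sum>a\<in>K. c a * (v \<bullet> rvec a))) (at 0)"
    unfolding h_def \<phi>_def c_def
    by (auto intro!: derivative_eq_intros sum.cong simp: inner_add_left)
  moreover have "\<forall>s. \<bar>0 - s\<bar> < 1 \<longrightarrow> h 0 \<le> h s" using \<xi>0_min by (simp add: h_def)
  ultimately show ?thesis by (intro DERIV_local_min[of h _ 0 1]) auto
qed

lemma spread: "v \<noteq> 0 \<Longrightarrow> \<exists>a\<in>K. v \<bullet> rvec a \<noteq> 0"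
proof -
  assume v: "v \<noteq> 0"
  obtain C where C: "C > 0" "\<And>\<xi>. \<exists>a\<in>K. C * norm \<xi> \<le> \<xi> \<bullet> rvec a" using support_function_lower by blast
  then obtain a where "a \<in> K" "C * norm v \<le> v \<bullet> rvec a" by blast
  moreover have "C * norm v > 0" using C v by simp
  ultimately show ?thesis by force
qed

lemma laurent_eval_exp: "laurent_eval f (\<chi> i. exp (\<xi> $ i)) = \<phi> \<xi>"
proof -
  have "(\<Prod>i\<in>UNIV. exp (\<xi> $ i) powi (a $ i)) = exp (\<xi> \<bullet> rvec a)" for a
  proof -
    have "exp x powi k = exp (x * of_int k)" for x :: real and k :: int
      by (simp add: exp_power_int mult.commute)
    then show ?thesis by (simp add: inner_vec_def rvec_def exp_sum)
  qed
  then show ?thesis by (simp add: laurent_eval_def \<phi>_def)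
qed

lemma conifold_value_eq: "conifold_value f = T"
proof -
  have "laurent_eval f x = \<phi> (\<chi> i. ln (x $ i))" if "\<forall>i. x $ i > 0" for x :: "real ^ 'm"
  proof -
    have "x = (\<chi> i. exp ((\<chi> i. ln (x $ i)) $ i))" using that by (simp add: vec_eq_iff)
    then show ?thesis using laurent_eval_exp[of "\<chi> i. ln (x $ i)"] by simp
  qed
  then have "T \<le> y" if "y \<in> laurent_eval f ` {x. \<forall>i. (x :: real ^ 'm) $ i > 0}" for y
    using that \<xi>0_min by (auto simp: T_def)
  moreover have "T \<in> laurent_eval f ` {x. \<forall>i. (x :: real ^ 'm) $ i > 0}"
    unfolding T_def laurent_eval_exp[symmetric] by (intro imageI) simp
  ultimately show ?thesis unfolding conifold_value_def by (intro Least_equality) auto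
qed

definition g :: "real ^ 'm \<Rightarrow> complex" where "g \<theta> = torus_eval f \<xi>0 \<theta>"

lemma g_eq: "g \<theta> = (\<Sum>a\<in>K. of_real (c a) * exp (\<i> * of_real (\<theta> \<bullet> rvec a)))"
  by (simp add: g_def torus_eval_def char_eval_def c_def exp_add mult.assoc exp_of_real)

lemma cont_g: "continuous_on S g"
  unfolding g_def by (rule continuous_on_torus_eval)

lemma norm_g_le: "norm (g \<theta>) \<le> T"
proof -
  have "norm (g \<theta>) \<le> (\<Sum>a\<in>K. norm (of_real (c a) * exp (\<i> * of_real (\<theta> \<bullet> rvec a))))"
    unfolding g_eq by (rule norm_sum)
  also have "\<dots> = (\<Sum>a\<in>K. c a)" using c_pos by (intro sum.cong) (auto simp: norm_mult less_imp_le)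
  finally show ?thesis by (simp add: sum_c)
qed

definition Z :: "(real ^ 'm) set" where "Z = {\<theta>. g \<theta> = T}"

text \<open>
  Equality in the triangle inequality: the real parts of the terms of \<open>g \<theta>\<close> add up to the sum of their
  absolute values only if every phase is 1.
\<close>
lemma Z_iff: "\<theta> \<in> Z \<longleftrightarrow> (\<forall>a\<in>K. exp (\<i> * of_real (\<theta> \<bullet> rvec a)) = 1)"
proof
  assume "\<theta> \<in> Z"
  then have "Re (g \<theta>) = T" by (simp add: Z_def)
  then have "(\<Sum>a\<in>K. c a * (1 - cos (\<theta> \<bullet> rvec a))) = 0"
    by (simp add: g_eq sum_c right_diff_distrib sum_subtractf Re_exp)
  moreover have nn: "c a * (1 - cos (\<theta> \<bullet> rvec a)) \<ge> 0" if "a \<in> K" for a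
    using c_pos[OF that] by simp
  ultimately have z: "\<forall>a\<in>K. c a * (1 - cos (\<theta> \<bullet> rvec a)) = 0"
    by (subst (asm) sum_nonneg_eq_0_iff) auto
  show "\<forall>a\<in>K. exp (\<i> * of_real (\<theta> \<bullet> rvec a)) = 1"
  proof
    fix a assume a: "a \<in> K"
    then have "cos (\<theta> \<bullet> rvec a) = 1" using z c_pos[OF a] by auto
    moreover from this have "sin (\<theta> \<bullet> rvec a) = 0" by (rule cos_one_sin_zero)
    ultimately show "exp (\<i> * of_real (\<theta> \<bullet> rvec a)) = 1"
      by (intro complex_eqI) (simp_all add: Re_exp Im_exp)
  qed
next
  assume "\<forall>a\<in>K. exp (\<i> * of_real (\<theta> \<bullet> rvec a)) = 1"
  then have "g \<theta> = (\<Sum>a\<in>K. of_real (c a))" by (simp add: g_eq)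
  then show "\<theta> \<in> Z" by (simp add: Z_def flip: sum_c)
qed

lemma g_translate: "z \<in> Z \<Longrightarrow> g (z + \<theta>) = g \<theta>"
  unfolding g_eq Z_iff
  by (intro sum.cong) (simp_all add: inner_add_left distrib_left exp_add)

lemma Z_diff: "z \<in> Z \<Longrightarrow> z' \<in> Z \<Longrightarrow> z - z' \<in> Z"
  by (simp add: Z_iff inner_diff_left right_diff_distrib exp_diff)

lemma lattice_in_Z: "(\<And>i. \<exists>k::int. z $ i = 2 * pi * k) \<Longrightarrow> z \<in> Z"
  unfolding Z_iff
proof
  fix a assume "\<And>i. \<exists>k::int. z $ i = 2 * pi * k"
  then obtain k :: "'m \<Rightarrow> int" where k: "\<And>i. z $ i = 2 * pi * k i" by metis
  have "z \<bullet> rvec a = 2 * pi * of_int (\<Sum>i\<in>UNIV. k i * a $ i)"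
    by (simp add: inner_vec_def rvec_def k sum_distrib_left mult_ac)
  then have "\<i> * of_real (z \<bullet> rvec a) = (2 * of_int (\<Sum>i\<in>UNIV. k i * a $ i) * pi) * \<i>"
    by simp
  then show "exp (\<i> * of_real (z \<bullet> rvec a)) = 1"
    by (simp only:) (metis exp_integer_2pi Ints_of_int of_int_mult of_real_of_int_eq of_real_mult of_int_numeral)
qed

end

section \<open>Radial expansion at the conifold point\<close>

text \<open>
  The entire function \<open>(1 + \<i> * z - exp (\<i> * z)) / z\<^sup>2\<close>, as an integral in which \<open>z = 0\<close> is not exceptional.
\<close>
definition phase_remainder :: "complex \<Rightarrow> complex" where
  "phase_remainder z = integral {0..1} (\<lambda>u. (1 - of_real u) * exp (\<i> * of_real u * z))"

lemma exp_ii_expansion: "exp (\<i> * z) = 1 + \<i> * z - z\<^sup>2 * phase_remainder z"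
proof -
  have "((\<lambda>u. z\<^sup>2 * ((1 - of_real u) * exp (\<i> * of_real u * z))) has_integral
     ((- \<i> * z * (1 - of_real 1) - 1) * exp (\<i> * of_real 1 * z) - (- \<i> * z * (1 - of_real 0) - 1) * exp (\<i> * of_real 0 * z))) {0..1}"
  proof (rule fundamental_theorem_of_calculus)
    fix x :: real
    have "((\<lambda>u. (- \<i> * z * (1 - u) - 1) * exp (\<i> * u * z)) has_field_derivative
        z\<^sup>2 * ((1 - of_real x) * exp (\<i> * of_real x * z))) (at (of_real x))"
      by (auto intro!: derivative_eq_intros simp: algebra_simps power2_eq_square)
    from has_vector_derivative_real_field[OF this]
    show "((\<lambda>u. (- \<i> * z * (1 - of_real u) - 1) * exp (\<i> * of_real u * z)) has_vector_derivative
        z\<^sup>2 * ((1 - of_real x) * exp (\<i> * of_real x * z))) (at x within {0..1})"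
      by (simp add: o_def)
  qed simp
  from integral_unique[OF this] have "z\<^sup>2 * phase_remainder z = 1 + \<i> * z - exp (\<i> * z)"
    by (simp add: phase_remainder_def)
  then show ?thesis by (simp add: algebra_simps)
qed

lemma phase_remainder_0: "phase_remainder 0 = 1 / 2"
proof -
  have "((\<lambda>u. 1 - complex_of_real u) has_integral ((of_real 1 - (of_real 1)\<^sup>2 / 2) - (of_real 0 - (of_real 0)\<^sup>2 / 2))) {0..1}"
  proof (rule fundamental_theorem_of_calculus)
    fix x :: real
    have "((\<lambda>u. u - u\<^sup>2 / 2) has_field_derivative 1 - complex_of_real x) (at (of_real x))"
      by (auto intro!: derivative_eq_intros)
    from has_vector_derivative_real_field[OF this]
    show "((\<lambda>u. of_real u - (of_real u)\<^sup>2 / 2) has_vector_derivative 1 - complex_of_real x) (at x within {0..1})"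
      by (simp add: o_def)
  qed simp
  then show ?thesis unfolding phase_remainder_def by (simp add: integral_unique)
qed

lemma holomorphic_phase_remainder: "phase_remainder holomorphic_on UNIV"
  unfolding phase_remainder_def[abs_def] cbox_interval[symmetric]
proof (rule leibniz_rule_holomorphic)
  show "((\<lambda>z. (1 - of_real u) * exp (\<i> * of_real u * z)) has_field_derivative
      (1 - of_real u) * (exp (\<i> * of_real u * z) * (\<i> * of_real u))) (at z within UNIV)" for z u
    by (auto intro!: derivative_eq_intros)
  show "(\<lambda>u. (1 - complex_of_real u) * exp (\<i> * of_real u * z)) integrable_on cbox 0 1" for z
    by (intro integrable_continuous continuous_intros)
  show "continuous_on (UNIV \<times> cbox 0 1) (\<lambda>(z, u). (1 - of_real u) * (exp (\<i> * of_real u * z) * (\<i> * of_real u)))"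
    unfolding case_prod_unfold by (intro continuous_intros)
qed auto

lemma norm_csqrt_minus_1_le: "norm (csqrt x - 1) \<le> norm (x - 1)"
proof -
  have "(csqrt x - 1) * (csqrt x + 1) = x - 1"
    by (simp add: algebra_simps flip: power2_eq_square)
  then have "norm (csqrt x - 1) * norm (csqrt x + 1) = norm (x - 1)" by (metis norm_mult)
  moreover have "1 \<le> norm (csqrt x + 1)"
    using Re_csqrt[of x] complex_Re_le_cmod[of "csqrt x + 1"] by (simp del: csqrt.simps)
  then have "norm (csqrt x - 1) * 1 \<le> norm (csqrt x - 1) * norm (csqrt x + 1)"
    by (intro mult_left_mono) auto
  ultimately show ?thesis by simp
qed

context convenient_laurent
begin

definition h :: "real ^ 'm \<Rightarrow> complex \<Rightarrow> complex" where
  "h v z = (\<Sum>a\<in>K. of_real (c a * (v \<bullet> rvec a)\<^sup>2) * phase_remainder (z * of_real (v \<bullet> rvec a)))"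

definition Q :: "real ^ 'm \<Rightarrow> real" where
  "Q v = (\<Sum>a\<in>K. c a * (v \<bullet> rvec a)\<^sup>2) / 2"

text \<open>
  The linear terms of the expansions cancel because \<open>\<xi>0\<close> is a critical point.
\<close>
lemma g_radial: "g (\<rho> *\<^sub>R v) = T - (of_real \<rho>)\<^sup>2 * h v (of_real \<rho>)"
proof -
  have "g (\<rho> *\<^sub>R v) = (\<Sum>a\<in>K. of_real (c a) + \<i> * of_real \<rho> * of_real (c a * (v \<bullet> rvec a)) -
     (of_real \<rho>)\<^sup>2 * (of_real (c a * (v \<bullet> rvec a)\<^sup>2) * phase_remainder (of_real \<rho> * of_real (v \<bullet> rvec a))))"
    unfolding g_eq
    by (intro sum.cong refl, subst exp_ii_expansion) (simp add: algebra_simps power_mult_distrib)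
  also have "\<dots> = of_real (\<Sum>a\<in>K. c a) + \<i> * of_real \<rho> * of_real (\<Sum>a\<in>K. c a * (v \<bullet> rvec a)) - (of_real \<rho>)\<^sup>2 * h v (of_real \<rho>)"
    by (simp add: h_def sum.distrib sum_subtractf sum_distrib_left)
  finally show ?thesis by (simp add: sum_c gradient_zero)
qed

lemma Q_pos: assumes "v \<noteq> 0" shows "Q v > 0"
proof -
  obtain a where a: "a \<in> K" "v \<bullet> rvec a \<noteq> 0" using spread[OF assms] by blast
  have "0 < (\<Sum>a\<in>K. c a * (v \<bullet> rvec a)\<^sup>2)"
    by (rule sum_pos2[OF _ a(1)]) (use a c_pos in \<open>auto intro!: mult_nonneg_nonneg simp: less_imp_le\<close>)
  then show ?thesis by (simp add: Q_def)
qed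

lemma h_0: "h v 0 = Q v"
  by (simp add: h_def Q_def phase_remainder_0 sum_divide_distrib)

lemma h_hol: "h v holomorphic_on S"
  unfolding h_def[abs_def]
  by (intro holomorphic_intros holomorphic_on_compose_gen[OF _ holomorphic_phase_remainder, unfolded o_def]) auto

lemma cont_h: "continuous_on A p \<Longrightarrow> continuous_on A q \<Longrightarrow> continuous_on A (\<lambda>x. h (p x) (q x))"
  unfolding h_def
  by (intro continuous_intros continuous_on_compose2[OF holomorphic_on_imp_continuous_on[OF holomorphic_phase_remainder]]) auto

lemma cont_Q: "continuous_on A Q"
  unfolding Q_def by (intro continuous_intros) auto

text \<open>
  One radius works for all directions since the slopes \<open>v \<bullet> rvec a\<close> are bounded on unit vectors.
\<close>
lemma h_near_Q: "\<exists>R>0. \<forall>v z. norm v = 1 \<longrightarrow> norm z < 3 * R \<longrightarrow> norm (h v z - Q v) \<le> Q v / 8"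
proof -
  have "isCont phase_remainder 0"
    using holomorphic_on_imp_continuous_on[OF holomorphic_phase_remainder] by (simp add: continuous_on_eq_continuous_at)
  then have "(phase_remainder \<longlongrightarrow> 1 / 2) (nhds 0)"
    unfolding isCont_def tendsto_nhds_iff by (simp add: phase_remainder_0)
  then have "\<forall>\<^sub>F z in nhds 0. dist (phase_remainder z) (1 / 2) < 1 / 16" by (rule tendstoD) simp
  then obtain d where d: "d > 0" "\<And>z. norm z < d \<Longrightarrow> norm (phase_remainder z - 1 / 2) < 1 / 16"
    unfolding eventually_nhds_metric by (auto simp: dist_norm)
  define L where "L = 1 + (\<Sum>a\<in>K. norm (rvec a))"
  have L: "L > 0" unfolding L_def by (intro add_pos_nonneg sum_nonneg) auto
  have La: "norm (rvec a) \<le> L" if "a \<in> K" for a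
    using member_le_sum[OF that, of "\<lambda>a. norm (rvec a)"] by (simp add: L_def)
  define R where "R = d / (3 * L)"
  have "norm (h v z - Q v) \<le> Q v / 8" if v: "norm v = 1" and z: "norm z < 3 * R" for v z
  proof -
    have "h v z - Q v = (\<Sum>a\<in>K. of_real (c a * (v \<bullet> rvec a)\<^sup>2) * (phase_remainder (z * of_real (v \<bullet> rvec a)) - 1 / 2))"
      by (simp add: h_def Q_def right_diff_distrib sum_subtractf sum_divide_distrib)
    also have "norm \<dots> \<le> (\<Sum>a\<in>K. norm (of_real (c a * (v \<bullet> rvec a)\<^sup>2) * (phase_remainder (z * of_real (v \<bullet> rvec a)) - 1 / 2)))"
      by (rule norm_sum)
    also have "\<dots> \<le> (\<Sum>a\<in>K. c a * (v \<bullet> rvec a)\<^sup>2 * (1 / 16))"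
    proof (rule sum_mono)
      fix a assume a: "a \<in> K"
      have "norm (z * of_real (v \<bullet> rvec a)) \<le> norm z * L"
        using Cauchy_Schwarz_ineq2[of v "rvec a"] La[OF a] v
        by (simp add: norm_mult mult_left_mono)
      also have "\<dots> < 3 * R * L" using z L by simp
      also have "\<dots> = d" using L by (simp add: R_def)
      finally have "norm (phase_remainder (z * of_real (v \<bullet> rvec a)) - 1 / 2) < 1 / 16" by (rule d(2))
      then show "norm (of_real (c a * (v \<bullet> rvec a)\<^sup>2) * (phase_remainder (z * of_real (v \<bullet> rvec a)) - 1 / 2)) \<le> c a * (v \<bullet> rvec a)\<^sup>2 * (1 / 16)"
        using c_pos[OF a] unfolding norm_mult norm_of_real by (intro mult_mono) auto
    qed
    also have "\<dots> = Q v / 8" by (simp add: Q_def flip: sum_divide_distrib)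
    finally show ?thesis .
  qed
  then show ?thesis using d(1) L by (intro exI[of _ R]) (auto simp: R_def)
qed

definition R1 :: real where
  "R1 = (SOME R. R > 0 \<and> (\<forall>v z. norm v = 1 \<longrightarrow> norm z < 3 * R \<longrightarrow> norm (h v z - Q v) \<le> Q v / 8))"

lemma R1: "R1 > 0" "norm v = 1 \<Longrightarrow> norm z < 3 * R1 \<Longrightarrow> norm (h v z - Q v) \<le> Q v / 8"
  using someI_ex[OF h_near_Q] unfolding R1_def by auto

lemma Q_unit: "norm v = 1 \<Longrightarrow> Q v > 0"
  by (rule Q_pos) auto

lemma ratio_near: assumes "norm v = 1" "norm z < 3 * R1" shows "norm (h v z / Q v - 1) \<le> 1 / 8"
proof -
  have "norm (h v z / Q v - 1) = norm ((h v z - Q v) / of_real (Q v))"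
    using Q_unit[OF assms(1)] by (simp add: diff_divide_distrib)
  also have "\<dots> = norm (h v z - Q v) / Q v" using Q_unit[OF assms(1)] by (simp add: norm_divide)
  also have "\<dots> \<le> 1 / 8" using R1(2)[OF assms] Q_unit[OF assms(1)] by (simp add: divide_simps)
  finally show ?thesis .
qed

lemma ratio_slit: assumes "norm v = 1" "norm z < 3 * R1" shows "h v z / Q v \<notin> \<real>\<^sub>\<le>\<^sub>0"
proof
  assume "h v z / Q v \<in> \<real>\<^sub>\<le>\<^sub>0"
  then have "Re (h v z / Q v) \<le> 0" by (auto simp: complex_nonpos_Reals_iff)
  then show False using ratio_near[OF assms] abs_Re_le_cmod[of "h v z / Q v - 1"] by simp
qed

text \<open>
  The square root of \<open>h v\<close> near the positive number \<open>sqrt (Q v)\<close>. After division by \<open>Q v\<close> the argument of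
  \<open>csqrt\<close> is close to 1, away from the cut.
\<close>
definition s :: "real ^ 'm \<Rightarrow> complex \<Rightarrow> complex" where
  "s v z = of_real (sqrt (Q v)) * csqrt (h v z / Q v)"

lemma s_squared: "norm v = 1 \<Longrightarrow> (s v z)\<^sup>2 = h v z"
  using Q_unit[of v] by (simp add: s_def power_mult_distrib flip: of_real_power)

lemma radial_chart_s:
  assumes v: "norm v = 1" and R: "0 < R" "R \<le> R1"
  shows "radial_chart (s v) (sqrt (Q v)) R"
proof
  show "sqrt (Q v) > 0" using Q_unit[OF v] by simp
  show "s v holomorphic_on ball 0 (3 * R)"
    unfolding s_def[abs_def] using Q_unit[OF v] ratio_slit[OF v] R
    by (intro holomorphic_intros h_hol) auto
  show "norm (s v z - of_real (sqrt (Q v))) \<le> sqrt (Q v) / 8" if "norm z < 3 * R" for z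
  proof -
    have "s v z - of_real (sqrt (Q v)) = of_real (sqrt (Q v)) * (csqrt (h v z / Q v) - 1)"
      by (simp add: s_def right_diff_distrib)
    then have "norm (s v z - of_real (sqrt (Q v))) = sqrt (Q v) * norm (csqrt (h v z / Q v) - 1)"
      using Q_unit[OF v] by (simp add: norm_mult)
    also have "\<dots> \<le> sqrt (Q v) * (1 / 8)"
      using norm_csqrt_minus_1_le[of "h v z / Q v"] ratio_near[OF v, of z] that R Q_unit[OF v]
      by (intro mult_left_mono) auto
    finally show ?thesis by simp
  qed
  show "s v 0 = of_real (sqrt (Q v))" using Q_unit[OF v] by (simp add: s_def h_0)
qed (rule R(1))

lemma cont_s:
  assumes "R \<le> R1"
  shows "continuous_on (sphere 0 1 \<times> ball 0 (3 * R)) (\<lambda>(v, z). s v z)"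
proof -
  let ?S = "sphere (0 :: real ^ 'm) 1 \<times> ball (0 :: complex) (3 * R)"
  have cQ: "continuous_on ?S (\<lambda>x. Q (fst x))"
    by (rule continuous_on_compose2[OF cont_Q[of UNIV]]) (auto intro: continuous_intros)
  have cr: "continuous_on ?S (\<lambda>x. h (fst x) (snd x) / complex_of_real (Q (fst x)))"
    using Q_unit by (intro continuous_intros cont_h cQ) fastforce+
  have "(\<lambda>x. h (fst x) (snd x) / complex_of_real (Q (fst x))) ` ?S \<subseteq> - \<real>\<^sub>\<le>\<^sub>0"
    using ratio_slit assms by auto
  from continuous_on_compose2[OF continuous_on_csqrt cr this]
  have "continuous_on ?S (\<lambda>x. s (fst x) (snd x))"
    unfolding s_def by (intro continuous_intros cQ)
  then show ?thesis by (simp add: case_prod_unfold)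
qed

lemma Q_lower: obtains b0 where "b0 > 0" "\<And>v. norm v = 1 \<Longrightarrow> b0 \<le> sqrt (Q v)"
proof -
  have "continuous_on (sphere 0 1) (\<lambda>v. sqrt (Q v))" by (intro continuous_intros cont_Q)
  moreover have "sphere (0 :: real ^ 'm) 1 \<noteq> {}" by simp
  ultimately obtain u where "u \<in> sphere 0 1" "\<And>v. v \<in> sphere 0 1 \<Longrightarrow> sqrt (Q u) \<le> sqrt (Q v)"
    using continuous_attains_inf[of "sphere 0 1" "\<lambda>v. sqrt (Q v)"] by auto
  then show ?thesis using that[of "sqrt (Q u)"] Q_unit[of u] by auto
qed

lemma radial_family_s:
  assumes R: "0 < R" "R \<le> R1"
  obtains b0 where "radial_family s (\<lambda>v. sqrt (Q v)) R b0 (sphere 0 1) sphere_measure"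
proof -
  obtain b0 where b0: "b0 > 0" "\<And>v. norm v = 1 \<Longrightarrow> b0 \<le> sqrt (Q v)" using Q_lower by blast
  interpret S: finite_measure "sphere_measure :: (real ^ 'm) measure" by (rule finite_measure_sphere_measure)
  have "radial_family s (\<lambda>v. sqrt (Q v)) R b0 (sphere 0 1) sphere_measure"
  proof (rule radial_family.intro)
    show "emeasure sphere_measure (sphere (0 :: real ^ 'm) 1) < \<infinity>"
      using S.emeasure_finite[of "sphere 0 1"] by (metis infinity_ennreal_def top.not_eq_extremum)
    show "radial_chart (s u) (sqrt (Q u)) R" if "u \<in> sphere 0 1" for u
      using that R by (intro radial_chart_s) auto
  qed (use b0 R cont_s measure_sphere_measure_pos in auto)
  then show ?thesis using that by blast
qed

definition local_part :: "real \<Rightarrow> complex \<Rightarrow> complex" where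
  "local_part \<delta> t = (LINT \<theta>:ball 0 \<delta>|lborel. 1 / (1 - t * g \<theta>))"

lemma resolvent_nz: assumes "norm t < inverse T" shows "1 - t * g \<theta> \<noteq> 0"
proof -
  have "norm (t * g \<theta>) \<le> norm t * T" unfolding norm_mult using norm_g_le by (intro mult_left_mono) auto
  also have "\<dots> < 1" using assms T_pos by (simp add: field_simps)
  finally show ?thesis by auto
qed

text \<open>
  On the ray in direction \<open>u\<close> one has \<open>1 - t * g = t * (1 / t - T + (\<rho> * s u \<rho>)\<^sup>2)\<close>.
\<close>
lemma local_part_polar:
  assumes R: "0 < R" "R \<le> R1" and t: "0 < t" "t < inverse T"
  shows "local_part (R / 4) (of_real t) = of_real (1 / t) *
     (LINT u:sphere 0 1|sphere_measure. integral {0..R/4} (\<lambda>\<rho>. of_real \<rho> ^ (CARD('m) - 1) /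
         (of_real ((sqrt (1 / t - T))\<^sup>2) + (of_real \<rho> * s u \<rho>)\<^sup>2)))"
proof -
  let ?J = "\<lambda>u. integral {0..R/4} (\<lambda>\<rho>. of_real \<rho> ^ (CARD('m) - 1) /
       (of_real ((sqrt (1 / t - T))\<^sup>2) + (of_real \<rho> * s u \<rho>)\<^sup>2))"
  have nt: "norm (complex_of_real t) < inverse T" using t by simp
  have wp: "1 / t - T > 0" using t T_pos by (simp add: field_simps)
  have "local_part (R / 4) (of_real t) =
    (LINT u:sphere 0 1|sphere_measure. integral {0..R/4} (\<lambda>\<rho>. of_real (\<rho> ^ (DIM(real ^ 'm) - 1)) * (1 / (1 - of_real t * g (\<rho> *\<^sub>R u)))))"
    unfolding local_part_def
    by (rule integral_polar_ball) (use R resolvent_nz[OF nt] in \<open>auto intro!: continuous_intros cont_g\<close>)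
  also have "\<dots> = (LINT u:sphere 0 1|sphere_measure. of_real (1 / t) * ?J u)"
  proof (rule set_lebesgue_integral_cong)
    show "\<forall>u. u \<in> sphere 0 1 \<longrightarrow> integral {0..R/4} (\<lambda>\<rho>. of_real (\<rho> ^ (DIM(real ^ 'm) - 1)) * (1 / (1 - of_real t * g (\<rho> *\<^sub>R u)))) =
       of_real (1 / t) * ?J u"
    proof (intro allI impI)
      fix u :: "real ^ 'm" assume "u \<in> sphere 0 1"
      then have u: "norm u = 1" by simp
      have "of_real (\<rho> ^ (DIM(real ^ 'm) - 1)) * (1 / (1 - of_real t * g (\<rho> *\<^sub>R u))) =
         of_real (1 / t) * (of_real \<rho> ^ (CARD('m) - 1) / (of_real ((sqrt (1 / t - T))\<^sup>2) + (of_real \<rho> * s u \<rho>)\<^sup>2))" for \<rho>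
      proof -
        have "1 - of_real t * g (\<rho> *\<^sub>R u) = of_real t * (of_real ((sqrt (1 / t - T))\<^sup>2) + (of_real \<rho> * s u \<rho>)\<^sup>2)"
          using t wp by (simp add: g_radial power_mult_distrib s_squared[OF u] field_simps)
        then show ?thesis using t by simp
      qed
      then show "integral {0..R/4} (\<lambda>\<rho>. of_real (\<rho> ^ (DIM(real ^ 'm) - 1)) * (1 / (1 - of_real t * g (\<rho> *\<^sub>R u)))) =
       of_real (1 / t) * ?J u"
        by (simp only: integral_mult_right)
    qed
  qed (auto simp: borel_closed)
  finally show ?thesis by simp
qed

end

section \<open>The singularity of the constant term series\<close>

lemma integral_ball_translate:
  fixes F :: "'a::euclidean_space \<Rightarrow> complex"
  assumes [measurable]: "F \<in> borel_measurable borel"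
  shows "(LINT \<theta>:ball z \<delta>|lborel. F \<theta>) = (LINT \<theta>:ball 0 \<delta>|lborel. F (z + \<theta>))"
proof -
  have "(LINT \<theta>:ball z \<delta>|lborel. F \<theta>) = (LINT \<theta>|distr lborel borel ((+) z). indicator (ball z \<delta>) \<theta> *\<^sub>R F \<theta>)"
    by (simp add: lborel_distr_plus set_lebesgue_integral_def)
  also have "\<dots> = (LINT \<theta>|lborel. indicator (ball z \<delta>) (z + \<theta>) *\<^sub>R F (z + \<theta>))"
    by (rule integral_distr) (auto intro!: borel_measurable_scaleR borel_measurable_indicator)
  also have "(\<lambda>\<theta>. indicat_real (ball z \<delta>) (z + \<theta>)) = indicator (ball 0 \<delta>)"
    by (auto simp: fun_eq_iff indicator_def dist_norm)
  finally show ?thesis by (simp add: set_lebesgue_integral_def)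
qed

context convenient_laurent
begin

text \<open>
  The shift of \<open>l\<close> by \<open>\<pi> * \<i>\<close> changes the sign of \<open>exp l\<close>, which exchanges the poles \<open>\<plusminus>\<i> * exp l\<close>. In the difference
  of the two values of \<open>\<Lambda>\<close> the terms with \<open>N\<close> cancel, and so do those with \<open>\<kappa> (- (\<i> * exp l))\<close>; the logarithms leave
  \<open>- \<pi> * \<kappa> (\<i> * exp l) / exp l\<close>.
\<close>
lemma local_part_expansion:
  assumes Rb: "0 < R" "R \<le> R1"
  obtains \<sigma> \<Lambda> where "\<Lambda> holomorphic_on {l. Re l < \<sigma>}"
    "\<And>l. Re l < \<sigma> \<Longrightarrow> \<Lambda> (l + pi * \<i>) \<noteq> \<Lambda> l"
    "\<And>t. 0 < t \<Longrightarrow> t < inverse T \<Longrightarrow> ln (1 / t - T) / 2 < \<sigma> \<Longrightarrow>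
       local_part (R / 4) (of_real t) = \<Lambda> (of_real (ln (1 / t - T) / 2))"
proof -
  let ?e = "CARD('m) - 1"
  obtain b0 where fam: "radial_family s (\<lambda>v. sqrt (Q v)) R b0 (sphere 0 1) sphere_measure"
    using radial_family_s[OF Rb] by blast
  interpret radial_family s "\<lambda>v. sqrt (Q v)" R b0 ?e "sphere 0 1" sphere_measure by (rule fam)
  obtain N K where NK: "N holomorphic_on ball 0 r" "K holomorphic_on ball 0 r" "K 0 \<noteq> 0"
    and int: "\<And>\<zeta>::real. 0 < \<zeta> \<Longrightarrow> \<zeta> < r \<Longrightarrow>
       (LINT u:sphere 0 1|sphere_measure. integral {0..R/4} (\<lambda>\<rho>. of_real \<rho> ^ ?e / (of_real (\<zeta>\<^sup>2) + (of_real \<rho> * s u \<rho>)\<^sup>2))) =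
       ((N (\<i> * \<zeta>) - (\<i> * \<zeta>) ^ ?e * K (\<i> * \<zeta>) * Ln (- (\<i> * \<zeta>))) -
        (N (- (\<i> * \<zeta>)) - (- (\<i> * \<zeta>)) ^ ?e * K (- (\<i> * \<zeta>)) * Ln (\<i> * \<zeta>))) / (2 * \<i> * \<zeta>)"
    by (rule averaged_integral) (rule that)
  have rp: "r > 0" using b0(1) R by simp
  have "isCont K 0" using NK(2) rp by (meson centre_in_ball continuous_on_interior holomorphic_on_imp_continuous_on interior_open open_ball continuous_on_eq_continuous_at)
  then have "\<forall>\<^sub>F z in nhds 0. K z \<noteq> 0"
    using NK(3) tendsto_imp_eventually_ne[of K "K 0" "nhds 0" 0] by (simp add: isCont_def tendsto_nhds_iff)
  then obtain r' where r': "r' > 0" "\<And>z. norm z < r' \<Longrightarrow> K z \<noteq> 0"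
    unfolding eventually_nhds_metric by auto
  \<comment> \<open>\<open>r\<close> bounds the domain of \<open>N\<close> and \<open>K\<close>, \<open>r'\<close> keeps \<open>K\<close> and \<open>sqrt T\<close> keeps \<open>T + exp (2 * l)\<close> away from 0\<close>
  define q where "q = min r (min r' (sqrt T))"
  have q: "q > 0" "q \<le> r" "q \<le> r'" "q \<le> sqrt T" using rp r' T_pos by (auto simp: q_def)
  define \<sigma> where "\<sigma> = ln q"
  define \<kappa> where "\<kappa> a = a ^ ?e * K a" for a
  \<comment> \<open>the first factor is \<open>1 / t\<close>; \<open>l \<mp> \<i> * \<pi> / 2\<close> is the logarithm of \<open>\<mp>\<i> * exp l\<close> for real \<open>l\<close>\<close>
  define \<Lambda> where "\<Lambda> l = (of_real T + exp (2 * l)) * ((N (\<i> * exp l) - N (- (\<i> * exp l)) - \<kappa> (\<i> * exp l) * (l - \<i> * pi / 2)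
       + \<kappa> (- (\<i> * exp l)) * (l + \<i> * pi / 2)) / (2 * \<i> * exp l))" for l
  have small: "norm (exp l) < q" if "Re l < \<sigma>" for l
    using that q(1) unfolding \<sigma>_def by (metis exp_less_cancel_iff exp_ln norm_exp_eq_Re)
  have \<kappa>h: "\<kappa> holomorphic_on ball 0 r" unfolding \<kappa>_def by (intro holomorphic_intros NK)
  have comp: "(\<lambda>l. F (\<i> * exp l)) holomorphic_on {l. Re l < \<sigma>}" "(\<lambda>l. F (- (\<i> * exp l))) holomorphic_on {l. Re l < \<sigma>}"
    if "F holomorphic_on ball 0 r" for F
  proof -
    have "(F \<circ> (\<lambda>l. \<i> * exp l)) holomorphic_on {l. Re l < \<sigma>}"
      by (rule holomorphic_on_compose_gen[OF _ that]) (use small q in \<open>force simp: norm_mult intro!: holomorphic_intros\<close>)+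
    moreover have "(F \<circ> (\<lambda>l. - (\<i> * exp l))) holomorphic_on {l. Re l < \<sigma>}"
      by (rule holomorphic_on_compose_gen[OF _ that]) (use small q in \<open>force simp: norm_mult intro!: holomorphic_intros\<close>)+
    ultimately show "(\<lambda>l. F (\<i> * exp l)) holomorphic_on {l. Re l < \<sigma>}" "(\<lambda>l. F (- (\<i> * exp l))) holomorphic_on {l. Re l < \<sigma>}"
      by (simp_all add: o_def)
  qed
  show ?thesis
  proof (rule that)
    show "\<Lambda> holomorphic_on {l. Re l < \<sigma>}"
      unfolding \<Lambda>_def by (intro holomorphic_intros comp NK \<kappa>h) auto
    show "\<Lambda> (l + pi * \<i>) \<noteq> \<Lambda> l" if l: "Re l < \<sigma>" for l
    proof -
      have e1: "exp (l + pi * \<i>) = - exp l" by (simp add: exp_add)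
      have e2: "exp (2 * (l + pi * \<i>)) = exp (2 * l)"
      proof -
        have e: "2 * (l + pi * \<i>) = 2 * l + 2 * of_real pi * \<i>" by (simp add: algebra_simps)
        show ?thesis unfolding e exp_add exp_two_pi_i by simp
      qed
      have "\<Lambda> (l + pi * \<i>) - \<Lambda> l = (of_real T + exp (2 * l)) * (- pi * \<kappa> (\<i> * exp l) / exp l)"
        unfolding \<Lambda>_def e1 e2 by (simp add: divide_simps) (simp add: algebra_simps)
      moreover have "of_real T + exp (2 * l) \<noteq> 0"
      proof
        assume "of_real T + exp (2 * l) = 0"
        then have "norm (exp (2 * l)) = T" using T_pos by (metis add_eq_0_iff abs_of_pos norm_minus_cancel norm_of_real)
        moreover have "norm (exp (2 * l)) = (norm (exp l))\<^sup>2"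
          by (simp add: norm_power exp_double flip: norm_exp_eq_Re)
        moreover have "(norm (exp l))\<^sup>2 < (sqrt T)\<^sup>2"
          using small[OF l] q(4) by (intro power_strict_mono) auto
        ultimately show False using T_pos by simp
      qed
      moreover have "\<kappa> (\<i> * exp l) \<noteq> 0"
        using small[OF l] q(3) r'(2)[of "\<i> * exp l"] by (simp add: \<kappa>_def norm_mult)
      ultimately show ?thesis by auto
    qed
    show "local_part (R / 4) (of_real t) = \<Lambda> (of_real (ln (1 / t - T) / 2))"
      if t: "0 < t" "t < inverse T" "ln (1 / t - T) / 2 < \<sigma>" for t
    proof -
      have wp: "1 / t - T > 0" using t T_pos by (simp add: field_simps)
      define \<zeta> where "\<zeta> = sqrt (1 / t - T)"
      have \<zeta>p: "\<zeta> > 0" using wp by (simp add: \<zeta>_def)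
      have ln\<zeta>: "ln \<zeta> = ln (1 / t - T) / 2" using wp by (simp add: \<zeta>_def ln_sqrt)
      have "ln \<zeta> < ln q" using t(3) by (simp add: ln\<zeta> \<sigma>_def)
      then have \<zeta>q: "\<zeta> < r" using \<zeta>p q by simp
      have ex: "exp (complex_of_real (ln \<zeta>)) = of_real \<zeta>" using \<zeta>p by (simp add: exp_of_real)
      have eh: "exp (\<i> * complex_of_real pi / 2) = \<i>" using cis_conv_exp[of "pi / 2"] by simp
      have Lp: "Ln (\<i> * of_real \<zeta>) = of_real (ln \<zeta>) + \<i> * pi / 2"
        by (rule Ln_unique) (use pi_gt_zero in \<open>simp_all add: exp_add ex eh mult_ac\<close>)
      have Lm: "Ln (- (\<i> * of_real \<zeta>)) = of_real (ln \<zeta>) - \<i> * pi / 2"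
        by (rule Ln_unique) (simp_all add: exp_diff ex eh mult_ac, use pi_gt_zero in linarith)
      have ex2: "of_real T + exp (2 * complex_of_real (ln \<zeta>)) = of_real (1 / t)"
      proof -
        have "exp (2 * complex_of_real (ln \<zeta>)) = of_real (\<zeta>\<^sup>2)" by (simp add: exp_double ex)
        also have "\<zeta>\<^sup>2 = 1 / t - T" using wp by (simp add: \<zeta>_def)
        finally show ?thesis by simp
      qed
      have "local_part (R / 4) (of_real t) = of_real (1 / t) *
        (LINT u:sphere 0 1|sphere_measure. integral {0..R/4} (\<lambda>\<rho>. of_real \<rho> ^ ?e / (of_real (\<zeta>\<^sup>2) + (of_real \<rho> * s u \<rho>)\<^sup>2)))"
        using local_part_polar[OF Rb t(1,2)] by (simp only: \<zeta>_def)
      also have "\<dots> = \<Lambda> (of_real (ln \<zeta>))"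
        unfolding int[OF \<zeta>p \<zeta>q] \<Lambda>_def ex ex2 Lp Lm \<kappa>_def
        by (rule arg_cong[where f = "\<lambda>x. of_real (1 / t) * (x / (2 * \<i> * of_real \<zeta>))"]) (simp add: algebra_simps)
      finally show ?thesis by (simp add: ln\<zeta>)
    qed
  qed
qed

text \<open>
  By the radial expansion \<open>T - g\<close> is \<open>(norm \<theta>)\<^sup>2\<close> times a factor without zeros near the origin.
\<close>
lemma Z_isolated: assumes "\<theta> \<in> Z" "norm \<theta> < 3 * R1" shows "\<theta> = 0"
proof (rule ccontr)
  assume nz: "\<theta> \<noteq> 0"
  define v where "v = sgn \<theta>"
  have v: "norm v = 1" "\<theta> = norm \<theta> *\<^sub>R v" using nz by (simp_all add: v_def norm_sgn sgn_div_norm)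
  have "of_real (norm \<theta>) ^ 2 * h v (of_real (norm \<theta>)) = 0"
    using assms(1) g_radial[of "norm \<theta>" v] v(2) by (simp add: Z_def)
  then have "h v (of_real (norm \<theta>)) = 0" using nz by simp
  then show False using ratio_slit[OF v(1), of "of_real (norm \<theta>)"] assms(2) by simp
qed

lemma Z_separated: assumes "z \<in> Z" "z' \<in> Z" "dist z z' < 3 * R1" shows "z = z'"
  using Z_isolated[OF Z_diff[OF assms(1,2)]] assms(3) by (simp add: dist_norm)

lemma finite_Z_bounded: "bounded S \<Longrightarrow> finite (Z \<inter> S)"
  using uniform_discrete_finite_iff[of "Z \<inter> S"] Z_separated R1(1)
  by (metis bounded_Int uniformI1 Int_iff mult_pos_pos zero_less_numeral)

lemma countable_Z: "countable Z"
proof -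
  have "Z = (\<Union>n::nat. Z \<inter> cball 0 (real n))"
    using real_arch_simple by auto
  moreover have "countable (\<Union>n::nat. Z \<inter> cball 0 (real n))"
    by (rule countable_UN[OF _ countable_finite[OF finite_Z_bounded[OF bounded_cball]]]) simp
  ultimately show ?thesis by simp
qed

lemma generic_shift: obtains \<beta> where "\<And>(z :: real ^ 'm) i. z \<in> Z \<Longrightarrow> z $ i \<noteq> \<beta> \<and> z $ i \<noteq> \<beta> + 2 * pi"
proof -
  define B where "B = (\<Union>i. (\<lambda>z. z $ i) ` Z \<union> (\<lambda>z. z $ i - 2 * pi) ` Z)"
  have "countable B" unfolding B_def using countable_Z by auto
  then obtain \<beta> where "\<beta> \<notin> B" using uncountable_UNIV_real by (metis UNIV_eq_I)
  then have "z $ i \<noteq> \<beta> \<and> z $ i \<noteq> \<beta> + 2 * pi" if "z \<in> Z" for z :: "real ^ 'm" and i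
  proof -
    have "z $ i \<in> B" "z $ i - 2 * pi \<in> B" using that by (auto simp: B_def)
    then show ?thesis using \<open>\<beta> \<notin> B\<close> by auto
  qed
  then show ?thesis using that by blast
qed

text \<open>
  Cut out of a period box the balls of radius \<open>R / 4\<close> around the points of \<open>Z\<close>, none of which lies on the boundary of
  the box. On the compact rest \<open>1 - t * g\<close> is bounded away from 0 for \<open>t\<close> near \<open>1 / T\<close>, and \<open>g\<close> looks
  the same in every ball. The box contains a point of the lattice \<open>2 * \<pi> * \<int>\<close>, hence at least
  one ball, so \<open>C \<noteq> 0\<close>.
\<close>
lemma constant_term_decomposition:
  obtains R A \<eta> C where "0 < R" "R \<le> R1" "\<eta> > 0" "A holomorphic_on ball (of_real (inverse T)) \<eta>" "C \<noteq> 0"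
    "\<And>t. norm t < inverse T \<Longrightarrow> eval_fps (constant_term_series f) t = A t + C * local_part (R / 4) t"
proof -
  obtain \<beta> where \<beta>: "\<And>(z :: real ^ 'm) i. z \<in> Z \<Longrightarrow> z $ i \<noteq> \<beta> \<and> z $ i \<noteq> \<beta> + 2 * pi" using generic_shift by blast
  define box where "box = (period_box \<beta> :: (real ^ 'm) set)"
  have cbox: "compact box" by (simp add: box_def period_box_def)
  define P where "P = Z \<inter> box"
  have finP: "finite P" unfolding P_def by (rule finite_Z_bounded) (rule compact_imp_bounded[OF cbox])
  have P_int: "z \<in> interior box" if "z \<in> P" for z
  proof -
    have "z \<in> Z" "z \<in> box" using that by (auto simp: P_def)
    then have "\<forall>i. \<beta> < (z :: real ^ 'm) $ i \<and> (z :: real ^ 'm) $ i < \<beta> + 2 * pi"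
      using \<beta>[OF \<open>z \<in> Z\<close>] by (auto simp: box_def period_box_def mem_box_cart order_less_le)
    then show ?thesis by (simp add: box_def period_box_def interior_cbox mem_box_cart)
  qed
  have Pne: "P \<noteq> {}"
  proof -
    define z :: "real ^ 'm" where "z = (\<chi> i. 2 * pi * \<lceil>\<beta> / (2 * pi)\<rceil>)"
    define q where "q = \<beta> / (2 * pi)"
    have "q \<le> \<lceil>q\<rceil>" "\<lceil>q\<rceil> \<le> q + 1" by linarith+
    then have "2 * pi * q \<le> 2 * pi * \<lceil>q\<rceil>" "2 * pi * \<lceil>q\<rceil> \<le> 2 * pi * (q + 1)"
      by (intro mult_left_mono; simp)+
    moreover have "2 * pi * q = \<beta>" by (simp add: q_def)
    ultimately have "\<beta> \<le> 2 * pi * \<lceil>q\<rceil>" "2 * pi * \<lceil>q\<rceil> \<le> \<beta> + 2 * pi"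
      by (simp_all add: distrib_left)
    then have "z \<in> box" by (simp add: z_def q_def box_def period_box_def mem_box_cart)
    moreover have "z \<in> Z" by (rule lattice_in_Z) (auto simp: z_def)
    ultimately show ?thesis by (auto simp: P_def)
  qed
  have "\<forall>z\<in>P. \<exists>d>0. ball z d \<subseteq> box"
    using P_int by (meson interior_subset mem_interior order_trans)
  then obtain d where d: "\<And>z. z \<in> P \<Longrightarrow> d z > 0 \<and> ball z (d z) \<subseteq> box" by metis
  define R where "R = min R1 (Min (d ` P))"
  have R: "0 < R" "R \<le> R1" using R1(1) finP Pne d by (auto simp: R_def)
  have Rd: "R \<le> d z" if "z \<in> P" for z using that finP by (auto simp: R_def min.coboundedI2)
  define \<delta> where "\<delta> = R / 4"
  have \<delta>: "\<delta> > 0" "\<delta> < R" using R by (auto simp: \<delta>_def)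
  have ballbox: "ball z \<delta> \<subseteq> box" if "z \<in> P" for z
    using d[OF that] Rd[OF that] \<delta> by (meson less_imp_le order_trans subset_ball)
  have disj: "disjoint_family_on (\<lambda>z. ball z \<delta>) P"
    unfolding disjoint_family_on_def
  proof (intro ballI impI)
    fix z z' assume zz: "z \<in> P" "z' \<in> P" "z \<noteq> z'"
    show "ball z \<delta> \<inter> ball z' \<delta> = {}"
    proof (rule ccontr)
      assume "ball z \<delta> \<inter> ball z' \<delta> \<noteq> {}"
      then obtain x where "dist z x < \<delta>" "dist z' x < \<delta>" by auto
      then have "dist z z' < 2 * \<delta>" using dist_triangle[of z z' x] by (simp add: dist_commute)
      also have "\<dots> < 3 * R1" using R \<delta>_def by simp
      finally show False using Z_separated[of z z'] zz by (auto simp: P_def)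
    qed
  qed
  define U where "U = (\<Union>z\<in>P. ball z \<delta>)"
  have Uop: "open U" by (auto simp: U_def)
  define W where "W = box - U"
  have Wc: "compact W" unfolding W_def using cbox Uop by (rule compact_diff)
  have WZ: "g \<theta> \<noteq> T" if "\<theta> \<in> W" for \<theta>
  proof
    assume "g \<theta> = T"
    then have "\<theta> \<in> P" using that by (simp add: W_def P_def Z_def)
    then have "\<theta> \<in> U" using \<delta> by (force simp: U_def)
    then show False using that by (simp add: W_def)
  qed
  obtain c0 where c0: "c0 > 0" "\<And>\<theta>. \<theta> \<in> W \<Longrightarrow> norm (1 - of_real (inverse T) * g \<theta>) \<ge> 2 * c0"
  proof (cases "W = {}")
    case False
    have "continuous_on W (\<lambda>\<theta>. norm (1 - of_real (inverse T) * g \<theta>))" by (intro continuous_intros cont_g)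
    then obtain \<theta>0 where \<theta>0: "\<theta>0 \<in> W" "\<And>\<theta>. \<theta> \<in> W \<Longrightarrow> norm (1 - of_real (inverse T) * g \<theta>0) \<le> norm (1 - of_real (inverse T) * g \<theta>)"
      using continuous_attains_inf[OF Wc False] by blast
    have "1 - of_real (inverse T) * g \<theta>0 \<noteq> 0" using WZ[OF \<theta>0(1)] T_pos by (auto simp: field_simps)
    then show ?thesis using \<theta>0 by (intro that[of "norm (1 - of_real (inverse T) * g \<theta>0) / 2"]) auto
  qed (use that[of 1] in auto)
  define \<eta> where "\<eta> = c0 / T"
  have \<eta>: "\<eta> > 0" using c0 T_pos by (simp add: \<eta>_def)
  have low: "norm (1 - t * g \<theta>) \<ge> c0" if "\<theta> \<in> W" "t \<in> ball (of_real (inverse T)) \<eta>" for \<theta> t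
  proof -
    have "norm ((of_real (inverse T) - t) * g \<theta>) \<le> \<eta> * T"
      unfolding norm_mult using that(2) norm_g_le \<eta> by (intro mult_mono) (auto simp: dist_norm)
    also have "\<dots> = c0" using T_pos by (simp add: \<eta>_def)
    finally have "norm ((of_real (inverse T) - t) * g \<theta>) \<le> c0" .
    moreover have "1 - of_real (inverse T) * g \<theta> = (1 - t * g \<theta>) - (of_real (inverse T) - t) * g \<theta>"
      by (simp add: algebra_simps)
    then have "norm (1 - of_real (inverse T) * g \<theta>) \<le> norm (1 - t * g \<theta>) + norm ((of_real (inverse T) - t) * g \<theta>)"
      by (simp only: norm_triangle_ineq4)
    ultimately show ?thesis using c0(2)[OF that(1)] by linarith
  qed
  have Wm: "W \<in> sets borel" using Wc by (simp add: borel_compact)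
  define B where "B t = (LINT \<theta>:W|lborel. 1 / (1 - t * g \<theta>))" for t
  have Bh: "B holomorphic_on ball (of_real (inverse T)) \<eta>"
    unfolding B_def
  proof (rule holomorphic_on_set_integral[OF _ Wm])
    show "emeasure lborel W < \<infinity>" using emeasure_bounded_finite[OF compact_imp_bounded[OF Wc]] by simp
    show "norm (1 / (1 - t * g \<theta>)) \<le> 1 / c0" if "\<theta> \<in> W" "t \<in> ball (of_real (inverse T)) \<eta>" for \<theta> t
      using low[OF that] c0(1) by (simp add: norm_divide divide_simps)
    have nz: "1 - t * g \<theta> \<noteq> 0" if "\<theta> \<in> W" "t \<in> ball (of_real (inverse T)) \<eta>" for \<theta> t
      using low[OF that] c0(1) by auto
    show "continuous_on W (\<lambda>\<theta>. 1 / (1 - t * g \<theta>))" if "t \<in> ball (of_real (inverse T)) \<eta>" for t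
      by (intro continuous_intros cont_g) (use nz that in auto)
    show "(\<lambda>t. 1 / (1 - t * g \<theta>)) holomorphic_on ball (of_real (inverse T)) \<eta>" if "\<theta> \<in> W" for \<theta>
      by (intro holomorphic_intros) (use nz that in auto)
  qed auto
  define V where "V = complex_of_real ((2 * pi) ^ CARD('m))"
  have V: "V \<noteq> 0" by (simp add: V_def)
  show ?thesis
  proof (rule that[OF R \<eta>])
    show "(\<lambda>t. B t / V) holomorphic_on ball (of_real (inverse T)) \<eta>"
      using V by (intro holomorphic_intros Bh) auto
    show "of_nat (card P) / V \<noteq> 0" using V finP Pne by auto
    show "eval_fps (constant_term_series f) t = B t / V + of_nat (card P) / V * local_part (R / 4) t"
      if t: "norm t < inverse T" for t
    proof -
      let ?F = "\<lambda>\<theta>. 1 / (1 - t * g \<theta>)"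
      have cF: "continuous_on S ?F" for S
        by (intro continuous_intros cont_g) (use resolvent_nz[OF t] in auto)
      have Fm: "?F \<in> borel_measurable borel" using cF[of UNIV] by (rule borel_measurable_continuous_onI)
      have I: "set_integrable lborel box ?F"
        unfolding set_integrable_def by (rule borel_integrable_compact[OF cbox cF])
      have "eval_fps (constant_term_series f) t = (LINT \<theta>:box|lborel. ?F \<theta>) / V"
        using eval_constant_term_series[of f \<xi>0 T t \<beta>] norm_g_le T_pos t
        by (simp add: box_def V_def g_def)
      also have "(LINT \<theta>:box|lborel. ?F \<theta>) = (LINT \<theta>:W \<union> U|lborel. ?F \<theta>)"
      proof -
        have "U \<subseteq> box" using ballbox by (auto simp: U_def)
        then have "box = W \<union> U" by (auto simp: W_def)
        then show ?thesis by simp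
      qed
      also have "\<dots> = (LINT \<theta>:W|lborel. ?F \<theta>) + (LINT \<theta>:U|lborel. ?F \<theta>)"
      proof (rule set_integral_Un)
        show "set_integrable lborel W ?F" by (rule set_integrable_subset[OF I]) (use Wm in \<open>auto simp: W_def\<close>)
        show "set_integrable lborel U ?F" by (rule set_integrable_subset[OF I]) (use Uop ballbox in \<open>auto simp: U_def\<close>)
      qed (auto simp: W_def)
      also have "(LINT \<theta>:U|lborel. ?F \<theta>) = (\<Sum>z\<in>P. LINT \<theta>:ball z \<delta>|lborel. ?F \<theta>)"
        unfolding U_def
      proof (rule set_integral_finite_Union[OF finP disj])
        show "set_integrable lborel (ball z \<delta>) ?F" if "z \<in> P" for z
          by (rule set_integrable_subset[OF I]) (use ballbox[OF that] in auto)
      qed auto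
      also have "\<dots> = (\<Sum>z\<in>P. local_part \<delta> t)"
      proof (rule sum.cong)
        fix z assume "z \<in> P"
        then have z: "z \<in> Z" by (simp add: P_def)
        show "(LINT \<theta>:ball z \<delta>|lborel. ?F \<theta>) = local_part \<delta> t"
          unfolding integral_ball_translate[OF Fm] local_part_def g_translate[OF z] ..
      qed simp
      finally show ?thesis by (simp add: B_def \<delta>_def add_divide_distrib)
    qed
  qed
qed

lemma log_singularity_constant_term_series:
  obtains \<eta> \<sigma> A \<Lambda> where "log_singularity (constant_term_series f) T \<eta> \<sigma> A \<Lambda>"
proof -
  obtain R A \<eta> C where R: "0 < R" "R \<le> R1" and \<eta>: "\<eta> > 0"
    and A: "A holomorphic_on ball (of_real (inverse T)) \<eta>" and C: "C \<noteq> 0"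
    and dec: "\<And>t. norm t < inverse T \<Longrightarrow> eval_fps (constant_term_series f) t = A t + C * local_part (R / 4) t"
    using constant_term_decomposition by metis
  obtain \<sigma> \<Lambda> where \<Lambda>: "\<Lambda> holomorphic_on {l. Re l < \<sigma>}" "\<And>l. Re l < \<sigma> \<Longrightarrow> \<Lambda> (l + pi * \<i>) \<noteq> \<Lambda> l"
    and loc: "\<And>t. 0 < t \<Longrightarrow> t < inverse T \<Longrightarrow> ln (1 / t - T) / 2 < \<sigma> \<Longrightarrow>
       local_part (R / 4) (of_real t) = \<Lambda> (of_real (ln (1 / t - T) / 2))"
    using local_part_expansion[OF R] by metis
  define \<eta>' where "\<eta>' = min \<eta> (inverse T - 1 / (T + exp (2 * \<sigma>)))"
  have Te: "T + exp (2 * \<sigma>) > 0" using T_pos by (simp add: add_pos_pos)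
  have "1 / (T + exp (2 * \<sigma>)) < inverse T" using T_pos Te by (simp add: field_simps)
  then have \<eta>': "\<eta>' > 0" "\<eta>' \<le> \<eta>" using \<eta> by (auto simp: \<eta>'_def)
  have "log_singularity (constant_term_series f) T \<eta>' \<sigma> A (\<lambda>l. C * \<Lambda> l)"
  proof
    show "A holomorphic_on ball (of_real (inverse T)) \<eta>'" using A \<eta>'(2) by (rule holomorphic_on_subset[OF _ subset_ball])
    show "(\<lambda>l. C * \<Lambda> l) holomorphic_on {l. Re l < \<sigma>}" by (intro holomorphic_intros \<Lambda>)
    show "ereal (inverse T) \<le> fps_conv_radius (constant_term_series f)"
      by (rule conv_radius_constant_term_series_ge[of f \<xi>0]) (use norm_g_le T_pos in \<open>auto simp: g_def\<close>)
    show "C * \<Lambda> (l + pi * \<i>) \<noteq> C * \<Lambda> l" if "Re l < \<sigma>" for l using \<Lambda>(2)[OF that] C by simp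
    show "eval_fps (constant_term_series f) (of_real t) = A (of_real t) + C * \<Lambda> (of_real (ln (1 / t - T) / 2))"
      if t: "inverse T - \<eta>' < t" "t < inverse T" "0 < t" for t
    proof -
      have "1 / (T + exp (2 * \<sigma>)) < t" using t(1) by (simp add: \<eta>'_def)
      then have "1 / t - T < exp (2 * \<sigma>)" using t(3) Te by (simp add: field_simps)
      moreover have wp: "1 / t - T > 0" using t T_pos by (simp add: field_simps)
      ultimately have "ln (1 / t - T) < 2 * \<sigma>" by (metis exp_less_cancel_iff exp_ln)
      then show ?thesis using dec[of "of_real t"] loc[OF t(3,2)] t by simp
    qed
  qed (use T_pos \<eta>' in auto)
  then show ?thesis using that by blast
qed

end

section \<open>Supermultiplicative sequences\<close>

text \<open>
  Let \<open>r\<close> be the least positive difference of two elements of \<open>S\<close>. Division with remainder shows that \<open>r\<close> divides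
  \<open>S\<close>. If \<open>z = r * k\<close> and \<open>z + r\<close> belong to \<open>S\<close>, then sums of copies of these two are all the multiples \<open>r * n\<close>
  with \<open>n \<ge> k * k\<close>.
\<close>
lemma additive_submonoid_nat_eventually_multiples:
  fixes S :: "nat set"
  assumes zero: "0 \<in> S" and add: "\<And>m n. m \<in> S \<Longrightarrow> n \<in> S \<Longrightarrow> m + n \<in> S" and pos: "\<exists>n\<in>S. n > 0"
  obtains r where "r \<ge> 1" "\<And>n. n \<in> S \<Longrightarrow> r dvd n" "\<exists>N. \<forall>n\<ge>N. r * n \<in> S"
proof -
  have mult: "k * n \<in> S" if "n \<in> S" for k n
    by (induction k) (use that zero add in auto)
  define P where "P d \<longleftrightarrow> d > 0 \<and> (\<exists>y\<in>S. y + d \<in> S)" for d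
  define r where "r = (LEAST d. P d)"
  obtain n0 where n0: "n0 \<in> S" "n0 > 0" using pos by blast
  have "P n0" using n0 zero by (auto simp: P_def intro!: bexI[of _ 0])
  then have Pr: "P r" unfolding r_def by (rule LeastI)
  have rmin: "r \<le> d" if "P d" for d unfolding r_def using that by (rule Least_le)
  obtain y where y: "y \<in> S" "y + r \<in> S" and r0: "r > 0" using Pr by (auto simp: P_def)
  have dvd: "r dvd n" if n: "n \<in> S" for n
  proof (rule ccontr)
    assume "\<not> r dvd n"
    then have m: "n mod r > 0" by (simp add: mod_greater_zero_iff_not_dvd)
    define q where "q = n div r"
    have "q * (y + r) \<in> S" by (rule mult[OF y(2)])
    moreover have "q * (y + r) + n mod r = n + q * y"
      unfolding q_def by (simp add: distrib_left)
    then have "q * (y + r) + n mod r \<in> S" using add[OF n mult[OF y(1)]] by simp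
    ultimately have "P (n mod r)" using m by (auto simp: P_def)
    then have "r \<le> n mod r" by (rule rmin)
    then show False using mod_less_divisor[OF r0, of n] by simp
  qed
  \<comment> \<open>adding \<open>n0\<close> excludes the case that the smaller of the two elements is 0\<close>
  define z where "z = y + n0"
  have z: "z \<in> S" "z + r \<in> S" "z > 0"
    using add[OF y(1) n0(1)] add[OF y(2) n0(1)] n0(2) by (auto simp: z_def add_ac)
  obtain k where k: "z = r * k" using dvd[OF z(1)] by blast
  have k0: "k > 0" using z(3) k by auto
  have "r * n \<in> S" if n: "n \<ge> k * k" for n
  proof -
    define q j where "q = n div k" and "j = n mod k"
    have j: "j < k" using k0 by (simp add: j_def)
    have nqj: "n = q * k + j" by (simp add: q_def j_def)
    have "q \<ge> k" using n k0 by (simp add: q_def less_eq_div_iff_mult_less_eq)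
    then have jq: "j \<le> q" using j by simp
    have "(q - j) * z + j * (z + r) \<in> S" by (intro add mult z)
    moreover have "(q - j) * z + j * (z + r) = r * n"
    proof -
      obtain i where i: "q = j + i" using jq le_Suc_ex by blast
      show ?thesis by (simp add: nqj i k algebra_simps)
    qed
    ultimately show ?thesis by simp
  qed
  then show ?thesis using that[of r] r0 dvd by (metis One_nat_def Suc_leI)
qed

lemma LIMSEQ_root_const_mult:
  fixes r :: nat assumes "r \<ge> 1" "c > 0"
  shows "(\<lambda>n. root (r * n) c) \<longlonglongrightarrow> 1"
proof -
  have "strict_mono (\<lambda>n. r * n)" using assms by (auto simp: strict_mono_def)
  from LIMSEQ_subseq_LIMSEQ[OF LIMSEQ_root_const[OF assms(2)] this] show ?thesis by (simp add: o_def)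
qed

locale supermultiplicative =
  fixes c :: "nat \<Rightarrow> real" and T :: real
  assumes c_0: "c 0 = 1" and c_nonneg: "\<And>n. c n \<ge> 0" and c_add: "\<And>m n. c m * c n \<le> c (m + n)"
    and c_le: "\<And>n. c n \<le> T ^ n" and T: "T > 0"
    and radius: "conv_radius (\<lambda>n. complex_of_real (c n)) = ereal (inverse T)"
begin

definition S :: "nat set" where "S = {n. c n > 0}"

lemma add_S: "m \<in> S \<Longrightarrow> n \<in> S \<Longrightarrow> m + n \<in> S"
  using c_add[of m n] by (auto simp: S_def intro: less_le_trans[OF mult_pos_pos])

lemma power_le: "c k ^ q \<le> c (k * q)"
proof (induction q)
  case 0
  then show ?case by (simp add: c_0)
next
  case (Suc q)
  have "c k ^ Suc q \<le> c k * c (k * q)" using Suc c_nonneg by (simp add: mult_left_mono)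
  also have "\<dots> \<le> c (k * Suc q)" using c_add[of k "k * q"] by simp
  finally show ?case .
qed

text \<open>
  Otherwise the radius of convergence would be at least \<open>1 / T'\<close>.
\<close>
lemma ex_large: assumes "0 < T'" "T' < T" shows "\<exists>k>0. c k > T' ^ k"
proof (rule ccontr)
  assume neg: "\<not> (\<exists>k>0. c k > T' ^ k)"
  have le: "c k \<le> T' ^ k" for k
  proof (cases "k = 0")
    case False
    then have "\<not> c k > T' ^ k" using neg by blast
    then show ?thesis by simp
  qed (simp add: c_0)
  have "ereal (inverse T') \<le> conv_radius (\<lambda>n. complex_of_real (c n))"
  proof (rule conv_radius_geI_ex)
    fix r :: real assume r: "0 < r" "ereal r < ereal (inverse T')"
    have q: "T' * r < 1" using r assms by (simp add: field_simps)
    have "summable (\<lambda>n. complex_of_real (c n) * of_real r ^ n)"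
    proof (rule summable_comparison_test')
      show "summable (\<lambda>n. (T' * r) ^ n)" using q r assms by (intro summable_geometric) auto
      show "norm (complex_of_real (c n) * of_real r ^ n) \<le> (T' * r) ^ n" for n
        using le[of n] c_nonneg[of n] r by (simp add: norm_mult norm_power power_mult_distrib mult_right_mono)
    qed
    then show "\<exists>z. norm z = r \<and> summable (\<lambda>n. complex_of_real (c n) * z ^ n)"
      using r by (intro exI[of _ "of_real r"]) auto
  qed
  then have "inverse T' \<le> inverse T" by (simp add: radius)
  then show False using assms T by (simp add: field_simps)
qed

lemma ex_period:
  obtains r where "r \<ge> 1" "\<And>n. \<not> r dvd n \<Longrightarrow> c n = 0" "\<exists>N. \<forall>n\<ge>N. c (r * n) > 0"
proof -
  obtain k where "k > 0" "c k > (T / 2) ^ k" using ex_large[of "T / 2"] T by auto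
  then have "k \<in> S" using T unfolding S_def by (metis mem_Collect_eq less_trans zero_less_power half_gt_zero)
  then have "\<exists>n\<in>S. n > 0" using \<open>k > 0\<close> by blast
  moreover have "0 \<in> S" by (simp add: S_def c_0)
  ultimately obtain r where "r \<ge> 1" "\<And>n. n \<in> S \<Longrightarrow> r dvd n" "\<exists>N. \<forall>n\<ge>N. r * n \<in> S"
    using additive_submonoid_nat_eventually_multiples[of S] add_S by metis
  then show ?thesis using that[of r] c_nonneg by (force simp: S_def order_less_le)
qed

text \<open>
  Two such numbers divide each other: each divides two consecutive large multiples of the other, hence
  their difference.
\<close>
lemma the_period:
  assumes r: "r \<ge> 1" "\<And>n. \<not> r dvd n \<Longrightarrow> c n = 0" "\<exists>N. \<forall>n\<ge>N. c (r * n) > 0"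
  shows "(THE r. r \<ge> 1 \<and> (\<forall>n. \<not> r dvd n \<longrightarrow> c n = 0) \<and> (\<forall>\<^sub>\<infinity>n. c (r * n) > 0)) = r"
proof (rule the_equality)
  show "r \<ge> 1 \<and> (\<forall>n. \<not> r dvd n \<longrightarrow> c n = 0) \<and> (\<forall>\<^sub>\<infinity>n. c (r * n) > 0)"
    using r by (auto simp: MOST_nat_le)
  have gen: "a dvd b" if a: "\<And>n. \<not> a dvd n \<Longrightarrow> c n = 0" and b: "\<exists>N. \<forall>n\<ge>N. c (b * n) > 0" for a b
  proof -
    obtain N where N: "\<And>n. n \<ge> N \<Longrightarrow> c (b * n) > 0" using b by blast
    have "a dvd b * N" "a dvd b * Suc N" using a N[of N] N[of "Suc N"] by force+
    then have "a dvd b * Suc N - b * N" by (rule dvd_diff_nat[rotated])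
    then show ?thesis by simp
  qed
  show "r' = r" if "r' \<ge> 1 \<and> (\<forall>n. \<not> r' dvd n \<longrightarrow> c n = 0) \<and> (\<forall>\<^sub>\<infinity>n. c (r' * n) > 0)" for r'
    using that gen[of r r'] gen[of r' r] r by (intro dvd_antisym) (auto simp: MOST_nat_le)
qed

text \<open>
  Choose \<open>k = r * l\<close> with \<open>c k > T' ^ k\<close>. An argument \<open>r * n\<close> is a sum of copies of \<open>k\<close> and one of the \<open>l\<close> numbers
  \<open>r * (N + j)\<close>, where \<open>c\<close> is positive; \<open>\<mu>\<close> accounts for the latter.
\<close>
lemma lower_bound:
  assumes r: "r \<ge> 1" "\<And>n. \<not> r dvd n \<Longrightarrow> c n = 0" "\<exists>N. \<forall>n\<ge>N. c (r * n) > 0" and T': "0 < T'" "T' < T"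
  shows "\<exists>\<mu>>0. \<exists>N. \<forall>n\<ge>N. c (r * n) \<ge> \<mu> * T' ^ (r * n)"
proof -
  obtain k where k: "k > 0" "c k > T' ^ k" using ex_large[OF T'] by blast
  then have "c k \<noteq> 0" using T' by (metis less_asym zero_less_power)
  then have "r dvd k" using r(2) by blast
  then obtain l where l: "k = r * l" by blast
  have l0: "l > 0" using k l by (cases l) auto
  obtain N where N: "\<And>n. n \<ge> N \<Longrightarrow> c (r * n) > 0" using r(3) by blast
  define \<mu> where "\<mu> = Min ((\<lambda>j. c (r * (N + j)) / T' ^ (r * (N + j))) ` {..<l})"
  have "\<mu> > 0" unfolding \<mu>_def using l0 N T' by (subst Min_gr_iff) auto
  moreover have "c (r * n) \<ge> \<mu> * T' ^ (r * n)" if "n \<ge> N" for n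
  proof -
    define q j where "q = (n - N) div l" and "j = (n - N) mod l"
    have j: "j < l" using l0 by (simp add: j_def)
    have n: "n = N + j + l * q" using that by (simp add: q_def j_def)
    have \<mu>: "\<mu> \<le> c (r * (N + j)) / T' ^ (r * (N + j))"
      unfolding \<mu>_def using j by (intro Min_le) auto
    then have 1: "\<mu> * T' ^ (r * (N + j)) \<le> c (r * (N + j))" using T' by (simp add: field_simps)
    have 2: "(T' ^ k) ^ q \<le> c k ^ q" using k T' by (intro power_mono) auto
    have "\<mu> * T' ^ (r * n) = (\<mu> * T' ^ (r * (N + j))) * (T' ^ k) ^ q"
      by (simp add: n l distrib_left power_add power_mult mult.assoc)
    also have "\<dots> \<le> c (r * (N + j)) * c k ^ q" using 1 2 T' c_nonneg by (intro mult_mono) auto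
    also have "\<dots> \<le> c (r * (N + j)) * c (k * q)" using power_le[of k q] c_nonneg by (intro mult_left_mono) auto
    also have "\<dots> \<le> c (r * (N + j) + k * q)" by (rule c_add)
    also have "r * (N + j) + k * q = r * n" by (simp add: n l algebra_simps)
    finally show ?thesis .
  qed
  ultimately show ?thesis by blast
qed

lemma root_tendsto:
  assumes r: "r \<ge> 1" "\<And>n. \<not> r dvd n \<Longrightarrow> c n = 0" "\<exists>N. \<forall>n\<ge>N. c (r * n) > 0"
  shows "(\<lambda>n. root (r * n) (c (r * n))) \<longlonglongrightarrow> T"
proof (rule order_tendstoI)
  fix a assume a: "a < T"
  define T' where "T' = (max a 0 + T) / 2"
  have T': "0 < T'" "a < T'" "T' < T" using a T by (auto simp: T'_def max_def)
  obtain \<mu> N where \<mu>: "\<mu> > 0" "\<And>n. n \<ge> N \<Longrightarrow> c (r * n) \<ge> \<mu> * T' ^ (r * n)"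
    using lower_bound[OF r T'(1,3)] by blast
  have "(\<lambda>n. root (r * n) \<mu> * T') \<longlonglongrightarrow> 1 * T'"
    by (intro tendsto_intros LIMSEQ_root_const_mult r \<mu>)
  then have "\<forall>\<^sub>F n in sequentially. root (r * n) \<mu> * T' > a"
    using T'(2) by (intro order_tendstoD(1)) auto
  moreover have "\<forall>\<^sub>F n in sequentially. n \<ge> N \<and> n > 0"
    using eventually_ge_at_top[of N] eventually_gt_at_top[of 0] by eventually_elim simp
  ultimately show "\<forall>\<^sub>F n in sequentially. a < root (r * n) (c (r * n))"
  proof eventually_elim
    case (elim n)
    then have p: "r * n > 0" using r(1) by simp
    have "root (r * n) \<mu> * T' = root (r * n) (\<mu> * T' ^ (r * n))"
      using p T' by (simp add: real_root_mult real_root_power_cancel)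
    also have "\<dots> \<le> root (r * n) (c (r * n))" using p \<mu>(2)[of n] elim by (intro real_root_le_mono) auto
    finally show ?case using elim by simp
  qed
next
  fix a assume a: "T < a"
  show "\<forall>\<^sub>F n in sequentially. root (r * n) (c (r * n)) < a"
    using eventually_gt_at_top[of 0]
  proof eventually_elim
    case (elim n)
    then have p: "r * n > 0" using r(1) by simp
    have "root (r * n) (c (r * n)) \<le> root (r * n) (T ^ (r * n))"
      using p c_le by (intro real_root_le_mono) auto
    also have "\<dots> = T" using p T by (intro real_root_power_cancel) auto
    finally show ?case using a by simp
  qed
qed

end

section \<open>Positivity of constant terms and the main result\<close>

lemma lookup_mult_eq_sum:
  fixes f g :: "'k::comm_monoid_add \<Rightarrow>\<^sub>0 real"
  shows "Poly_Mapping.lookup (f * g) k = (\<Sum>a\<in>Poly_Mapping.keys f. \<Sum>b\<in>Poly_Mapping.keys g.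
      (if a + b = k then Poly_Mapping.lookup f a * Poly_Mapping.lookup g b else 0))"
  by (subst poly_mapping_mult_eq_sum) (simp add: lookup_sum lookup_single when_def)

lemma lookup_mult_nonneg:
  fixes f g :: "'k::comm_monoid_add \<Rightarrow>\<^sub>0 real"
  assumes "\<And>a. Poly_Mapping.lookup f a \<ge> 0" "\<And>a. Poly_Mapping.lookup g a \<ge> 0"
  shows "Poly_Mapping.lookup (f * g) k \<ge> 0"
  unfolding lookup_mult_eq_sum using assms by (auto intro!: sum_nonneg)

lemma lookup_power_nonneg:
  fixes f :: "'k::comm_monoid_add \<Rightarrow>\<^sub>0 real"
  assumes "\<And>a. Poly_Mapping.lookup f a \<ge> 0"
  shows "Poly_Mapping.lookup (f ^ n) k \<ge> 0"
proof (induction n arbitrary: k)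
  case 0
  show ?case by (simp add: lookup_one when_def)
next
  case (Suc n)
  then show ?case using lookup_mult_nonneg[OF assms Suc.IH] by simp
qed

text \<open>
  The left-hand side is one of the nonnegative terms of the convolution.
\<close>
lemma lookup_mult_0_ge:
  fixes f g :: "'k::comm_monoid_add \<Rightarrow>\<^sub>0 real"
  assumes f: "\<And>a. Poly_Mapping.lookup f a \<ge> 0" and g: "\<And>a. Poly_Mapping.lookup g a \<ge> 0"
  shows "Poly_Mapping.lookup f 0 * Poly_Mapping.lookup g 0 \<le> Poly_Mapping.lookup (f * g) 0"
proof (cases "0 \<in> Poly_Mapping.keys f \<and> 0 \<in> Poly_Mapping.keys g")
  case True
  let ?t = "\<lambda>a b. if a + b = 0 then Poly_Mapping.lookup f a * Poly_Mapping.lookup g b else 0"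
  have "Poly_Mapping.lookup f 0 * Poly_Mapping.lookup g 0 = ?t 0 0" by simp
  also have "\<dots> \<le> (\<Sum>b\<in>Poly_Mapping.keys g. ?t 0 b)"
    using True f g by (intro member_le_sum[of 0]) auto
  also have "\<dots> \<le> (\<Sum>a\<in>Poly_Mapping.keys f. \<Sum>b\<in>Poly_Mapping.keys g. ?t a b)"
    using True f g by (intro member_le_sum[of 0 _ "\<lambda>a. \<Sum>b\<in>Poly_Mapping.keys g. ?t a b"]) (auto intro!: sum_nonneg)
  finally show ?thesis by (simp add: lookup_mult_eq_sum)
next
  case False
  then have "Poly_Mapping.lookup f 0 * Poly_Mapping.lookup g 0 = 0" by (auto simp: in_keys_iff)
  then show ?thesis using lookup_mult_nonneg[OF f g, of 0] by linarith
qed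

theorem theorem5p9:
  fixes f :: "'m::finite laurent"
  assumes nonneg: "\<And>a. Poly_Mapping.lookup f a \<ge> 0"
    and conv: "convenient f"
  shows "(\<lambda>n. root (period f * n) (Cst (f ^ (period f * n)))) \<longlonglongrightarrow> conifold_value f
    \<and> fps_conv_radius (constant_term_series f) = ereal (inverse (conifold_value f))
    \<and> (\<exists>\<epsilon>>0.
         let p = complex_of_real (inverse (conifold_value f));
             D = eball 0 (fps_conv_radius (constant_term_series f));
             G = eval_fps (constant_term_series f)
         in extends_multivalued G D (ball p \<epsilon> - {p}) \<and> nontrivial_monodromy G D p \<epsilon>)"
proof -
  interpret convenient_laurent f using nonneg conv by unfold_locales
  obtain \<eta> \<sigma> A \<Lambda> where "log_singularity (constant_term_series f) T \<eta> \<sigma> A \<Lambda>"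
    by (rule log_singularity_constant_term_series)
  then interpret L: log_singularity "constant_term_series f" T \<eta> \<sigma> A \<Lambda> .
  interpret C: supermultiplicative "\<lambda>n. Cst (f ^ n)" T
  proof
    show "Cst (f ^ 0) = 1" by (simp add: Cst_def lookup_one)
    show "0 \<le> Cst (f ^ n)" for n unfolding Cst_def by (rule lookup_power_nonneg[OF nonneg])
    show "Cst (f ^ m) * Cst (f ^ n) \<le> Cst (f ^ (m + n))" for m n
      unfolding Cst_def power_add by (intro lookup_mult_0_ge lookup_power_nonneg nonneg)
    show "Cst (f ^ n) \<le> T ^ n" for n
      using Cst_power_le[of f \<xi>0 T n] norm_g_le by (simp add: g_def)
    show "conv_radius (\<lambda>n. complex_of_real (Cst (f ^ n))) = ereal (inverse T)"
      using L.radius_eq by (simp add: fps_conv_radius_def constant_term_series_def)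
  qed (rule T_pos)
  obtain r where r: "r \<ge> 1" "\<And>n. \<not> r dvd n \<Longrightarrow> Cst (f ^ n) = 0" "\<exists>N. \<forall>n\<ge>N. Cst (f ^ (r * n)) > 0"
    using C.ex_period by metis
  have "period f = r" unfolding period_def by (rule C.the_period[OF r])
  then have "(\<lambda>n. root (period f * n) (Cst (f ^ (period f * n)))) \<longlonglongrightarrow> conifold_value f"
    using C.root_tendsto[OF r] by (simp add: conifold_value_eq)
  then show ?thesis
    using L.radius_eq L.monodromy unfolding Let_def conifold_value_eq L.p_def by blast
qed

end
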